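(* Let $V$ belong to the class $\mathfrak C$ (defined in the context, with associated constant $V^*>0$ and set $B$), and consider collapsing scalar field solutions $(a,\phi)$ with initial data $(\phi(0),\dot\phi(0))$ such that $\phi(0)\in B$ and $\dot\phi(0)^2+2V(\phi(0))\ge0$. Except at most for a set of initial data of measure zero, the scalar field model matched with the generalized Vaidya solution along $r=r_b$ collapses to a black hole.
   Context: Class $\mathfrak V$: functions $V:\mathbb R\to\mathbb R$ such that (i) $V$ is $C^2$ and bounded from below; (ii) the critical points of $V$ are isolated, and each is either a (local) minimum point or a nondegenerate (local) maximum point. Class $\mathfrak C$: functions $V\in\mathfrak V$ for which there is a constant $V^*>0$ such that the set $B:=\{\phi\in\mathbb R: V(\phi)\le V^*\}$ is bounded, $V'(\phi)>0$ for all $\phi\ge\sup B$, $V'(\phi)<0$ for all $\phi\le\inf B$, and such that the function $u(\phi):=\frac{V'(\phi)}{2\sqrt3\,V(\phi)}$ (defined for large $|\phi|$) satisfies $\limsup_{\phi\to\pm\infty}|u(\phi)|<1$ and $\lim_{\phi\to\pm\infty}u'(\phi)$ exists and equals $0$. A constant $V^*>0$ such that $B=\{\phi\in\mathbb R: V(\phi)\le V^*\}$ is bounded, $V'(\phi)>0$ for all $\phi\ge\sup B$ and $V'(\phi)<0$ for all $\phi\le\inf B$ is fixed. Interior: the metric is $g=-dt^2+a^2(t)(dr^2+r^2d\Omega^2)$, $0\le r\le r_b$ (spatially flat), with $a(0)>0$, and with $\epsilon=\dot\phi^2+2V(\phi)$ the pair $(a,\phi)$ solves the collapsing equations $$\frac{\dot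 a}{a}=-\sqrt{\frac{\epsilon}{3}},\qquad \ddot\phi+V'(\phi)=\sqrt3\sqrt{\epsilon}\,\dot\phi$$ (the Einstein equations $3\dot a^2/a^2=\dot\phi^2+2V(\phi)$, $(\dot a^2+2a\ddot a)/a^2=-(\dot\phi^2-2V(\phi))$ with $\dot a<0$; functions with non-constant $\phi$ and $\epsilon\equiv0$ on an interval are not solutions of the Einstein equations and are not considered). The singularity time is $t_s=\sup$ of the maximal interval of existence to the right of $t=0$. Exterior: the generalized Vaidya metric $$ds^2_{\rm ext}=-\Bigl(1-\frac{2M(U,Y)}{Y}\Bigr)dU^2-2\,dY\,dU+Y^2d\Omega^2,$$ with $M$ a positive function, matched along the hypersurface $\Sigma=\{r=r_b\}$, $r_b>0$ constant, through the Israel junction conditions $$M(U(t),Y(t))=\tfrac12 r_b^3\,a(t)\dot a(t)^2,\qquad \frac{\partial M}{\partial Y}(U(t),Y(t))=\tfrac12 r_b^2\bigl(\dot a(t)^2+2a(t)\ddot a(t)\bigr),$$ where $Y(t)=r_b a(t)$ and $\frac{dU}{dt}(t)=\frac{1}{1+\dot a(t)r_b}$. Endstate: the apparent horizon of the interior metric is given by $r^2\dot a(t)^2=1$, and the region $r^2\dot a(t)^2>1$ is trapped. If $\dot a^2$ stays bounded up to $t_s$, then for $r_b$ small enough no apparent horizon forms and the singularity is naked. The model "collapses to a black hole" when a singularity forms at a finite time $t_s$ (with $\epsilon\to+\infty$ and $a\to0$ as $t\to t_s^-$) and $\dot a^2$ is unbounded as $t\to t_s^-$, so that, whatever the value of $r_b>0$,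 the trapped region forms before the singularity. Measure zero refers to Lebesgue measure on the set of initial data $(\phi(0),\dot\phi(0))\in\mathbb R^2$. *)

theory Defs
  imports "HOL-Analysis.Analysis"
begin

section \<open>Potentials\<close>

definition class_V :: "(real \<Rightarrow> real) set" where
  "class_V = {V.
     V C1_differentiable_on UNIV \<and> deriv V C1_differentiable_on UNIV \<and>
     bdd_below (range V) \<and>
     discrete {x. deriv V x = 0} \<and>
     (\<forall>x. deriv V x = 0 \<longrightarrow>
        (\<forall>\<^sub>F y in at x. V x \<le> V y) \<or>
        ((\<forall>\<^sub>F y in at x. V y \<le> V x) \<and> deriv (deriv V) x \<noteq> 0))}"

definition sublevel :: "(real \<Rightarrow> real) \<Rightarrow> real \<Rightarrow> real set" where
  "sublevel V c = {x. V x \<le> c}"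

text \<open>Nonemptiness of the sublevel set is implicit in the sign conditions on the derivative: with
  the conventions that the supremum and infimum of the empty set are minus and plus infinity, they
  would be contradictory for an empty set. It is explicit here because \<^term>\<open>Sup\<close> and
  \<^term>\<open>Inf\<close> of an empty set of reals are unspecified reals.\<close>

definition admissible_level :: "(real \<Rightarrow> real) \<Rightarrow> real \<Rightarrow> bool" where
  "admissible_level V c \<longleftrightarrow>
     c > 0 \<and> sublevel V c \<noteq> {} \<and> bounded (sublevel V c) \<and>
     (\<forall>x \<ge> Sup (sublevel V c). deriv V x > 0) \<and>
     (\<forall>x \<le> Inf (sublevel V c). deriv V x < 0)"

definition u_fun :: "(real \<Rightarrow> real) \<Rightarrow> real \<Rightarrow> real" where
  "u_fun V x = deriv V x / (2 * sqrt 3 * V x)"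

text \<open>Outside the bounded sublevel set of an admissible level one has \<open>V > 0\<close>, so
  \<^term>\<open>u_fun V\<close> is a genuine \<open>C\<^sup>1\<close> function near plus and minus infinity.\<close>

definition class_C :: "(real \<Rightarrow> real) set" where
  "class_C = {V \<in> class_V.
     (\<exists>c. admissible_level V c) \<and>
     Limsup at_top (\<lambda>x. ereal \<bar>u_fun V x\<bar>) < 1 \<and>
     Limsup at_bot (\<lambda>x. ereal \<bar>u_fun V x\<bar>) < 1 \<and>
     (deriv (u_fun V) \<longlongrightarrow> 0) at_top \<and>
     (deriv (u_fun V) \<longlongrightarrow> 0) at_bot}"


section \<open>Collapsing interior solutions\<close>

definition life :: "ereal \<Rightarrow> real set" where
  "life T = {t. 0 \<le> t \<and> ereal t < T}"

text \<open>Time derivative along \<^term>\<open>life T\<close>; it is one-sided at the initial time \<open>0\<close>.\<close>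

definition ddt :: "ereal \<Rightarrow> (real \<Rightarrow> real) \<Rightarrow> real \<Rightarrow> real" where
  "ddt T f t = vector_derivative f (at t within life T)"

definition energy :: "(real \<Rightarrow> real) \<Rightarrow> ereal \<Rightarrow> (real \<Rightarrow> real) \<Rightarrow> real \<Rightarrow> real" where
  "energy V T \<phi> t = (ddt T \<phi> t)\<^sup>2 + 2 * V (\<phi> t)"

text \<open>Solutions of the collapsing equations on \<open>[0, T)\<close>. The condition \<open>energy \<ge> 0\<close> is the domain
  of the square roots (\<^term>\<open>sqrt\<close> is odd on the negative axis). The last clause discards
  the functions with nonconstant \<open>\<phi>\<close> and identically vanishing energy on an interval, which satisfy
  the collapsing equations but not the Einstein equations.\<close>

definition collapsing_solution ::
  "(real \<Rightarrow> real) \<Rightarrow> ereal \<Rightarrow> (real \<Rightarrow> real) \<Rightarrow> (real \<Rightarrow> real) \<Rightarrow> bool" where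
  "collapsing_solution V T a \<phi> \<longleftrightarrow>
     0 < T \<and>
     a differentiable_on life T \<and> \<phi> differentiable_on life T \<and>
     ddt T \<phi> differentiable_on life T \<and>
     (\<forall>t \<in> life T.
        a t > 0 \<and> energy V T \<phi> t \<ge> 0 \<and>
        ddt T a t / a t = - sqrt (energy V T \<phi> t / 3) \<and>
        ddt T (ddt T \<phi>) t + deriv V (\<phi> t) = sqrt 3 * sqrt (energy V T \<phi> t) * ddt T \<phi> t) \<and>
     (\<forall>c d. c < d \<longrightarrow> {c..d} \<subseteq> life T \<longrightarrow> (\<forall>t \<in> {c..d}. energy V T \<phi> t = 0) \<longrightarrow>
        \<phi> constant_on {c..d})"

text \<open>Here \<open>T\<close>, the right end of the maximal interval of existence, is the time \<open>t\<^sub>s\<close>.\<close>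

definition maximal_collapsing_solution ::
  "(real \<Rightarrow> real) \<Rightarrow> ereal \<Rightarrow> (real \<Rightarrow> real) \<Rightarrow> (real \<Rightarrow> real) \<Rightarrow> bool" where
  "maximal_collapsing_solution V T a \<phi> \<longleftrightarrow>
     collapsing_solution V T a \<phi> \<and>
     \<not> (\<exists>T' a' \<phi>'. T < T' \<and> collapsing_solution V T' a' \<phi>' \<and>
          (\<forall>t \<in> life T. a' t = a t \<and> \<phi>' t = \<phi> t))"


section \<open>Matching with a generalized Vaidya exterior\<close>

text \<open>The exterior metric
  \<open>- (1 - 2 M(U,Y) / Y) dU\<^sup>2 - 2 dY dU + Y\<^sup>2 d\<Omega>\<^sup>2\<close>, on the domain \<open>Y > 0\<close>, is given by its
  positive mass function \<open>M\<close>, and it is joined to the interior metric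
  \<open>- dt\<^sup>2 + a\<^sup>2 (dr\<^sup>2 + r\<^sup>2 d\<Omega>\<^sup>2)\<close> along \<open>r = r\<^sub>b\<close> by the Israel junction conditions.
  The equation \<open>dU/dt = 1 / (1 + a' r\<^sub>b)\<close> has a non-integrable pole when the boundary crosses the
  apparent horizon (\<open>1 + a' r\<^sub>b = 0\<close>): the coordinate \<open>U\<close> diverges there, so the conditions
  are meaningful, and are imposed, exactly at the other times. Imposing them at all times would,
  with \<open>1 / 0 = 0\<close>, be unsatisfiable for any model whose boundary crosses the horizon.\<close>

definition vaidya_matching ::
  "ereal \<Rightarrow> (real \<Rightarrow> real) \<Rightarrow> real \<Rightarrow> (real \<Rightarrow> real \<Rightarrow> real) \<Rightarrow> (real \<Rightarrow> real) \<Rightarrow> bool" where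
  "vaidya_matching T a r\<^sub>b M U \<longleftrightarrow>
     r\<^sub>b > 0 \<and> (\<forall>w y. y > 0 \<longrightarrow> M w y > 0) \<and>
     (\<forall>t \<in> life T. 1 + ddt T a t * r\<^sub>b \<noteq> 0 \<longrightarrow>
        (U has_real_derivative 1 / (1 + ddt T a t * r\<^sub>b)) (at t within life T) \<and>
        M (U t) (r\<^sub>b * a t) = 1 / 2 * r\<^sub>b ^ 3 * a t * (ddt T a t)\<^sup>2 \<and>
        ((\<lambda>y. M (U t) y) has_real_derivative
           1 / 2 * r\<^sub>b\<^sup>2 * ((ddt T a t)\<^sup>2 + 2 * a t * ddt T (ddt T a) t)) (at (r\<^sub>b * a t)))"


section \<open>Endstate\<close>

definition trapped_at :: "ereal \<Rightarrow> (real \<Rightarrow> real) \<Rightarrow> real \<Rightarrow> real \<Rightarrow> bool" where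
  "trapped_at T a r t \<longleftrightarrow> r\<^sup>2 * (ddt T a t)\<^sup>2 > 1"

definition collapses_to_black_hole ::
  "(real \<Rightarrow> real) \<Rightarrow> ereal \<Rightarrow> (real \<Rightarrow> real) \<Rightarrow> (real \<Rightarrow> real) \<Rightarrow> bool" where
  "collapses_to_black_hole V T a \<phi> \<longleftrightarrow>
     (\<exists>t\<^sub>s. T = ereal t\<^sub>s \<and>
        filterlim (energy V T \<phi>) at_top (at_left t\<^sub>s) \<and>
        (a \<longlongrightarrow> 0) (at_left t\<^sub>s) \<and>
        (\<forall>K. \<exists>\<^sub>F t in at_left t\<^sub>s. (ddt T a t)\<^sup>2 > K)) \<and>
     (\<forall>R > 0. \<exists>t \<in> life T. \<exists>r \<in> {0..R}. trapped_at T a r t)"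

end

theory Submission
  imports Defs
begin

text \<open>
  Let \<open>W = V'\<close>, \<open>v = \<phi>'\<close> and \<open>h = sqrt \<epsilon>\<close>. The equations become \<open>v' = sqrt 3 h v - W(\<phi>)\<close> and
  \<open>h' = sqrt 3 v\<^sup>2\<close>: the friction has the wrong sign, so the energy grows and neighbouring orbits
  separate. An orbit that fails to blow up must stay balanced on an unstable branch for all time,
  and the proof consists in showing that there are only countably many such branches, each of which
  is followed by essentially one orbit.

  Dichotomy. If \<open>h\<close> is bounded, then the orbit exists for all times (\<open>bounded_energy_continues\<close>),
  \<open>v\<close> tends to \<open>0\<close> and \<open>\<phi>\<close> tends to a critical point or to \<open>\<plusminus>\<infinity>\<close>. As \<open>\<epsilon>\<close> increases to its limit
  \<open>2 V(p)\<close>, the orbit must be at rest if \<open>p\<close> is a minimum; otherwise it climbs slowly to a maximum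
  or towards an infinite end (\<open>bounded_orbit_exceptional\<close>). If \<open>h\<close> is unbounded, put \<open>x = v / h\<close>.
  Where \<open>V > 0\<close>, one has \<open>x' = sqrt 3 h (1 - x\<^sup>2) (x - u)\<close> with \<open>u = W / (2 sqrt 3 V)\<close>, and
  \<open>\<bar>u\<bar> \<le> \<rho> < 1\<close> near infinity. For given \<open>\<kappa>\<close> between \<open>\<rho>\<close> and \<open>1\<close>, either finally \<open>\<bar>x\<bar> \<ge> \<kappa>\<close>, or
  \<open>\<phi> \<rightarrow> \<plusminus>\<infinity>\<close> and \<open>x - u \<rightarrow> 0\<close> (\<open>unbounded_orbit_exceptional_or_fast\<close>); here \<open>u' \<rightarrow> 0\<close> enters.

  Collapse. If finally \<open>\<bar>x\<bar> \<ge> \<kappa>\<close> with \<open>\<kappa>\<^sup>2 \<ge> 1/2\<close>, then \<open>h' \<ge> sqrt 3 \<kappa>\<^sup>2 h\<^sup>2\<close>, so that \<open>h\<close>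
  blows up in finite time, and comparison of \<open>a' = - a h / sqrt 3\<close> with \<open>h'\<close> yields \<open>a \<rightarrow> 0\<close> and \<open>a h \<rightarrow> \<infinity>\<close>. The latter says that
  \<open>a'\<^sup>2 = a\<^sup>2 \<epsilon> / 3\<close> is unbounded.

  Measure zero. Two exceptional orbits of the same kind, viewed as graphs over \<open>\<phi>\<close>, separate in
  the direction of motion, while they approach the same branch; so they have to meet
  (\<open>climbing_orbits_meet\<close>). By uniqueness backwards in time, the initial data of a kind then lie,
  but for one point, on countably many orbits, and are negligible
  (\<open>meeting_orbits_negligible\<close>). The critical points being isolated, there are countably many kinds. Data of zero energy, where the vector field
  is not Lipschitz, form a null set by Fubini's theorem.
\<close>

section \<open>Calculus on the lifetime\<close>

lemma life_downward_closed: "0 \<le> s \<Longrightarrow> s \<le> t \<Longrightarrow> t \<in> life T \<Longrightarrow> s \<in> life T"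
  unfolding life_def using ereal_less_eq(3) order.strict_trans1 by blast

lemma life_Icc: "0 \<le> s \<Longrightarrow> t \<in> life T \<Longrightarrow> {s..t} \<subseteq> life T"
  using life_downward_closed by (meson atLeastAtMost_iff order_trans subsetI)

lemma life_nonneg: "t \<in> life T \<Longrightarrow> 0 \<le> t"
  by (simp add: life_def)

lemma life_max: "s \<in> life T \<Longrightarrow> t \<in> life T \<Longrightarrow> max s t \<in> life T"
  by (simp add: max_def)

lemma life_later:
  assumes "t \<in> life T" obtains t' where "t < t'" "t' \<in> life T"
proof -
  have "ereal t < T" "0 \<le> t" using assms by (auto simp: life_def)
  then obtain q where "ereal t < q" "q < T" using dense by blast
  then obtain r where "q = ereal r" by (cases q) auto
  with \<open>ereal t < q\<close> \<open>q < T\<close> \<open>0 \<le> t\<close> show ?thesis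
    by (intro that[of r]) (auto simp: life_def)
qed

lemma nondecreasing_of_deriv_nonneg:
  fixes f :: "real \<Rightarrow> real"
  assumes "s \<le> t" "{s..t} \<subseteq> A"
    and f: "\<And>r. s \<le> r \<Longrightarrow> r \<le> t \<Longrightarrow> (f has_real_derivative f' r) (at r within A)"
    and nonneg: "\<And>r. s \<le> r \<Longrightarrow> r \<le> t \<Longrightarrow> 0 \<le> f' r"
  shows "f s \<le> f t"
proof (cases "s = t")
  case False
  then have "s < t" using assms(1) by simp
  moreover have "(f has_derivative (\<lambda>y. y * f' r)) (at r within {s..t})" if "s \<le> r" "r \<le> t" for r
    using DERIV_subset[OF f[OF that] assms(2)] by (simp add: has_field_derivative_def mult_commute_abs)
  ultimately obtain r where "r \<in> {s<..<t}" "f t - f s = (t - s) * f' r"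
    using mvt_simple[of s t f "\<lambda>r y. y * f' r"] by auto
  moreover have "0 \<le> (t - s) * f' r" using \<open>s < t\<close> nonneg[of r] calculation(1) by simp
  ultimately show ?thesis by linarith
qed simp

text \<open>At the last time with \<open>f = b\<close> before falling below \<open>b\<close>, \<open>f\<close> would be pushed upwards. All the trapping regions below are obtained in this way.\<close>

lemma barrier:
  fixes f :: "real \<Rightarrow> real"
  assumes "s \<le> t" "{s..t} \<subseteq> A"
    and f: "\<And>r. s \<le> r \<Longrightarrow> r \<le> t \<Longrightarrow> (f has_real_derivative f' r) (at r within A)"
    and start: "b \<le> f s"
    and push: "\<And>r. s \<le> r \<Longrightarrow> r \<le> t \<Longrightarrow> f r = b \<Longrightarrow> 0 < f' r"
  shows "b \<le> f t"
proof (rule ccontr)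
  assume "\<not> b \<le> f t"
  then have ft: "f t < b" by simp
  have cont: "continuous_on {s..t} f"
    by (rule DERIV_continuous_on[where D=f'])
       (use f assms(2) in \<open>auto intro: DERIV_subset\<close>)
  define C where "C = {s..t} \<inter> f -` {b..}"
  have "closed C" unfolding C_def
    by (rule continuous_closed_preimage[OF cont]) auto
  moreover have "s \<in> C" using start assms(1) by (simp add: C_def)
  moreover have bdd: "bdd_above C" unfolding C_def by (rule bdd_above_mono[of "{s..t}"]) auto
  ultimately have last: "Sup C \<in> C" using closed_contains_Sup[of C] by blast
  define r where "r = Sup C"
  have r: "s \<le> r" "r \<le> t" "b \<le> f r" using last by (auto simp: C_def r_def)
  have rt: "r < t" using r ft by (cases "r = t") auto
  have above: "f x < b" if "r < x" "x \<le> t" for x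
  proof (rule ccontr)
    assume "\<not> f x < b"
    then have "x \<in> C" using that r by (auto simp: C_def)
    then show False using cSup_upper[OF _ bdd, of x] that by (simp add: r_def)
  qed
  have "f r = b"
  proof (rule ccontr)
    assume "f r \<noteq> b"
    then have "b < f r" using r by simp
    have "continuous_on {r..t} f" using cont by (rule continuous_on_subset) (use r in auto)
    then obtain x where "r \<le> x" "x \<le> t" "f x = b"
      using IVT2'[of f t b r] ft \<open>b < f r\<close> rt by auto
    then show False using above[of x] \<open>f r \<noteq> b\<close> by (cases "x = r") auto
  qed
  then have "0 < f' r" using push r by auto
  then obtain d where "d > 0" and d: "\<And>h. 0 < h \<Longrightarrow> r + h \<in> A \<Longrightarrow> h < d \<Longrightarrow> f r < f (r + h)"
    using has_real_derivative_pos_inc_right[OF f[OF r(1,2)]] by blast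
  define h where "h = min (d/2) (t - r)"
  have "0 < h" "h < d" "r + h \<le> t" using \<open>d > 0\<close> rt by (auto simp: h_def)
  moreover have "r + h \<in> A" using calculation r assms(2) by auto
  ultimately show False using d[of h] above[of "r+h"] \<open>f r = b\<close> by auto
qed

lemma bounded_on_Icc:
  fixes f :: "real \<Rightarrow> real"
  assumes "continuous_on {a..b} f" shows "\<exists>B. \<forall>x\<in>{a..b}. \<bar>f x\<bar> \<le> B"
  using compact_imp_bounded[OF compact_continuous_image[OF assms compact_Icc]] by (auto simp: bounded_iff)

section \<open>Orbits in the phase space\<close>

text \<open>In the variables \<open>\<phi>\<close>, \<open>v = \<phi>'\<close>, \<open>h = sqrt \<epsilon>\<close>, the square root disappears from the
  equation of motion: \<open>h' = sqrt 3 v\<^sup>2\<close>, and the vector field is a polynomial in \<open>v\<close>, \<open>h\<close>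
  plus the force \<open>W = V'\<close>. The condition \<open>h > 0\<close> leaves out the data of zero energy.\<close>

definition orbit ::
  "(real \<Rightarrow> real) \<Rightarrow> (real \<Rightarrow> real) \<Rightarrow> ereal \<Rightarrow> (real \<Rightarrow> real) \<Rightarrow> (real \<Rightarrow> real) \<Rightarrow> (real \<Rightarrow> real) \<Rightarrow> bool"
  where
  "orbit V W T \<phi> v h \<longleftrightarrow> 0 < T \<and> (\<forall>t \<in> life T.
     (\<phi> has_real_derivative v t) (at t within life T) \<and>
     (v has_real_derivative sqrt 3 * h t * v t - W (\<phi> t)) (at t within life T) \<and>
     (h has_real_derivative sqrt 3 * (v t)\<^sup>2) (at t within life T) \<and>
     (h t)\<^sup>2 = (v t)\<^sup>2 + 2 * V (\<phi> t) \<and> 0 < h t)"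

lemma orbitD:
  assumes "orbit V W T \<phi> v h" "t \<in> life T"
  shows "(\<phi> has_real_derivative v t) (at t within life T)"
    "(v has_real_derivative sqrt 3 * h t * v t - W (\<phi> t)) (at t within life T)"
    "(h has_real_derivative sqrt 3 * (v t)\<^sup>2) (at t within life T)"
    "(h t)\<^sup>2 = (v t)\<^sup>2 + 2 * V (\<phi> t)" "0 < h t"
  using assms by (auto simp: orbit_def)

lemma orbit_zero_mem: "orbit V W T \<phi> v h \<Longrightarrow> 0 \<in> life T"
  by (simp add: orbit_def life_def zero_ereal_def)

lemma orbit_h_mono:
  assumes "orbit V W T \<phi> v h" "0 \<le> s" "s \<le> t" "t \<in> life T"
  shows "h s \<le> h t"
  by (rule nondecreasing_of_deriv_nonneg[of s t "life T" h "\<lambda>r. sqrt 3 * (v r)\<^sup>2"])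
     (use assms orbitD(3)[OF assms(1)] life_Icc[OF assms(2,4)] in auto)

lemma orbit_continuous:
  assumes "orbit V W T \<phi> v h"
  shows "continuous_on (life T) \<phi>" "continuous_on (life T) v" "continuous_on (life T) h"
  using orbitD[OF assms] by (auto intro!: DERIV_continuous_on)

text \<open>The reflection \<open>\<phi> \<mapsto> - \<phi>\<close> turns everything said about the right end of the real line
  into a statement about the left end.\<close>

lemma orbit_reflect:
  assumes "orbit V W T \<phi> v h"
  shows "orbit (\<lambda>x. V (- x)) (\<lambda>x. - W (- x)) T (\<lambda>t. - \<phi> t) (\<lambda>t. - v t) h"
proof -
  have "((\<lambda>t. - v t) has_real_derivative sqrt 3 * h t * - v t - - W (- (- \<phi> t))) (at t within life T)"
    if "t \<in> life T" for t
    using DERIV_minus[OF orbitD(2)[OF assms that]] by simp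
  then show ?thesis using assms by (auto simp: orbit_def intro: DERIV_minus)
qed

lemma sqrt3_bounds: "1 \<le> sqrt 3" "sqrt 3 \<le> (2::real)"
  by (auto intro!: real_le_rsqrt real_le_lsqrt)

lemma norm4_le: "norm (a, b, c, d) \<le> \<bar>a\<bar> + \<bar>b\<bar> + \<bar>c\<bar> + \<bar>d\<bar>" for a b c d :: real
  using norm_Pair_le[of a "(b, c, d)"] norm_Pair_le[of b "(c, d)"] norm_Pair_le[of c d] by simp

lemma abs_le_norm4:
  "\<bar>a\<bar> \<le> norm (a, b, c, d) \<and> \<bar>b\<bar> \<le> norm (a, b, c, d) \<and> \<bar>c\<bar> \<le> norm (a, b, c, d)"
  for a b c d :: real
  using norm_fst_le[of a "(b, c, d)"] norm_snd_le[of "(b, c, d)" a] norm_fst_le[of b "(c, d)"]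
    norm_snd_le[of "(c, d)" b] norm_fst_le[of c d] by (auto intro: order_trans)

text \<open>The equations for the state \<open>(\<phi>, v, h, ln a)\<close>. With the logarithm, the positivity of the scale
  factor need not be monitored, and \<open>W\<close> is the only nonpolynomial term.\<close>

definition collapse_field :: "(real \<Rightarrow> real) \<Rightarrow> real \<times> real \<times> real \<times> real \<Rightarrow> real \<times> real \<times> real \<times> real" where
  "collapse_field W = (\<lambda>(\<phi>, v, h, l). (v, sqrt 3 * h * v - W \<phi>, sqrt 3 * v\<^sup>2, - (h / sqrt 3)))"

lemma continuous_collapse_field:
  assumes "continuous_on UNIV W" shows "continuous_on UNIV (collapse_field W)"
  unfolding collapse_field_def split_beta
  by (intro continuous_intros continuous_on_compose2[OF assms]) auto

lemma collapse_field_lipschitz: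
  fixes W W' :: "real \<Rightarrow> real"
  assumes W: "\<And>x. (W has_real_derivative W' x) (at x)" and W': "continuous_on UNIV W'"
  shows "\<exists>L. L-lipschitz_on (cball p r) (collapse_field W)"
proof -
  define B where "B = norm p + \<bar>r\<bar>"
  have nB: "norm x \<le> B" if "x \<in> cball p r" for x
    using that norm_triangle_ineq[of p "x - p"] by (simp add: B_def dist_norm norm_minus_commute)
  obtain L0 where L0: "\<forall>x\<in>{-B..B}. \<bar>W' x\<bar> \<le> L0"
    using bounded_on_Icc[OF continuous_on_subset[OF W']] by blast
  define L where "L = max L0 0"
  have B0: "0 \<le> B" by (simp add: B_def)
  have s3: "sqrt 3 \<le> (2::real)" by (rule sqrt3_bounds)
  have "dist (collapse_field W x) (collapse_field W y) \<le> (2 + L + 8 * B) * dist x y"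
    if xy: "x \<in> cball p r" "y \<in> cball p r" for x y
  proof -
    obtain \<phi>1 v1 h1 l1 where x: "x = (\<phi>1, v1, h1, l1)" by (cases x)
    obtain \<phi>2 v2 h2 l2 where y: "y = (\<phi>2, v2, h2, l2)" by (cases y)
    define \<delta> where "\<delta> = norm (\<phi>1 - \<phi>2, v1 - v2, h1 - h2, l1 - l2)"
    have \<delta>: "dist x y = \<delta>" by (simp add: x y dist_norm \<delta>_def)
    have d: "\<bar>\<phi>1 - \<phi>2\<bar> \<le> \<delta>" "\<bar>v1 - v2\<bar> \<le> \<delta>" "\<bar>h1 - h2\<bar> \<le> \<delta>" using abs_le_norm4 unfolding \<delta>_def by auto
    have n: "norm x \<le> B" "norm y \<le> B" using nB xy by auto
    have bd: "\<bar>\<phi>1\<bar> \<le> B" "\<bar>v1\<bar> \<le> B" "\<bar>h1\<bar> \<le> B" "\<bar>\<phi>2\<bar> \<le> B" "\<bar>v2\<bar> \<le> B" "\<bar>h2\<bar> \<le> B"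
      using abs_le_norm4[of \<phi>1 v1 h1 l1] abs_le_norm4[of \<phi>2 v2 h2 l2] n unfolding x y by auto
    have "norm (W \<phi>1 - W \<phi>2) \<le> L * norm (\<phi>1 - \<phi>2)"
    proof (rule field_differentiable_bound[of "{-B..B}" W W'])
      show "norm (W' z) \<le> L" if "z \<in> {-B..B}" for z using L0 that by (simp add: L_def le_max_iff_disj)
    qed (use bd W in \<open>auto intro: has_field_derivative_at_within simp: abs_le_iff\<close>)
    then have w: "\<bar>W \<phi>1 - W \<phi>2\<bar> \<le> L * \<delta>"
      using d(1) mult_left_mono[of "\<bar>\<phi>1 - \<phi>2\<bar>" \<delta> L] by (simp add: L_def)
    have "h1 * v1 - h2 * v2 = h1 * (v1 - v2) + v2 * (h1 - h2)" by (simp add: algebra_simps)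
    then have "\<bar>h1 * v1 - h2 * v2\<bar> \<le> \<bar>h1\<bar> * \<bar>v1 - v2\<bar> + \<bar>v2\<bar> * \<bar>h1 - h2\<bar>"
      unfolding abs_mult[symmetric] by (metis abs_triangle_ineq)
    also have "\<dots> \<le> B * \<delta> + B * \<delta>" 
      by (rule add_mono[OF mult_mono[OF bd(3) d(2) B0 abs_ge_zero] mult_mono[OF bd(5) d(3) B0 abs_ge_zero]])
    finally have hv: "sqrt 3 * \<bar>h1 * v1 - h2 * v2\<bar> \<le> 2 * (B * \<delta> + B * \<delta>)"
      using s3 by (intro mult_mono) auto
    have "\<bar>sqrt 3 * h1 * v1 - W \<phi>1 - (sqrt 3 * h2 * v2 - W \<phi>2)\<bar> = \<bar>sqrt 3 * (h1 * v1 - h2 * v2) - (W \<phi>1 - W \<phi>2)\<bar>"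
      by (simp add: algebra_simps)
    also have "\<dots> \<le> \<bar>sqrt 3 * (h1 * v1 - h2 * v2)\<bar> + \<bar>W \<phi>1 - W \<phi>2\<bar>" by (rule abs_triangle_ineq4)
    also have "\<bar>sqrt 3 * (h1 * v1 - h2 * v2)\<bar> = sqrt 3 * \<bar>h1 * v1 - h2 * v2\<bar>" by (simp add: abs_mult)
    also have "sqrt 3 * \<bar>h1 * v1 - h2 * v2\<bar> + \<bar>W \<phi>1 - W \<phi>2\<bar> \<le> 2 * (B * \<delta> + B * \<delta>) + L * \<delta>"
      by (rule add_mono[OF hv w])
    finally have t2: "\<bar>sqrt 3 * h1 * v1 - W \<phi>1 - (sqrt 3 * h2 * v2 - W \<phi>2)\<bar> \<le> 4 * (B * \<delta>) + L * \<delta>"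
      by simp
    have "\<bar>v1\<^sup>2 - v2\<^sup>2\<bar> = \<bar>v1 + v2\<bar> * \<bar>v1 - v2\<bar>"
      unfolding abs_mult[symmetric] by (simp add: power2_eq_square algebra_simps)
    also have "\<dots> \<le> (2 * B) * \<delta>"
    proof (rule mult_mono)
      show "\<bar>v1 + v2\<bar> \<le> 2 * B" using bd by linarith
    qed (use d B0 in auto)
    finally have "sqrt 3 * \<bar>v1\<^sup>2 - v2\<^sup>2\<bar> \<le> 2 * ((2 * B) * \<delta>)" using s3 by (intro mult_mono) auto
    then have t3: "\<bar>sqrt 3 * v1\<^sup>2 - sqrt 3 * v2\<^sup>2\<bar> \<le> 4 * (B * \<delta>)"
      by (simp add: abs_mult flip: right_diff_distrib)
    have "\<bar>h1 - h2\<bar> / sqrt 3 \<le> \<bar>h1 - h2\<bar> / 1" using sqrt3_bounds by (intro divide_left_mono) auto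
    then have t4: "\<bar>- (h1 / sqrt 3) - - (h2 / sqrt 3)\<bar> \<le> \<delta>"
      using d(3) by (simp add: abs_minus_commute abs_divide flip: diff_divide_distrib)
    have "dist (collapse_field W x) (collapse_field W y) \<le> \<bar>v1 - v2\<bar> +
        \<bar>sqrt 3 * h1 * v1 - W \<phi>1 - (sqrt 3 * h2 * v2 - W \<phi>2)\<bar> + \<bar>sqrt 3 * v1\<^sup>2 - sqrt 3 * v2\<^sup>2\<bar> +
        \<bar>- (h1 / sqrt 3) - - (h2 / sqrt 3)\<bar>"
      unfolding x y collapse_field_def dist_norm prod.case diff_Pair by (rule norm4_le)
    also have "\<dots> \<le> \<delta> + (4 * (B * \<delta>) + L * \<delta>) + 4 * (B * \<delta>) + \<delta>" using d(2) t2 t3 t4 by linarith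
    also have "\<dots> = (2 + L + 8 * B) * dist x y" unfolding \<delta> by (simp add: algebra_simps)
    finally show ?thesis .
  qed
  moreover have "0 \<le> 2 + L + 8 * B" using B0 by (simp add: L_def)
  ultimately show ?thesis by (intro exI[of _ "2 + L + 8 * B"] lipschitz_onI)
qed

text \<open>Two trajectories that meet have the same past: the squared distance \<open>D\<close> of the two states
  satisfies \<open>D' \<ge> - C D\<close>, because the field is Lipschitz on bounded sets. The last component of
  the field does not influence the others, and is evaluated at \<open>0\<close>.\<close>

lemma trajectories_same_past:
  fixes W W' :: "real \<Rightarrow> real"
  assumes W: "\<And>x. (W has_real_derivative W' x) (at x)" and W': "continuous_on UNIV W'"
    and d1: "\<And>s. s \<in> {0..m} \<Longrightarrow> (\<phi>1 has_real_derivative v1 s) (at s within {0..m})"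
      "\<And>s. s \<in> {0..m} \<Longrightarrow> (v1 has_real_derivative sqrt 3 * h1 s * v1 s - W (\<phi>1 s)) (at s within {0..m})"
      "\<And>s. s \<in> {0..m} \<Longrightarrow> (h1 has_real_derivative sqrt 3 * (v1 s)\<^sup>2) (at s within {0..m})"
    and d2: "\<And>s. s \<in> {0..m} \<Longrightarrow> (\<phi>2 has_real_derivative v2 s) (at s within {0..m})"
      "\<And>s. s \<in> {0..m} \<Longrightarrow> (v2 has_real_derivative sqrt 3 * h2 s * v2 s - W (\<phi>2 s)) (at s within {0..m})"
      "\<And>s. s \<in> {0..m} \<Longrightarrow> (h2 has_real_derivative sqrt 3 * (v2 s)\<^sup>2) (at s within {0..m})"
    and meet: "\<phi>1 m = \<phi>2 m" "v1 m = v2 m" "h1 m = h2 m"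
    and s: "s \<in> {0..m}"
  shows "\<phi>1 s = \<phi>2 s \<and> v1 s = v2 s"
proof -
  have cont: "continuous_on {0..m} \<phi>1" "continuous_on {0..m} v1" "continuous_on {0..m} h1"
     "continuous_on {0..m} \<phi>2" "continuous_on {0..m} v2" "continuous_on {0..m} h2"
    using DERIV_continuous_on[OF d1(1)] DERIV_continuous_on[OF d1(2)] DERIV_continuous_on[OF d1(3)]
      DERIV_continuous_on[OF d2(1)] DERIV_continuous_on[OF d2(2)] DERIV_continuous_on[OF d2(3)] by auto
  have "bounded (\<phi>1 ` {0..m} \<union> \<phi>2 ` {0..m} \<union> v1 ` {0..m} \<union> v2 ` {0..m} \<union> h1 ` {0..m} \<union> h2 ` {0..m})"
    using cont by (auto simp: bounded_Un intro!: compact_imp_bounded compact_continuous_image)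
  then obtain B where B: "\<And>y. y \<in> \<phi>1 ` {0..m} \<union> \<phi>2 ` {0..m} \<union> v1 ` {0..m} \<union> v2 ` {0..m} \<union> h1 ` {0..m} \<union> h2 ` {0..m}
      \<Longrightarrow> \<bar>y\<bar> \<le> B"
    unfolding bounded_iff by (metis real_norm_def)
  have BB: "\<bar>\<phi>1 s\<bar> \<le> B" "\<bar>\<phi>2 s\<bar> \<le> B" "\<bar>v1 s\<bar> \<le> B" "\<bar>v2 s\<bar> \<le> B" "\<bar>h1 s\<bar> \<le> B" "\<bar>h2 s\<bar> \<le> B"
    if "s\<in>{0..m}" for s
    using that by (auto intro!: B)
  obtain L where L: "L-lipschitz_on (cball 0 (3 * B)) (collapse_field W)"
    using collapse_field_lipschitz[OF W W'] by blast
  define N where "N s = norm (\<phi>1 s - \<phi>2 s, v1 s - v2 s, h1 s - h2 s, 0::real)" for s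
  define D where "D = (\<lambda>s. (\<phi>1 s - \<phi>2 s)\<^sup>2 + (v1 s - v2 s)\<^sup>2 + (h1 s - h2 s)\<^sup>2)"
  define D' where "D' = (\<lambda>s. 2 * ((\<phi>1 s - \<phi>2 s) * (v1 s - v2 s))
      + 2 * ((v1 s - v2 s) * ((sqrt 3 * h1 s * v1 s - W (\<phi>1 s)) - (sqrt 3 * h2 s * v2 s - W (\<phi>2 s))))
      + 2 * ((h1 s - h2 s) * (sqrt 3 * (v1 s)\<^sup>2 - sqrt 3 * (v2 s)\<^sup>2)))"
  define C where "C = 6 * L"
  have DN: "D s = (N s)\<^sup>2" for s by (simp add: D_def N_def norm_Pair)
  have derD: "(D has_real_derivative D' s) (at s within {0..m})" if "s \<in> {0..m}" for s
    unfolding D_def D'_def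
    by (rule derivative_eq_intros d1[OF that] d2[OF that] refl | simp)+
  have growth: "0 \<le> D' s + C * D s" if sm: "s \<in> {0..m}" for s
  proof -
    have "(\<phi>1 s, v1 s, h1 s, 0::real) \<in> cball 0 (3 * B)" "(\<phi>2 s, v2 s, h2 s, 0::real) \<in> cball 0 (3 * B)"
      using norm4_le[of "\<phi>1 s" "v1 s" "h1 s" 0] norm4_le[of "\<phi>2 s" "v2 s" "h2 s" 0] BB[OF sm] by simp_all
    then have "dist (collapse_field W (\<phi>1 s, v1 s, h1 s, 0)) (collapse_field W (\<phi>2 s, v2 s, h2 s, 0)) \<le>
        L * dist (\<phi>1 s, v1 s, h1 s, 0::real) (\<phi>2 s, v2 s, h2 s, 0)"
      by (rule lipschitz_onD[OF L])
    then have F: "norm (v1 s - v2 s, (sqrt 3 * h1 s * v1 s - W (\<phi>1 s)) - (sqrt 3 * h2 s * v2 s - W (\<phi>2 s)),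
        sqrt 3 * (v1 s)\<^sup>2 - sqrt 3 * (v2 s)\<^sup>2, - (h1 s / sqrt 3) - - (h2 s / sqrt 3)) \<le> L * N s"
      unfolding collapse_field_def dist_norm prod.case diff_Pair N_def by simp
    have "- (L * D s) \<le> a * b" if "\<bar>a\<bar> \<le> N s" "\<bar>b\<bar> \<le> L * N s" for a b
    proof -
      have "\<bar>a * b\<bar> \<le> N s * (L * N s)" unfolding abs_mult by (rule mult_mono) (use that in auto)
      also have "\<dots> = L * D s" by (simp add: DN power2_eq_square)
      finally show ?thesis by linarith
    qed
    note est = this
    have n: "\<bar>\<phi>1 s - \<phi>2 s\<bar> \<le> N s \<and> \<bar>v1 s - v2 s\<bar> \<le> N s \<and> \<bar>h1 s - h2 s\<bar> \<le> N s"
      unfolding N_def by (rule abs_le_norm4)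
    have f: "\<bar>v1 s - v2 s\<bar> \<le> L * N s \<and>
        \<bar>(sqrt 3 * h1 s * v1 s - W (\<phi>1 s)) - (sqrt 3 * h2 s * v2 s - W (\<phi>2 s))\<bar> \<le> L * N s \<and>
        \<bar>sqrt 3 * (v1 s)\<^sup>2 - sqrt 3 * (v2 s)\<^sup>2\<bar> \<le> L * N s"
      using abs_le_norm4 order_trans[OF _ F] by blast
    have "- (L * D s) \<le> (\<phi>1 s - \<phi>2 s) * (v1 s - v2 s)"
      "- (L * D s) \<le> (v1 s - v2 s) * ((sqrt 3 * h1 s * v1 s - W (\<phi>1 s)) - (sqrt 3 * h2 s * v2 s - W (\<phi>2 s)))"
      "- (L * D s) \<le> (h1 s - h2 s) * (sqrt 3 * (v1 s)\<^sup>2 - sqrt 3 * (v2 s)\<^sup>2)"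
      using est n f by blast+
    moreover have "0 \<le> 2 * x + 2 * y + 2 * z + 6 * k" if "- k \<le> x" "- k \<le> y" "- k \<le> z" for x y z k :: real
      using that by linarith
    moreover have "C * D s = 6 * (L * D s)" by (simp add: C_def)
    ultimately show ?thesis unfolding D'_def by (simp only:)
  qed
  have "exp (C * s) * D s \<le> exp (C * m) * D m"
  proof (rule nondecreasing_of_deriv_nonneg[of s m "{0..m}" _ "\<lambda>s. exp (C * s) * (D' s + C * D s)"])
    fix r assume r: "s \<le> r" "r \<le> m"
    then have rm: "r \<in> {0..m}" using s by auto
    show "((\<lambda>a. exp (C * a) * D a) has_real_derivative exp (C * r) * (D' r + C * D r)) (at r within {0..m})"
      by (rule derivative_eq_intros derD[OF rm] refl | simp)+ (simp add: algebra_simps)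
    show "0 \<le> exp (C * r) * (D' r + C * D r)" using growth[OF rm] by simp
  qed (use s in auto)
  moreover have "D m = 0" using meet by (simp add: D_def)
  ultimately have "exp (C * s) * D s \<le> 0" by simp
  then have "D s \<le> 0" by (simp add: mult_le_0_iff)
  then have "D s = 0" by (smt (verit) D_def zero_le_power2)
  then show ?thesis by (simp add: D_def add_nonneg_eq_0_iff)
qed

lemma orbits_same_past:
  fixes W W' :: "real \<Rightarrow> real"
  assumes W: "\<And>x. (W has_real_derivative W' x) (at x)" "continuous_on UNIV W'"
    and o1: "orbit V W T1 \<phi>1 v1 h1" and o2: "orbit V W T2 \<phi>2 v2 h2"
    and t: "t1 \<in> life T1" "t2 \<in> life T2" and meet: "\<phi>1 t1 = \<phi>2 t2" "v1 t1 = v2 t2"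
    and s: "0 \<le> s" "s \<le> t1" "s \<le> t2"
  shows "\<phi>1 (t1 - s) = \<phi>2 (t2 - s) \<and> v1 (t1 - s) = v2 (t2 - s)"
proof -
  have shift: "((\<lambda>r. f (c + r)) has_real_derivative f') (at r within {0..s})"
    if "(f has_real_derivative f') (at (c + r) within life T)" "c + s \<in> life T" "0 \<le> c" "r \<in> {0..s}"
    for f :: "real \<Rightarrow> real" and f' c r T
  proof -
    have "(f has_real_derivative f') (at (c + r) within (\<lambda>r. c + r) ` {0..s})"
      by (rule DERIV_subset[OF that(1)]) (use life_Icc[OF _ that(2), of c] that(3) in force)
    then have "(f \<circ> (\<lambda>r. c + r) has_real_derivative f' * 1) (at r within {0..s})"
      by (rule DERIV_image_chain) (auto intro!: derivative_eq_intros)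
    then show ?thesis by (simp add: o_def)
  qed
  have mem: "t1 - s + r \<in> life T1" "t2 - s + r \<in> life T2" if "r \<in> {0..s}" for r
    using that s t life_downward_closed[of "t1 - s + r" t1] life_downward_closed[of "t2 - s + r" t2] by auto
  have "h1 t1 = h2 t2"
    using orbitD(4,5)[OF o1 t(1)] orbitD(4,5)[OF o2 t(2)] meet
    by (metis less_le power2_eq_imp_eq)
  then have "\<phi>1 (t1 - s + 0) = \<phi>2 (t2 - s + 0) \<and> v1 (t1 - s + 0) = v2 (t2 - s + 0)"
    using s t meet mem orbitD[OF o1] orbitD[OF o2]
    by (intro trajectories_same_past[OF W, where m=s and ?h1.0="\<lambda>r. h1 (t1 - s + r)" and ?h2.0="\<lambda>r. h2 (t2 - s + r)"
          and ?v1.0="\<lambda>r. v1 (t1 - s + r)" and ?v2.0="\<lambda>r. v2 (t2 - s + r)"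
          and ?\<phi>1.0="\<lambda>r. \<phi>1 (t1 - s + r)" and ?\<phi>2.0="\<lambda>r. \<phi>2 (t2 - s + r)"])
       (auto intro!: shift)
  then show ?thesis by simp
qed

section \<open>Families of pairwise meeting orbits\<close>

lemma orbit_negligible:
  assumes "orbit V W T \<phi> v h"
  shows "negligible ((\<lambda>t. (\<phi> t, v t)) ` life T)"
proof (rule negligible_differentiable_image_lowdim)
  show "(\<lambda>t. (\<phi> t, v t)) differentiable_on life T"
    unfolding differentiable_on_def
  proof
    fix t assume t: "t \<in> life T"
    have "((\<lambda>t. (\<phi> t, v t)) has_derivative (\<lambda>y. (y * v t, y * (sqrt 3 * h t * v t - W (\<phi> t))))) (at t within life T)"
      using orbitD(1,2)[OF assms t] unfolding has_field_derivative_def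
      by (intro has_derivative_Pair) (simp_all add: mult_commute_abs)
    then show "(\<lambda>t. (\<phi> t, v t)) differentiable at t within life T"
      by (rule differentiableI)
  qed
qed simp

text \<open>If any two orbits of a family meet, backward uniqueness makes the family a chain: of two
  initial states, one lies on the orbit of the other. A chain has a countable cofinal subset,
  so that countably many orbits and one more point cover all initial states.\<close>

lemma meeting_orbits_negligible:
  fixes S :: "(real \<times> real) set"
  assumes W: "\<And>x. (W has_real_derivative W' x) (at x)" "continuous_on UNIV W'"
    and o: "\<And>p. p \<in> S \<Longrightarrow> orbit V W (T p) (\<phi> p) (v p) (h p)"
    and init: "\<And>p. p \<in> S \<Longrightarrow> (\<phi> p 0, v p 0) = p"
    and meet: "\<And>p q. p \<in> S \<Longrightarrow> q \<in> S \<Longrightarrow>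
        \<exists>t\<in>life (T p). \<exists>t'\<in>life (T q). \<phi> p t = \<phi> q t' \<and> v p t = v q t'"
  shows "negligible S"
proof (cases "S = {}")
  case False
  then obtain p0 where p0: "p0 \<in> S" by blast
  define Orb where "Orb p = (\<lambda>t. (\<phi> p t, v p t)) ` life (T p)" for p
  have past: "q \<in> Orb p \<and> (t = t' \<longrightarrow> p = q)"
    if "p \<in> S" "q \<in> S" "t \<in> life (T p)" "t' \<in> life (T q)"
      "\<phi> p t = \<phi> q t'" "v p t = v q t'" "t' \<le> t" for p q t t'
  proof -
    have "\<phi> p (t - t') = \<phi> q (t' - t') \<and> v p (t - t') = v q (t' - t')"
      using that life_nonneg by (intro orbits_same_past[OF W o[OF that(1)] o[OF that(2)]]) auto
    then have "(\<phi> p (t - t'), v p (t - t')) = q" using init[OF that(2)] by simp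
    moreover have "t - t' \<in> life (T p)"
      using that life_nonneg[OF that(4)] by (intro life_downward_closed[OF _ _ that(3)]) auto
    ultimately have "q \<in> Orb p" unfolding Orb_def by (intro image_eqI[of _ _ "t - t'"]) auto
    moreover have "p = q" if "t = t'" using \<open>(\<phi> p (t - t'), v p (t - t')) = q\<close> init[OF \<open>p \<in> S\<close>] that by simp
    ultimately show ?thesis by blast
  qed
  have chain: "q \<in> Orb p \<or> p \<in> Orb q" if pq: "p \<in> S" "q \<in> S" for p q
  proof -
    obtain t t' where "t \<in> life (T p)" "t' \<in> life (T q)" "\<phi> p t = \<phi> q t'" "v p t = v q t'"
      using meet[OF pq] by blast
    then show ?thesis using past[OF pq, of t t'] past[OF pq(2,1), of t' t] by (cases "t' \<le> t") auto
  qed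
  define S' where "S' = S - Orb p0"
  have "\<exists>t. t \<in> life (T q) \<and> \<phi> q t = fst p0 \<and> v q t = snd p0" if "q \<in> S'" for q
  proof -
    have "p0 \<in> Orb q" using chain[OF p0, of q] that unfolding S'_def by blast
    then obtain t where "t \<in> life (T q)" "p0 = (\<phi> q t, v q t)" unfolding Orb_def by blast
    then show ?thesis by (intro exI[of _ t]) simp
  qed
  then obtain s where s: "\<And>q. q \<in> S' \<Longrightarrow> s q \<in> life (T q) \<and> \<phi> q (s q) = fst p0 \<and> v q (s q) = snd p0"
    by metis
  have order: "q' \<in> Orb q \<and> (s q = s q' \<longrightarrow> q = q')" if "q \<in> S'" "q' \<in> S'" "s q' \<le> s q" for q q'
    using past[of q q' "s q" "s q'"] s[OF that(1)] s[OF that(2)] that by (auto simp: S'_def)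
  define R where "R = {r \<in> \<rat>. \<exists>q\<in>S'. r < s q}"
  have "\<exists>q. q \<in> S' \<and> r < s q" if "r \<in> R" for r using that by (auto simp: R_def)
  then obtain c where c: "\<And>r. r \<in> R \<Longrightarrow> c r \<in> S' \<and> r < s (c r)" by metis
  define Top where "Top = {q \<in> S'. \<forall>q'\<in>S'. s q' \<le> s q}"
  have "S \<subseteq> Orb p0 \<union> Top \<union> \<Union> ((\<lambda>r. Orb (c r)) ` R)"
  proof
    fix q assume "q \<in> S"
    show "q \<in> Orb p0 \<union> Top \<union> \<Union> ((\<lambda>r. Orb (c r)) ` R)"
    proof (cases "q \<in> Orb p0 \<union> Top")
      case False
      then have "q \<in> S'" using \<open>q \<in> S\<close> by (simp add: S'_def)
      then obtain q' where "q' \<in> S'" "s q < s q'" using False by (fastforce simp: Top_def)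
      then obtain r where r: "r \<in> \<rat>" "s q < r" "r < s q'" using Rats_dense_in_real by blast
      then have "r \<in> R" using \<open>q' \<in> S'\<close> by (auto simp: R_def)
      then have "q \<in> Orb (c r)" using order[of "c r" q] c[of r] \<open>q \<in> S'\<close> r by auto
      then show ?thesis using \<open>r \<in> R\<close> by blast
    qed blast
  qed
  moreover have neg: "negligible (Orb p)" if "p \<in> S" for p
    unfolding Orb_def by (rule orbit_negligible[OF o[OF that]])
  moreover have "negligible Top"
  proof -
    have "q = q'" if "q \<in> Top" "q' \<in> Top" for q q'
    proof -
      have "s q = s q'" using that by (auto simp: Top_def intro!: antisym)
      then show ?thesis using order[of q q'] that by (auto simp: Top_def)
    qed
    then have "Top = {} \<or> (\<exists>q. Top = {q})" by blast
    then show ?thesis by auto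
  qed
  moreover have "countable R" unfolding R_def by (rule countable_subset[OF _ countable_rat]) auto
  moreover have "negligible (\<Union> ((\<lambda>r. Orb (c r)) ` R))"
  proof (rule negligible_countable_Union)
    show "countable ((\<lambda>r. Orb (c r)) ` R)" using calculation by blast
    show "negligible X" if X: "X \<in> (\<lambda>r. Orb (c r)) ` R" for X
    proof -
      obtain r where "r \<in> R" "X = Orb (c r)" using X by blast
      then show ?thesis using neg[of "c r"] c[of r] by (simp add: S'_def)
    qed
  qed
  ultimately show ?thesis
    using p0 by (meson negligible_Un negligible_subset)
qed simp

section \<open>Climbing orbits\<close>

text \<open>\<open>P\<close> holds finally during the lifetime. This notion treats finite and infinite lifetimes alike; for
  finite \<open>T\<close> it concerns a left neighbourhood of \<open>T\<close>.\<close>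

definition ev :: "ereal \<Rightarrow> (real \<Rightarrow> bool) \<Rightarrow> bool" where
  "ev T P \<longleftrightarrow> (\<exists>s\<in>life T. \<forall>t\<in>life T. s \<le> t \<longrightarrow> P t)"

lemma evI: "s \<in> life T \<Longrightarrow> (\<And>t. t \<in> life T \<Longrightarrow> s \<le> t \<Longrightarrow> P t) \<Longrightarrow> ev T P"
  unfolding ev_def by blast

lemma ev_conj: "ev T P \<Longrightarrow> ev T Q \<Longrightarrow> ev T (\<lambda>t. P t \<and> Q t)"
  unfolding ev_def by (meson life_max max.bounded_iff)

lemma ev_mono: "ev T P \<Longrightarrow> (\<And>t. t \<in> life T \<Longrightarrow> P t \<Longrightarrow> Q t) \<Longrightarrow> ev T Q"
  unfolding ev_def by blast

lemma ev_after:
  assumes "ev T P" "s \<in> life T"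
  obtains t where "t \<in> life T" "s \<le> t" "P t"
  using assms unfolding ev_def by (metis life_max max.cobounded1 max.cobounded2)

text \<open>The exceptional orbits: \<open>\<phi>\<close> ends by increasing to \<open>p\<close> against the force, and \<open>x = v / h\<close>
  approaches the graph of a given function \<open>g\<close>, at a distance from the value \<open>1\<close>. In the
  applications \<open>g = 0\<close> if the energy is bounded, and \<open>g = u\<close> otherwise.\<close>

definition climbs ::
  "(real \<Rightarrow> real) \<Rightarrow> (real \<Rightarrow> real) \<Rightarrow> ereal \<Rightarrow> ereal \<Rightarrow> (real \<Rightarrow> real) \<Rightarrow> (real \<Rightarrow> real) \<Rightarrow> (real \<Rightarrow> real) \<Rightarrow> bool"
  where
  "climbs W g p T \<phi> v h \<longleftrightarrow>
     (\<exists>\<rho><1. ev T (\<lambda>t. 0 < v t \<and> 0 < W (\<phi> t) \<and> v t \<le> \<rho> * h t \<and> ereal (\<phi> t) < p)) \<and>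
     (\<forall>c. ereal c < p \<longrightarrow> ev T (\<lambda>t. c < \<phi> t)) \<and>
     (\<forall>e>0. ev T (\<lambda>t. \<bar>v t / h t - g (\<phi> t)\<bar> < e))"

lemma at_within_life:
  assumes "t \<in> life T" "0 < t" shows "at t within life T = at t"
proof -
  obtain t' where "t < t'" "t' \<in> life T" using life_later[OF assms(1)] .
  then have "t \<in> {0<..<t'}" "{0<..<t'} \<subseteq> life T" using assms(2) life_Icc[of 0 t' T] by auto
  then show ?thesis by (intro at_within_open_subset[of t "{0<..<t'}"]) auto
qed

text \<open>Since \<open>\<phi>\<close> increases, time is a function \<open>\<tau>\<close> of \<open>\<phi>\<close> along the final part of the orbit.\<close>

lemma climbing_orbit_graph:
  assumes o: "orbit V W T \<phi> v h" and cl: "climbs W g p T \<phi> v h"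
  obtains m \<rho> \<tau> where "ereal m < p" "\<rho> < 1"
    "\<And>q. m < q \<Longrightarrow> ereal q < p \<Longrightarrow> \<tau> q \<in> life T \<and> \<phi> (\<tau> q) = q \<and> 0 < \<tau> q \<and>
       0 < v (\<tau> q) \<and> v (\<tau> q) \<le> \<rho> * h (\<tau> q) \<and> 0 < W q \<and>
       (\<tau> has_real_derivative 1 / v (\<tau> q)) (at q)"
    "\<And>e. 0 < e \<Longrightarrow> \<exists>c. ereal c < p \<and> (\<forall>q. c < q \<longrightarrow> ereal q < p \<longrightarrow> \<bar>v (\<tau> q) / h (\<tau> q) - g q\<bar> < e)"
proof -
  obtain \<rho> where \<rho>: "\<rho> < 1" and "ev T (\<lambda>t. 0 < v t \<and> 0 < W (\<phi> t) \<and> v t \<le> \<rho> * h t \<and> ereal (\<phi> t) < p)"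
    using cl unfolding climbs_def by auto
  then obtain s where s: "s \<in> life T"
    and late: "\<And>t. t \<in> life T \<Longrightarrow> s \<le> t \<Longrightarrow> 0 < v t \<and> 0 < W (\<phi> t) \<and> v t \<le> \<rho> * h t \<and> ereal (\<phi> t) < p"
    unfolding ev_def by auto
  have s0: "0 \<le> s" using s by (rule life_nonneg)
  have der: "(\<phi> has_real_derivative v t) (at t)" if "t \<in> life T" "0 < t" for t
    using orbitD(1)[OF o that(1)] at_within_life[OF that] by simp
  have incr: "\<phi> a < \<phi> b" if "s \<le> a" "a < b" "b \<in> life T" for a b
  proof -
    have sub: "{a..b} \<subseteq> life T" using life_Icc[of a b T] that s0 by auto
    have "continuous_on {a..b} \<phi>" by (rule continuous_on_subset[OF orbit_continuous(1)[OF o] sub])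
    moreover have "(\<phi> has_derivative (*) (v r)) (at r)" if "a < r" "r < b" for r
      using der[of r] that sub \<open>s \<le> a\<close> s0 by (auto simp: has_field_derivative_def subset_iff)
    ultimately obtain r where r: "a < r" "r < b" "\<phi> b - \<phi> a = v r * (b - a)"
      using mvt[OF \<open>a < b\<close>, of \<phi> "\<lambda>r. (*) (v r)"] by blast
    have "r \<in> life T" using r sub by auto
    then have "0 < v r * (b - a)" using late[of r] r that by simp
    then show ?thesis using r by linarith
  qed
  have incr_eq: "\<phi> a \<le> \<phi> b \<longleftrightarrow> a \<le> b" if "s \<le> a" "s \<le> b" "a \<in> life T" "b \<in> life T" for a b
    using incr[of a b] incr[of b a] that by (cases a b rule: linorder_cases) auto
  define m where "m = \<phi> s"
  have mp: "ereal m < p" using late[OF s] by (simp add: m_def)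
  have ex: "\<exists>t. t \<in> life T \<and> s < t \<and> \<phi> t = q" if q: "m < q" "ereal q < p" for q
  proof -
    obtain t where t: "t \<in> life T" "s \<le> t" "q < \<phi> t"
    proof -
      have "ev T (\<lambda>t. q < \<phi> t)" using cl q(2) unfolding climbs_def by simp
      then show ?thesis using ev_after[OF _ s] that by metis
    qed
    have "continuous_on {s..t} \<phi>"
      by (rule continuous_on_subset[OF orbit_continuous(1)[OF o] life_Icc[OF s0 t(1)]])
    then obtain r where r: "s \<le> r" "r \<le> t" "\<phi> r = q"
      using IVT'[of \<phi> s q t] t q(1) by (auto simp: m_def)
    moreover have "r \<noteq> s" using r q(1) by (auto simp: m_def)
    moreover have "r \<in> life T" using r s0 t(1) life_downward_closed[of r t T] by auto
    ultimately show ?thesis by (intro exI[of _ r]) auto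
  qed
  then obtain \<tau> where \<tau>: "\<And>q. m < q \<Longrightarrow> ereal q < p \<Longrightarrow> \<tau> q \<in> life T \<and> s < \<tau> q \<and> \<phi> (\<tau> q) = q"
    by metis
  have inv: "\<tau> (\<phi> t) = t" if "t \<in> life T" "s < t" for t
  proof -
    have "m < \<phi> t" using incr[of s t] that by (simp add: m_def)
    moreover have "ereal (\<phi> t) < p" using late that by auto
    ultimately have "\<tau> (\<phi> t) \<in> life T" "s < \<tau> (\<phi> t)" "\<phi> (\<tau> (\<phi> t)) = \<phi> t" using \<tau> by auto
    then show ?thesis using incr_eq[of t "\<tau> (\<phi> t)"] incr_eq[of "\<tau> (\<phi> t)" t] that by auto
  qed
  have "(\<tau> has_real_derivative 1 / v (\<tau> q)) (at q)" if q: "m < q" "ereal q < p" for q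
  proof -
    note t = \<tau>[OF q]
    obtain b where b: "\<tau> q < b" "b \<in> life T" using life_later t by blast
    obtain a where a: "s < a" "a < \<tau> q" using t dense by blast
    have mem: "z \<in> life T" "s < z" if "a \<le> z" "z \<le> b" for z
      using that a s0 b life_downward_closed[of z b T] by auto
    define r' where "r' = \<phi> b"
    have r': "q < r'" "ereal r' < p" using incr[of "\<tau> q" b] t b late[of b] by (auto simp: r'_def)
    have "isCont \<tau> (\<phi> (\<tau> q))"
    proof (rule isCont_inverse_function2[of a "\<tau> q" b])
      show "isCont \<phi> z" if "a \<le> z" "z \<le> b" for z
        using mem[OF that] s0 der[of z] by (intro DERIV_isCont) auto
    qed (use a b mem inv in auto)
    then have "isCont \<tau> q" using t by simp
    moreover have "DERIV \<phi> (\<tau> q) :> v (\<tau> q)" using der[of "\<tau> q"] t s0 by auto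
    moreover have "v (\<tau> q) \<noteq> 0" using late[of "\<tau> q"] t by auto
    moreover have "\<phi> (\<tau> y) = y" if "m < y" "y < r'" for y
    proof -
      have "ereal y < p" using less_trans[of "ereal y" "ereal r'" p] that r' by simp
      then show ?thesis using \<tau>[of y] that by simp
    qed
    ultimately have "DERIV \<tau> q :> inverse (v (\<tau> q))"
      using q(1) r'(1) by (intro DERIV_inverse_function[of \<phi> _ \<tau> q m r']) auto
    then show ?thesis by (simp add: inverse_eq_divide)
  qed
  then have main: "\<tau> q \<in> life T \<and> \<phi> (\<tau> q) = q \<and> 0 < \<tau> q \<and> 0 < v (\<tau> q) \<and> v (\<tau> q) \<le> \<rho> * h (\<tau> q) \<and> 0 < W q \<and>
       (\<tau> has_real_derivative 1 / v (\<tau> q)) (at q)" if "m < q" "ereal q < p" for q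
    using \<tau>[OF that] late[of "\<tau> q"] that s0 by auto
  have lim: "\<exists>c. ereal c < p \<and> (\<forall>q. c < q \<longrightarrow> ereal q < p \<longrightarrow> \<bar>v (\<tau> q) / h (\<tau> q) - g q\<bar> < e)" if "0 < e" for e
  proof -
    obtain s' where s': "s' \<in> life T" and *: "\<And>t. t \<in> life T \<Longrightarrow> s' \<le> t \<Longrightarrow> \<bar>v t / h t - g (\<phi> t)\<bar> < e"
    proof -
      have "ev T (\<lambda>t. \<bar>v t / h t - g (\<phi> t)\<bar> < e)" using cl \<open>0 < e\<close> unfolding climbs_def by simp
      then show ?thesis using that unfolding ev_def by metis
    qed
    define s1 where "s1 = max s s'"
    have s1: "s1 \<in> life T" "s \<le> s1" "s' \<le> s1" using life_max[OF s s'] by (auto simp: s1_def)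
    have "\<bar>v (\<tau> q) / h (\<tau> q) - g q\<bar> < e" if q: "\<phi> s1 < q" "ereal q < p" for q
    proof -
      have "m \<le> \<phi> s1" using incr_eq[of s s1] s s1 by (simp add: m_def)
      then have t: "\<tau> q \<in> life T" "s < \<tau> q" "\<phi> (\<tau> q) = q" using \<tau>[of q] q by auto
      then have "s1 \<le> \<tau> q" using incr_eq[of "s1" "\<tau> q"] q s1 by auto
      then show ?thesis using *[of "\<tau> q"] t s1 by auto
    qed
    moreover have "ereal (\<phi> s1) < p" using late[of s1] s1 by simp
    ultimately show ?thesis by blast
  qed
  show ?thesis by (rule that[OF mp \<rho> main lim])
qed

text \<open>Along a climbing orbit, seen as a graph over \<open>\<phi>\<close>, the quantity \<open>z = h + v\<close> satisfies
  \<open>dz / d\<phi> = sqrt 3 z - W / v\<close>, and \<open>v\<close> is an increasing function of \<open>z\<close> for given \<open>\<phi>\<close>. The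
  ratio \<open>r\<close> of the two quantities \<open>z\<close> of two orbits therefore never comes closer to \<open>1\<close>. On the other
  hand \<open>z\<^sup>2 = 2 V (1 + x) / (1 - x)\<close>, so that \<open>r\<close> tends to \<open>1\<close> when both \<open>x\<close> approach
  the same graph.\<close>

lemma climbing_orbits_meet:
  assumes o1: "orbit V W T1 \<phi>1 v1 h1" and c1: "climbs W g p T1 \<phi>1 v1 h1"
    and o2: "orbit V W T2 \<phi>2 v2 h2" and c2: "climbs W g p T2 \<phi>2 v2 h2"
  shows "\<exists>t1\<in>life T1. \<exists>t2\<in>life T2. \<phi>1 t1 = \<phi>2 t2 \<and> v1 t1 = v2 t2"
proof -
  obtain m1 \<rho>1 \<tau>1 where m1: "ereal m1 < p" "\<rho>1 < 1"
    and g1: "\<And>q. m1 < q \<Longrightarrow> ereal q < p \<Longrightarrow> \<tau>1 q \<in> life T1 \<and> \<phi>1 (\<tau>1 q) = q \<and> 0 < \<tau>1 q \<and>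
       0 < v1 (\<tau>1 q) \<and> v1 (\<tau>1 q) \<le> \<rho>1 * h1 (\<tau>1 q) \<and> 0 < W q \<and>
       (\<tau>1 has_real_derivative 1 / v1 (\<tau>1 q)) (at q)"
    and l1: "\<And>e. 0 < e \<Longrightarrow> \<exists>c. ereal c < p \<and> (\<forall>q. c < q \<longrightarrow> ereal q < p \<longrightarrow> \<bar>v1 (\<tau>1 q) / h1 (\<tau>1 q) - g q\<bar> < e)"
    by (rule climbing_orbit_graph[OF o1 c1]) blast
  obtain m2 \<rho>2 \<tau>2 where m2: "ereal m2 < p" "\<rho>2 < 1"
    and g2: "\<And>q. m2 < q \<Longrightarrow> ereal q < p \<Longrightarrow> \<tau>2 q \<in> life T2 \<and> \<phi>2 (\<tau>2 q) = q \<and> 0 < \<tau>2 q \<and>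
       0 < v2 (\<tau>2 q) \<and> v2 (\<tau>2 q) \<le> \<rho>2 * h2 (\<tau>2 q) \<and> 0 < W q \<and>
       (\<tau>2 has_real_derivative 1 / v2 (\<tau>2 q)) (at q)"
    and l2: "\<And>e. 0 < e \<Longrightarrow> \<exists>c. ereal c < p \<and> (\<forall>q. c < q \<longrightarrow> ereal q < p \<longrightarrow> \<bar>v2 (\<tau>2 q) / h2 (\<tau>2 q) - g q\<bar> < e)"
    by (rule climbing_orbit_graph[OF o2 c2]) blast
  define m where "m = max m1 m2"
  define \<rho> where "\<rho> = max \<rho>1 \<rho>2"
  have mp: "ereal m < p" and \<rho>: "\<rho> < 1" "\<rho>1 \<le> \<rho>" "\<rho>2 \<le> \<rho>" using m1 m2 by (auto simp: m_def \<rho>_def max_def)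
  define V1 V2 H1 H2 where "V1 q = v1 (\<tau>1 q)" and "V2 q = v2 (\<tau>2 q)" and "H1 q = h1 (\<tau>1 q)" and "H2 q = h2 (\<tau>2 q)" for q
  note defs = V1_def V2_def H1_def H2_def
  define r where "r q = (H1 q + V1 q) / (H2 q + V2 q)" for q
  have q: "0 < V1 q" "0 < V2 q" "0 < H1 q" "0 < H2 q" "V1 q \<le> \<rho> * H1 q" "V2 q \<le> \<rho> * H2 q" "0 < W q"
     "(H1 q)\<^sup>2 - (V1 q)\<^sup>2 = 2 * V q" "(H2 q)\<^sup>2 - (V2 q)\<^sup>2 = 2 * V q" if "m < q" "ereal q < p" for q
  proof -
    have G1: "\<tau>1 q \<in> life T1" "\<phi>1 (\<tau>1 q) = q" "0 < v1 (\<tau>1 q)" "v1 (\<tau>1 q) \<le> \<rho>1 * h1 (\<tau>1 q)" "0 < W q"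
      using g1[of q] that by (auto simp: m_def)
    have G2: "\<tau>2 q \<in> life T2" "\<phi>2 (\<tau>2 q) = q" "0 < v2 (\<tau>2 q)" "v2 (\<tau>2 q) \<le> \<rho>2 * h2 (\<tau>2 q)"
      using g2[of q] that by (auto simp: m_def)
    note O1 = orbitD(4,5)[OF o1 G1(1)] and O2 = orbitD(4,5)[OF o2 G2(1)]
    show "0 < V1 q" "0 < V2 q" "0 < H1 q" "0 < H2 q" "0 < W q"
     "(H1 q)\<^sup>2 - (V1 q)\<^sup>2 = 2 * V q" "(H2 q)\<^sup>2 - (V2 q)\<^sup>2 = 2 * V q"
      using O1 O2 G1 G2 by (simp_all add: defs)
    have "\<rho>1 * h1 (\<tau>1 q) \<le> \<rho> * h1 (\<tau>1 q)" "\<rho>2 * h2 (\<tau>2 q) \<le> \<rho> * h2 (\<tau>2 q)"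
      using \<rho> O1 O2 by (auto intro: mult_right_mono)
    then show "V1 q \<le> \<rho> * H1 q" "V2 q \<le> \<rho> * H2 q" using G1 G2 by (auto simp: defs)
  qed
  define r' where "r' q = W q / (H2 q + V2 q)\<^sup>2 * ((H1 q + V1 q) / V2 q - (H2 q + V2 q) / V1 q)" for q
  have der: "(r has_real_derivative r' q) (at q)" if mq: "m < q" "ereal q < p" for q
  proof -
    have *: "((\<lambda>q. h (\<tau> q) + v (\<tau> q)) has_real_derivative sqrt 3 * (h (\<tau> q) + v (\<tau> q)) - W q / v (\<tau> q)) (at q)"
      if o: "orbit V W T \<phi> v h" and G: "\<tau> q \<in> life T" "\<phi> (\<tau> q) = q" "0 < \<tau> q" "0 < v (\<tau> q)"
        "(\<tau> has_real_derivative 1 / v (\<tau> q)) (at q)" for T \<phi> v h \<tau>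
    proof -
      have "DERIV v (\<tau> q) :> sqrt 3 * h (\<tau> q) * v (\<tau> q) - W q" "DERIV h (\<tau> q) :> sqrt 3 * (v (\<tau> q))\<^sup>2"
        using orbitD(2,3)[OF o G(1)] at_within_life[OF G(1,3)] G(2) by auto
      then have "((\<lambda>q. h (\<tau> q) + v (\<tau> q)) has_real_derivative
         sqrt 3 * (v (\<tau> q))\<^sup>2 * (1 / v (\<tau> q)) + (sqrt 3 * h (\<tau> q) * v (\<tau> q) - W q) * (1 / v (\<tau> q))) (at q)"
        by (intro DERIV_add DERIV_chain2[OF _ G(5)])
      then show ?thesis using G(4) by (simp add: field_simps power2_eq_square)
    qed
    have G1: "\<tau>1 q \<in> life T1" "\<phi>1 (\<tau>1 q) = q" "0 < \<tau>1 q" "0 < v1 (\<tau>1 q)" "(\<tau>1 has_real_derivative 1 / v1 (\<tau>1 q)) (at q)"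
      using g1[of q] mq by (auto simp: m_def)
    have G2: "\<tau>2 q \<in> life T2" "\<phi>2 (\<tau>2 q) = q" "0 < \<tau>2 q" "0 < v2 (\<tau>2 q)" "(\<tau>2 has_real_derivative 1 / v2 (\<tau>2 q)) (at q)"
      using g2[of q] mq by (auto simp: m_def)
    have d: "((\<lambda>q. H1 q + V1 q) has_real_derivative sqrt 3 * (H1 q + V1 q) - W q / V1 q) (at q)"
        "((\<lambda>q. H2 q + V2 q) has_real_derivative sqrt 3 * (H2 q + V2 q) - W q / V2 q) (at q)"
      using *[OF o1 G1] *[OF o2 G2] by (simp_all add: defs)
    have nz: "H2 q + V2 q \<noteq> 0" using q[OF mq] by simp
    have "(r has_real_derivative ((sqrt 3 * (H1 q + V1 q) - W q / V1 q) * (H2 q + V2 q)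
        - (H1 q + V1 q) * (sqrt 3 * (H2 q + V2 q) - W q / V2 q)) / ((H2 q + V2 q) * (H2 q + V2 q))) (at q)"
      unfolding r_def by (rule DERIV_divide[OF d nz])
    moreover have "((sqrt 3 * (H1 q + V1 q) - W q / V1 q) * (H2 q + V2 q)
        - (H1 q + V1 q) * (sqrt 3 * (H2 q + V2 q) - W q / V2 q)) / ((H2 q + V2 q) * (H2 q + V2 q)) = r' q"
      unfolding r'_def power2_eq_square by (simp add: diff_divide_distrib algebra_simps)
    ultimately show ?thesis by simp
  qed
  have sgn: "0 \<le> (r q - 1) * r' q" if mq: "m < q" "ereal q < p" for q
  proof -
    note Q = q[OF mq]
    define z1 z2 where "z1 = H1 q + V1 q" and "z2 = H2 q + V2 q"
    have z: "0 < z1" "0 < z2" using Q by (auto simp: z1_def z2_def)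
    have "(V1 q \<le> V2 q \<and> z1 \<le> z2) \<or> (V2 q \<le> V1 q \<and> z2 \<le> z1)"
    proof (cases "V1 q \<le> V2 q")
      case True
      then have "(V1 q)\<^sup>2 \<le> (V2 q)\<^sup>2" using Q by (intro power_mono) auto
      then have "(H1 q)\<^sup>2 \<le> (H2 q)\<^sup>2" using Q(8,9) by linarith
      then have "H1 q \<le> H2 q" by (rule power2_le_imp_le) (use Q in simp)
      then show ?thesis using True by (auto simp: z1_def z2_def)
    next
      case False
      then have "(V2 q)\<^sup>2 \<le> (V1 q)\<^sup>2" using Q by (intro power_mono) auto
      then have "(H2 q)\<^sup>2 \<le> (H1 q)\<^sup>2" using Q(8,9) by linarith
      then have "H2 q \<le> H1 q" by (rule power2_le_imp_le) (use Q in simp)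
      then show ?thesis using False by (auto simp: z1_def z2_def)
    qed
    then have A: "0 \<le> (z1 / z2 - 1) * (z1 / V2 q - z2 / V1 q)"
    proof
      assume a: "V1 q \<le> V2 q \<and> z1 \<le> z2"
      then have "z1 / V2 q \<le> z2 / V1 q" using z Q by (intro frac_le) auto
      moreover have "z1 / z2 \<le> 1" using a z by simp
      ultimately show ?thesis by (intro mult_nonpos_nonpos) auto
    next
      assume a: "V2 q \<le> V1 q \<and> z2 \<le> z1"
      then have "z2 / V1 q \<le> z1 / V2 q" using z Q by (intro frac_le) auto
      moreover have "1 \<le> z1 / z2" using a z by simp
      ultimately show ?thesis by (intro mult_nonneg_nonneg) auto
    qed
    have "0 \<le> W q / z2\<^sup>2 * ((z1 / z2 - 1) * (z1 / V2 q - z2 / V1 q))"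
      using Q(7) by (intro mult_nonneg_nonneg[OF _ A]) simp
    moreover have "(r q - 1) * r' q = (z1 / z2 - 1) * (W q / z2\<^sup>2 * (z1 / V2 q - z2 / V1 q))"
      unfolding r_def r'_def z1_def z2_def ..
    ultimately show ?thesis by (simp only: mult.left_commute)
  qed
  obtain q0 where q0: "m < q0" "ereal q0 < p"
  proof -
    obtain y where "ereal m < y" "y < p" using dense[OF mp] by blast
    then show ?thesis by (cases y) (auto intro: that)
  qed
  have mono: "(r q0 - 1)\<^sup>2 \<le> (r b - 1)\<^sup>2" if b: "q0 \<le> b" "ereal b < p" for b
  proof (rule nondecreasing_of_deriv_nonneg[of q0 b UNIV _ "\<lambda>q. 2 * ((r q - 1) * r' q)"])
    fix q assume "q0 \<le> q" "q \<le> b"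
    then have mq: "m < q" "ereal q < p" using q0 b by (auto intro: le_less_trans[of _ "ereal b"])
    show "((\<lambda>q. (r q - 1)\<^sup>2) has_real_derivative 2 * ((r q - 1) * r' q)) (at q)"
      by (rule derivative_eq_intros der[OF mq] refl | simp)+
    show "0 \<le> 2 * ((r q - 1) * r' q)" using sgn[OF mq] by simp
  qed (use b in auto)
  have "r q0 = 1"
  proof (rule ccontr)
    assume ne: "r q0 \<noteq> 1"
    define \<delta> where "\<delta> = \<bar>r q0 - 1\<bar>"
    have \<delta>: "0 < \<delta>" using ne by (simp add: \<delta>_def)
    \<comment> \<open>Both \<open>x\<close> will be within \<open>e\<close> of \<open>g\<close>, and then \<open>\<bar>r\<^sup>2 - 1\<bar> \<le> 2 \<bar>x1 - x2\<bar> / (1 - \<rho>) < \<delta> / 2\<close>.\<close>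
    define e where "e = \<delta> * (1 - \<rho>) / 8"
    have e: "0 < e" using \<delta> \<rho> by (simp add: e_def)
    obtain ca cb where ca: "ereal ca < p" "\<And>q. ca < q \<Longrightarrow> ereal q < p \<Longrightarrow> \<bar>V1 q / H1 q - g q\<bar> < e"
       and cb: "ereal cb < p" "\<And>q. cb < q \<Longrightarrow> ereal q < p \<Longrightarrow> \<bar>V2 q / H2 q - g q\<bar> < e"
      using l1[OF e] l2[OF e] unfolding defs by blast
    have "ereal (max q0 (max ca cb)) < p" using ca(1) cb(1) q0(2) by (auto simp: max_def)
    then obtain y where "ereal (max q0 (max ca cb)) < y" "y < p" using dense by blast
    then obtain b where b: "q0 < b" "ca < b" "cb < b" "ereal b < p" by (cases y) auto
    have mb: "m < b" "ereal b < p" using b q0 by auto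
    note Q = q[OF mb]
    define x1 x2 where "x1 = V1 b / H1 b" and "x2 = V2 b / H2 b"
    have x: "0 < x1" "0 < x2" "x1 \<le> \<rho>" "x2 \<le> \<rho>" "V1 b = x1 * H1 b" "V2 b = x2 * H2 b"
      using Q by (auto simp: x1_def x2_def field_simps)
    have dx: "\<bar>x1 - x2\<bar> < 2 * e" using ca(2)[of b] cb(2)[of b] b by (auto simp: x1_def x2_def)
    have c: "(H1 b)\<^sup>2 * (1 - x1\<^sup>2) = (H2 b)\<^sup>2 * (1 - x2\<^sup>2)"
      using Q(8,9) unfolding x(5,6) power_mult_distrib by (simp add: algebra_simps)
    have rb: "r b = H1 b * (1 + x1) / (H2 b * (1 + x2))"
      unfolding r_def x(5,6) by (simp add: algebra_simps)
    have rpos: "0 < r b" unfolding rb using x Q by auto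
    have one: "(H1 b)\<^sup>2 * (1 + x1) * (1 - x1) = (H2 b)\<^sup>2 * (1 + x2) * (1 - x2)"
      using c by (simp add: power2_eq_square algebra_simps)
    have "(r b)\<^sup>2 * ((1 - x1) * (1 + x2)) = (1 + x1) * (1 - x2)"
    proof -
      have "(H2 b)\<^sup>2 * (1 + x2)\<^sup>2 * ((r b)\<^sup>2 * ((1 - x1) * (1 + x2))) = (H1 b)\<^sup>2 * (1 + x1)\<^sup>2 * ((1 - x1) * (1 + x2))"
        unfolding rb power_divide power_mult_distrib using x Q by (simp add: field_simps)
      also have "\<dots> = ((H1 b)\<^sup>2 * (1 + x1) * (1 - x1)) * (1 + x1) * (1 + x2)"
        by (simp add: power2_eq_square algebra_simps)
      also have "\<dots> = (H2 b)\<^sup>2 * (1 + x2)\<^sup>2 * ((1 + x1) * (1 - x2))"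
        unfolding one by (simp add: power2_eq_square algebra_simps)
      finally show ?thesis using x Q by simp
    qed
    then have "((r b)\<^sup>2 - 1) * ((1 - x1) * (1 + x2)) = 2 * (x1 - x2)" by (simp add: algebra_simps)
    moreover define C where "C = (1 - x1) * (1 + x2)"
    ultimately have "\<bar>((r b)\<^sup>2 - 1) * C\<bar> = \<bar>2 * (x1 - x2)\<bar>" by simp
    then have eq: "\<bar>(r b)\<^sup>2 - 1\<bar> * \<bar>C\<bar> = 2 * \<bar>x1 - x2\<bar>" by (simp only: abs_mult abs_numeral)
    have "(1 - \<rho>) * 1 \<le> C" unfolding C_def using x \<rho> by (intro mult_mono) auto
    then have "1 - \<rho> \<le> \<bar>C\<bar>" using \<rho> by simp
    then have "\<bar>(r b)\<^sup>2 - 1\<bar> * (1 - \<rho>) \<le> 2 * \<bar>x1 - x2\<bar>"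
      unfolding eq[symmetric] by (rule mult_left_mono) simp
    also have "\<dots> < \<delta> / 2 * (1 - \<rho>)" using dx by (simp add: e_def field_simps)
    finally have small: "\<bar>(r b)\<^sup>2 - 1\<bar> < \<delta> / 2" by (rule mult_right_less_imp_less) (use \<rho> in simp)
    have "(r b)\<^sup>2 - 1 = (r b - 1) * (r b + 1)" by (simp add: power2_eq_square algebra_simps)
    then have "\<bar>(r b)\<^sup>2 - 1\<bar> = \<bar>r b - 1\<bar> * \<bar>r b + 1\<bar>" by (simp only: abs_mult)
    moreover have "\<bar>r b - 1\<bar> * 1 \<le> \<bar>r b - 1\<bar> * \<bar>r b + 1\<bar>" using rpos by (intro mult_left_mono) auto
    ultimately have "\<bar>r b - 1\<bar> \<le> \<bar>(r b)\<^sup>2 - 1\<bar>" by (simp only: mult_1_right)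
    also have "\<dots> < \<delta>" using small \<delta> by simp
    finally have "\<bar>r b - 1\<bar> < \<bar>r q0 - 1\<bar>" unfolding \<delta>_def .
    then have "(r b - 1)\<^sup>2 < (r q0 - 1)\<^sup>2" by (metis abs_le_square_iff not_le)
    then show False using mono[of b] b by simp
  qed
  then have z: "H1 q0 + V1 q0 = H2 q0 + V2 q0" using q[OF q0] by (simp add: r_def)
  note Q = q[OF q0]
  have "(H1 q0 - V1 q0) * (H1 q0 + V1 q0) = (H2 q0 - V2 q0) * (H2 q0 + V2 q0)"
    using Q(8,9) by (simp add: power2_eq_square algebra_simps)
  then have "H1 q0 - V1 q0 = H2 q0 - V2 q0" using z Q by simp
  then have "V1 q0 = V2 q0" using z by simp
  moreover have "\<tau>1 q0 \<in> life T1" "\<phi>1 (\<tau>1 q0) = q0" "\<tau>2 q0 \<in> life T2" "\<phi>2 (\<tau>2 q0) = q0"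
    using g1[of q0] g2[of q0] q0 by (auto simp: m_def)
  ultimately show ?thesis unfolding defs by metis
qed

section \<open>Confining potentials\<close>

text \<open>The properties of the class \<open>\<CC>\<close> that the dynamics uses, in a form that is invariant under the
  reflection \<open>\<phi> \<mapsto> - \<phi>\<close>: the force points inwards for \<open>\<bar>\<phi>\<bar> \<ge> R\<close> and \<open>\<bar>u\<bar> \<le> \<rho> < 1\<close> there, where
  \<open>u = W / (2 sqrt 3 V)\<close>. The last two assumptions say that \<open>u'\<close> tends to \<open>0\<close> at the ends.\<close>

locale confining_potential =
  fixes V W W' :: "real \<Rightarrow> real" and R \<rho> K :: real
  assumes V_deriv: "\<And>x. (V has_real_derivative W x) (at x)"
    and W_deriv: "\<And>x. (W has_real_derivative W' x) (at x)"
    and W'_cont: "continuous_on UNIV W'"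
    and V_below: "\<And>x. - K \<le> V x"
    and noncritical_near: "\<And>x. \<forall>\<^sub>F y in at x. W y \<noteq> 0"
    and critical: "\<And>x. W x = 0 \<Longrightarrow> (\<forall>\<^sub>F y in at x. V x \<le> V y) \<or> (\<forall>\<^sub>F y in at x. V y \<le> V x)"
    and R_pos: "0 < R" and \<rho>_less: "\<rho> < 1"
    and far_right: "\<And>x. R \<le> x \<Longrightarrow> 0 < V x \<and> 0 < W x \<and> W x \<le> \<rho> * (2 * sqrt 3 * V x)"
    and far_left: "\<And>x. x \<le> - R \<Longrightarrow> 0 < V x \<and> W x < 0 \<and> - W x \<le> \<rho> * (2 * sqrt 3 * V x)"
    and slope_right: "((\<lambda>x. (W' x * V x - (W x)\<^sup>2) / (V x)\<^sup>2) \<longlongrightarrow> 0) at_top"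
    and slope_left: "((\<lambda>x. (W' x * V x - (W x)\<^sup>2) / (V x)\<^sup>2) \<longlongrightarrow> 0) at_bot"
begin

lemma reflection:
  "confining_potential (\<lambda>x. V (- x)) (\<lambda>x. - W (- x)) (\<lambda>x. W' (- x)) R \<rho> K"
proof
  fix x :: real
  have m: "(uminus has_real_derivative - 1) (at x)" by (auto intro!: derivative_eq_intros)
  show "((\<lambda>x. V (- x)) has_real_derivative - W (- x)) (at x)"
    using DERIV_chain2[OF V_deriv m] by simp
  show "((\<lambda>x. - W (- x)) has_real_derivative W' (- x)) (at x)"
    using DERIV_minus[OF DERIV_chain2[OF W_deriv m]] by simp
  show "- K \<le> V (- x)" by (rule V_below)
  have *: "(\<forall>\<^sub>F y in at x. P (- y)) \<longleftrightarrow> (\<forall>\<^sub>F y in at (- x). P y)" for P :: "real \<Rightarrow> bool"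
    using eventually_filtermap[of P uminus "at x"] by (simp add: filtermap_at_minus)
  show "\<forall>\<^sub>F y in at x. - W (- y) \<noteq> 0" using noncritical_near[of "- x"] *[of "\<lambda>y. W y \<noteq> 0"] by simp
  show "(\<forall>\<^sub>F y in at x. V (- x) \<le> V (- y)) \<or> (\<forall>\<^sub>F y in at x. V (- y) \<le> V (- x))" if "- W (- x) = 0"
    using critical[of "- x"] that *[of "\<lambda>y. V (- x) \<le> V y"] *[of "\<lambda>y. V y \<le> V (- x)"] by simp
  show "0 < V (- x) \<and> 0 < - W (- x) \<and> - W (- x) \<le> \<rho> * (2 * sqrt 3 * V (- x))" if "R \<le> x"
    using far_left[of "- x"] that by simp
  show "0 < V (- x) \<and> - W (- x) < 0 \<and> - (- W (- x)) \<le> \<rho> * (2 * sqrt 3 * V (- x))" if "x \<le> - R"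
    using far_right[of "- x"] that by simp
next
  show "continuous_on UNIV (\<lambda>x. W' (- x))"
    by (intro continuous_on_compose2[OF W'_cont] continuous_intros) auto
  show "((\<lambda>x. (W' (- x) * V (- x) - (- W (- x))\<^sup>2) / (V (- x))\<^sup>2) \<longlongrightarrow> 0) at_top"
    using slope_left unfolding at_bot_mirror filterlim_filtermap by simp
  show "((\<lambda>x. (W' (- x) * V (- x) - (- W (- x))\<^sup>2) / (V (- x))\<^sup>2) \<longlongrightarrow> 0) at_bot"
    using slope_right unfolding at_top_mirror filterlim_filtermap by simp
qed (use R_pos \<rho>_less in auto)

lemma W_isCont: "isCont W x" and V_isCont: "isCont V x"
  using DERIV_isCont W_deriv V_deriv by blast+

lemma W_bounded: "\<exists>B. \<forall>x\<in>{a..b}. \<bar>W x\<bar> \<le> B" and V_bounded: "\<exists>B. \<forall>x\<in>{a..b}. \<bar>V x\<bar> \<le> B"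
  using W_isCont V_isCont by (auto intro!: bounded_on_Icc continuous_at_imp_continuous_on)

lemma noncritical_between:
  assumes "a < b" obtains q where "a < q" "q < b" "W q \<noteq> 0"
proof -
  have "\<forall>\<^sub>F y in at_right a. W y \<noteq> 0"
    using noncritical_near[of a] by (simp add: eventually_at_split)
  moreover have "\<forall>\<^sub>F y in at_right a. y < b" "\<forall>\<^sub>F y in at_right a. a < y"
    using assms by (auto simp: eventually_at_right_field)
  ultimately have "\<forall>\<^sub>F y in at_right a. a < y \<and> y < b \<and> W y \<noteq> 0"
    by eventually_elim auto
  then show ?thesis using that eventually_happens[of _ "at_right a"] by (auto simp: trivial_limit_at_right_real)
qed

end

section \<open>Orbits of bounded energy\<close>

lemma life_infinity: "t \<in> life \<infinity> \<longleftrightarrow> 0 \<le> t"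
  by (simp add: life_def)

lemma ev_infinity: "ev \<infinity> P \<longleftrightarrow> (\<exists>s\<ge>0. \<forall>t\<ge>s. P t)"
  unfolding ev_def by (meson life_infinity order_trans)

lemma increment_ge:
  fixes f :: "real \<Rightarrow> real"
  assumes "s \<le> t" "{s..t} \<subseteq> A"
    and f: "\<And>r. s \<le> r \<Longrightarrow> r \<le> t \<Longrightarrow> (f has_real_derivative f' r) (at r within A)"
    and c: "\<And>r. s \<le> r \<Longrightarrow> r \<le> t \<Longrightarrow> c \<le> f' r"
  shows "c * (t - s) \<le> f t - f s"
proof -
  have "f s - c * s \<le> f t - c * t"
  proof (rule nondecreasing_of_deriv_nonneg[OF assms(1,2), of "\<lambda>r. f r - c * r" "\<lambda>r. f' r - c"])
    show "((\<lambda>r. f r - c * r) has_real_derivative f' r - c) (at r within A)" if "s \<le> r" "r \<le> t" for r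
      using f[OF that] by (auto intro!: derivative_eq_intros)
  qed (use c in simp)
  then show ?thesis by (simp add: right_diff_distrib)
qed

lemma increment_le:
  fixes f :: "real \<Rightarrow> real"
  assumes "s \<le> t" "{s..t} \<subseteq> A"
    and f: "\<And>r. s \<le> r \<Longrightarrow> r \<le> t \<Longrightarrow> (f has_real_derivative f' r) (at r within A)"
    and c: "\<And>r. s \<le> r \<Longrightarrow> r \<le> t \<Longrightarrow> f' r \<le> c"
  shows "f t - f s \<le> c * (t - s)"
  using increment_ge[OF assms(1,2), of "\<lambda>r. - f r" "\<lambda>r. - f' r" "- c"] f c
  by (simp add: DERIV_minus)

lemma increment_abs_le:
  fixes f :: "real \<Rightarrow> real"
  assumes "s \<le> t" "{s..t} \<subseteq> A"
    and f: "\<And>r. s \<le> r \<Longrightarrow> r \<le> t \<Longrightarrow> (f has_real_derivative f' r) (at r within A)"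
    and c: "\<And>r. s \<le> r \<Longrightarrow> r \<le> t \<Longrightarrow> \<bar>f' r\<bar> \<le> c"
  shows "\<bar>f t - f s\<bar> \<le> c * (t - s)"
proof -
  have "- c \<le> f' r" "f' r \<le> c" if "s \<le> r" "r \<le> t" for r using c[OF that] by auto
  then have "- c * (t - s) \<le> f t - f s" "f t - f s \<le> c * (t - s)"
    using increment_ge[OF assms(1,2) f, of "- c"] increment_le[OF assms(1,2) f, of c] by auto
  then show ?thesis by simp
qed

text \<open>As \<open>v\<close> decreases whenever it vanishes, it cannot become positive again.\<close>

lemma falls_back:
  assumes o: "orbit V W T \<phi> v h" and s: "0 \<le> s" "s \<le> t" "t \<in> life T"
    and W: "\<And>r. s \<le> r \<Longrightarrow> r \<le> t \<Longrightarrow> 0 < W (\<phi> r)" and v: "v s \<le> 0"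
  shows "\<phi> t \<le> \<phi> s"
proof -
  note sub = life_Icc[OF s(1,3)]
  have neg: "0 \<le> - v r" if "s \<le> r" "r \<le> t" for r
  proof (rule barrier[OF that(1), of "life T" "\<lambda>r. - v r" "\<lambda>r. - (sqrt 3 * h r * v r - W (\<phi> r))"])
    show "{s..r} \<subseteq> life T" using sub that by auto
    fix x assume x: "s \<le> x" "x \<le> r"
    then have "x \<in> life T" using sub that by auto
    then show "((\<lambda>r. - v r) has_real_derivative - (sqrt 3 * h x * v x - W (\<phi> x))) (at x within life T)"
      by (intro DERIV_minus orbitD(2)[OF o])
    show "0 < - (sqrt 3 * h x * v x - W (\<phi> x))" if "- v x = 0" using W[of x] x that \<open>r \<le> t\<close> by simp
  qed (use v in simp)
  have "- \<phi> s \<le> - \<phi> t"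
  proof (rule nondecreasing_of_deriv_nonneg[OF s(2) sub])
    show "((\<lambda>r. - \<phi> r) has_real_derivative - v r) (at r within life T)" if "s \<le> r" "r \<le> t" for r
      using that sub by (intro DERIV_minus orbitD(1)[OF o]) auto
  qed (use neg in auto)
  then show ?thesis by simp
qed

text \<open>An orbit with \<open>v \<le> 0\<close> at a late time would fall back and never approach \<open>p\<close> from below.\<close>

lemma velocity_eventually_positive:
  assumes o: "orbit V W T \<phi> v h"
    and W: "ev T (\<lambda>t. 0 < W (\<phi> t) \<and> ereal (\<phi> t) < p)" and lim: "\<And>c. ereal c < p \<Longrightarrow> ev T (\<lambda>t. c < \<phi> t)"
  shows "ev T (\<lambda>t. 0 < v t)"
proof -
  obtain s where s: "s \<in> life T" and *: "\<And>t. t \<in> life T \<Longrightarrow> s \<le> t \<Longrightarrow> 0 < W (\<phi> t) \<and> ereal (\<phi> t) < p"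
    using W unfolding ev_def by auto
  show ?thesis
  proof (rule evI[OF s], rule ccontr)
    fix t assume t: "t \<in> life T" "s \<le> t" "\<not> 0 < v t"
    then have "ev T (\<lambda>r. \<phi> t < \<phi> r)" using lim * by auto
    then obtain r where r: "r \<in> life T" "t \<le> r" "\<phi> t < \<phi> r" using ev_after t(1) by metis
    have t0: "0 \<le> t" by (rule life_nonneg[OF t(1)])
    have W': "0 < W (\<phi> x)" if "t \<le> x" "x \<le> r" for x
    proof -
      have "x \<in> life T" using life_downward_closed[of x r T] that t0 r(1) by simp
      then show ?thesis using *[of x] that t(2) by simp
    qed
    have "\<phi> r \<le> \<phi> t" using t(3) by (intro falls_back[OF o t0 r(2,1) W']) simp_all
    then show False using r by simp
  qed
qed

text \<open>As \<open>h\<close> is bounded away from \<open>0\<close>, \<open>v \<rightarrow> 0\<close> implies \<open>x \<rightarrow> 0\<close>.\<close>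

lemma slow_orbit_climbs:
  assumes o: "orbit V W T \<phi> v h" and v: "\<And>e. 0 < e \<Longrightarrow> ev T (\<lambda>t. \<bar>v t\<bar> < e)"
    and W: "ev T (\<lambda>t. 0 < W (\<phi> t) \<and> ereal (\<phi> t) < p)" and lim: "\<And>c. ereal c < p \<Longrightarrow> ev T (\<lambda>t. c < \<phi> t)"
  shows "climbs W (\<lambda>_. 0) p T \<phi> v h"
proof -
  have z: "0 \<in> life T" by (rule orbit_zero_mem[OF o])
  have h0: "0 < h 0" using orbitD(5)[OF o z] .
  have h: "h 0 \<le> h t" if "t \<in> life T" for t
    using orbit_h_mono[OF o _ _ that] life_nonneg[OF that] by simp
  have small: "ev T (\<lambda>t. \<bar>v t\<bar> < e * h t)" if "0 < e" for e
  proof (rule ev_mono[OF v[of "e * h 0"]])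
    show "0 < e * h 0" using that h0 by simp
    show "\<bar>v t\<bar> < e * h t" if "t \<in> life T" "\<bar>v t\<bar> < e * h 0" for t
      using mult_left_mono[OF h[OF that(1)], of e] that \<open>0 < e\<close> by linarith
  qed
  have "ev T (\<lambda>t. 0 < v t \<and> 0 < W (\<phi> t) \<and> v t \<le> 1/2 * h t \<and> ereal (\<phi> t) < p)"
    by (rule ev_mono[OF ev_conj[OF velocity_eventually_positive[OF o W lim] ev_conj[OF W small[of "1/2"]]]]) auto
  moreover have "ev T (\<lambda>t. \<bar>v t / h t - 0\<bar> < e)" if "0 < e" for e
  proof (rule ev_mono[OF small[OF that]])
    show "\<bar>v t / h t - 0\<bar> < e" if "t \<in> life T" "\<bar>v t\<bar> < e * h t" for t
      using that orbitD(5)[OF o that(1)] by (simp add: abs_divide field_simps)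
  qed
  ultimately show ?thesis using lim unfolding climbs_def by (intro conjI exI[of _ "1/2"]) auto
qed

text \<open>Near a point where the force is positive, a slow orbit would be decelerated for so long that
  it becomes fast: it stays in the neighbourhood for the time \<open>d / \<delta>\<close>.\<close>

lemma slow_orbit_avoids_positive_force:
  assumes o: "orbit V W \<infinity> \<phi> v h" and H: "\<And>t. 0 \<le> t \<Longrightarrow> h t \<le> H"
    and v: "\<And>e. 0 < e \<Longrightarrow> ev \<infinity> (\<lambda>t. \<bar>v t\<bar> < e)" and W: "isCont W q" "0 < W q"
  shows "\<exists>d>0. ev \<infinity> (\<lambda>t. d < \<bar>\<phi> t - q\<bar>)"
proof -
  define m where "m = W q / 2"
  have m: "0 < m" using W by (simp add: m_def)
  obtain d0 where d0: "0 < d0" "\<And>x. dist x q < d0 \<Longrightarrow> dist (W x) (W q) < m"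
    using W(1) m unfolding continuous_at_eps_delta by metis
  define d where "d = d0 / 3"
  have d: "0 < d" "\<And>x. \<bar>x - q\<bar> \<le> 2 * d \<Longrightarrow> m < W x"
  proof -
    show "0 < d" using d0(1) by (simp add: d_def)
    show "m < W x" if "\<bar>x - q\<bar> \<le> 2 * d" for x
    proof -
      have "dist (W x) (W q) < m" using that d0(1) by (intro d0(2)) (simp add: d_def dist_real_def)
      then show ?thesis unfolding dist_real_def m_def by (simp add: abs_if split: if_splits)
    qed
  qed
  have H0: "0 < H" using H[of 0] orbitD(5)[OF o, of 0] by (simp add: life_infinity)
  \<comment> \<open>The speed bound \<open>\<delta>\<close> is so small that friction takes away at most half of the force, and that
    the deceleration \<open>m / 2\<close> during the time \<open>d / \<delta>\<close> changes \<open>v\<close> by more than \<open>2 \<delta>\<close>.\<close>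
  define \<delta> where "\<delta> = min (m / (4 * H)) (sqrt (m * d) / 3)"
  have \<delta>: "0 < \<delta>" using m H0 d by (simp add: \<delta>_def)
  have "\<delta> \<le> m / (4 * H)" by (simp add: \<delta>_def)
  then have \<delta>H: "2 * (H * \<delta>) \<le> m / 2" using H0 by (simp add: field_simps)
  have "\<delta> \<le> sqrt (m * d) / 3" by (simp add: \<delta>_def)
  then have "\<delta>\<^sup>2 \<le> (sqrt (m * d) / 3)\<^sup>2" using \<delta> by (intro power_mono) auto
  also have "\<dots> = m * d / 9" using m d by (simp add: power_divide)
  finally have \<delta>2: "9 * \<delta>\<^sup>2 \<le> m * d" by simp
  obtain s where s: "0 \<le> s" and vs: "\<And>t. s \<le> t \<Longrightarrow> \<bar>v t\<bar> < \<delta>"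
    using v[OF \<delta>] unfolding ev_infinity by metis
  have "d < \<bar>\<phi> t - q\<bar>" if t: "s \<le> t" for t
  proof (rule ccontr)
    assume "\<not> d < \<bar>\<phi> t - q\<bar>"
    then have near: "\<bar>\<phi> t - q\<bar> \<le> d" by simp
    have sub: "{t..r} \<subseteq> life \<infinity>" for r using s t by (auto simp: life_infinity)
    have force: "m < W (\<phi> r)" if r: "t \<le> r" "r \<le> t + d / \<delta>" for r
    proof (rule d(2))
      have "\<bar>\<phi> r - \<phi> t\<bar> \<le> \<delta> * (r - t)"
      proof (rule increment_abs_le[OF r(1) sub])
        show "\<bar>v x\<bar> \<le> \<delta>" if "t \<le> x" for x using vs[of x] t that by simp
      qed (use s t in \<open>auto intro!: orbitD(1)[OF o] simp: life_infinity\<close>)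
      also have "\<dots> \<le> \<delta> * (d / \<delta>)" using r \<delta> by (intro mult_left_mono) auto
      also have "\<dots> = d" using \<delta> by simp
      finally show "\<bar>\<phi> r - q\<bar> \<le> 2 * d" using near by linarith
    qed
    define t' where "t' = t + d / \<delta>"
    have t': "t \<le> t'" "t' - t = d / \<delta>" using d \<delta> by (auto simp: t'_def)
    have "v t' - v t \<le> (- m / 2) * (t' - t)"
    proof (rule increment_le[OF t'(1) sub])
      fix r assume r: "t \<le> r" "r \<le> t'"
      have r0: "0 \<le> r" using r s t by simp
      show "(v has_real_derivative sqrt 3 * h r * v r - W (\<phi> r)) (at r within life \<infinity>)"
        by (rule orbitD(2)[OF o]) (simp add: life_infinity r0)
      have "0 < h r" using orbitD(5)[OF o] r0 by (simp add: life_infinity)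
      have "h r * v r \<le> h r * \<bar>v r\<bar>" using \<open>0 < h r\<close> by (intro mult_left_mono) auto
      also have "\<dots> \<le> H * \<delta>" using vs[of r] t r H[OF r0] H0 by (intro mult_mono) auto
      finally have "h r * v r \<le> H * \<delta>" .
      then have "sqrt 3 * (h r * v r) \<le> sqrt 3 * (H * \<delta>)" by (intro mult_left_mono) auto
      also have "\<dots> \<le> 2 * (H * \<delta>)" using sqrt3_bounds H0 \<delta> by (intro mult_right_mono) auto
      finally have "sqrt 3 * (h r * v r) \<le> m / 2" using \<delta>H by linarith
      moreover have "m < W (\<phi> r)" using force r by (simp add: t'_def)
      moreover have "sqrt 3 * h r * v r = sqrt 3 * (h r * v r)" by (rule mult.assoc)
      ultimately show "sqrt 3 * h r * v r - W (\<phi> r) \<le> - m / 2" by linarith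
    qed
    also have "\<dots> = - (m * d / (2 * \<delta>))" unfolding t'(2) by simp
    also have "\<dots> \<le> - (9 * \<delta>\<^sup>2 / (2 * \<delta>))" using \<delta> \<delta>2 by (intro le_imp_neg_le divide_right_mono) auto
    also have "\<dots> = - (9 / 2 * \<delta>)" using \<delta> by (simp add: power2_eq_square)
    finally have "v t' \<le> v t - 9 / 2 * \<delta>" by linarith
    then show False using vs[of t] vs[of t'] t t'(1) \<delta> by linarith
  qed
  then show ?thesis using d(1) s by (intro exI[of _ d] conjI evI[of s]) (auto simp: life_infinity)
qed

context confining_potential
begin

lemma slow_orbit_avoids_noncritical:
  assumes o: "orbit V W \<infinity> \<phi> v h" and H: "\<And>t. 0 \<le> t \<Longrightarrow> h t \<le> H"
    and v: "\<And>e. 0 < e \<Longrightarrow> ev \<infinity> (\<lambda>t. \<bar>v t\<bar> < e)" and W: "W q \<noteq> 0"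
  shows "\<exists>d>0. ev \<infinity> (\<lambda>t. d < \<bar>\<phi> t - q\<bar>)"
proof (cases "0 < W q")
  case True
  show ?thesis by (rule slow_orbit_avoids_positive_force[OF o H v W_isCont True])
next
  case False
  interpret M: confining_potential "\<lambda>x. V (- x)" "\<lambda>x. - W (- x)" "\<lambda>x. W' (- x)" R \<rho> K
    by (rule reflection)
  have "\<exists>d>0. ev \<infinity> (\<lambda>t. d < \<bar>- \<phi> t - - q\<bar>)"
    by (rule slow_orbit_avoids_positive_force[OF orbit_reflect[OF o] H _ M.W_isCont])
       (use v W False in simp_all)
  moreover have "\<bar>- \<phi> t - - q\<bar> = \<bar>\<phi> t - q\<bar>" for t by (simp add: abs_minus_commute)
  ultimately show ?thesis by simp
qed

text \<open>Barbalat's argument: \<open>h\<close> is nondecreasing and bounded with \<open>h' = sqrt 3 v\<^sup>2\<close>, and \<open>v\<close> is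
  Lipschitz, as the force is bounded along the orbit: for large \<open>\<bar>\<phi>\<bar>\<close> it is dominated by the
  potential, hence by the energy.\<close>

lemma bounded_orbit_slow:
  assumes o: "orbit V W \<infinity> \<phi> v h" and H: "\<And>t. 0 \<le> t \<Longrightarrow> h t \<le> H" and e: "0 < e"
  shows "ev \<infinity> (\<lambda>t. \<bar>v t\<bar> < e)"
proof -
  have od: "(v has_real_derivative sqrt 3 * h t * v t - W (\<phi> t)) (at t within life \<infinity>)"
    "(h has_real_derivative sqrt 3 * (v t)\<^sup>2) (at t within life \<infinity>)"
    "(h t)\<^sup>2 = (v t)\<^sup>2 + 2 * V (\<phi> t)" "0 < h t" if "0 \<le> t" for t
    using orbitD[OF o, of t] that by (auto simp: life_infinity)
  have H0: "0 < H" using H[of 0] od(4)[of 0] by simp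
  have h2: "(h t)\<^sup>2 \<le> H\<^sup>2" if "0 \<le> t" for t using H[OF that] od(4)[OF that] by (intro power_mono) auto
  define A where "A = sqrt (H\<^sup>2 + 2 * K)"
  have A: "\<bar>v t\<bar> \<le> A" if "0 \<le> t" for t
    unfolding A_def using od(3)[OF that] h2[OF that] V_below[of "\<phi> t"] by (intro real_le_rsqrt) auto
  have A0: "0 \<le> A" using A[of 0] by simp
  obtain B where "\<forall>x\<in>{-R..R}. \<bar>W x\<bar> \<le> B" using W_bounded by blast
  then have B: "\<bar>W x\<bar> \<le> B" if "\<bar>x\<bar> \<le> R" for x using that by (simp add: abs_le_iff)
  have B0: "0 \<le> B" using B[of 0] R_pos by simp
  have force: "\<bar>W (\<phi> t)\<bar> \<le> B + 2 * H\<^sup>2" if t: "0 \<le> t" for t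
  proof (cases "\<bar>\<phi> t\<bar> \<le> R")
    case True
    have "0 \<le> H\<^sup>2" by simp
    with B[OF True] show ?thesis by linarith
  next
    case False
    have VW: "0 < V (\<phi> t)" "\<bar>W (\<phi> t)\<bar> \<le> \<rho> * (2 * sqrt 3 * V (\<phi> t))"
      using far_right[of "\<phi> t"] far_left[of "\<phi> t"] False by (auto simp: abs_if split: if_splits)
    have "\<rho> * (2 * sqrt 3 * V (\<phi> t)) \<le> 1 * (2 * sqrt 3 * V (\<phi> t))"
      using \<rho>_less VW(1) by (intro mult_right_mono) auto
    also have "\<dots> = sqrt 3 * (2 * V (\<phi> t))" by simp
    also have "\<dots> \<le> 2 * (2 * V (\<phi> t))" using sqrt3_bounds VW(1) by (intro mult_right_mono) auto
    also have "2 * V (\<phi> t) \<le> H\<^sup>2" using od(3)[OF t] h2[OF t] zero_le_power2[of "v t"] by linarith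
    finally show ?thesis using VW(2) B0 by linarith
  qed
  define L where "L = 2 * (H * A) + (B + 2 * H\<^sup>2) + 1"
  have "0 \<le> H * A" "0 \<le> H\<^sup>2" using H0 A0 by auto
  then have L0: "0 < L" using B0 unfolding L_def by linarith
  have acc: "\<bar>sqrt 3 * h t * v t - W (\<phi> t)\<bar> \<le> L" if t: "0 \<le> t" for t
  proof -
    have "\<bar>h t * v t\<bar> \<le> H * A" unfolding abs_mult using H[OF t] od(4)[OF t] A[OF t] H0 by (intro mult_mono) auto
    then have "sqrt 3 * \<bar>h t * v t\<bar> \<le> 2 * (H * A)" using sqrt3_bounds by (intro mult_mono) auto
    moreover have "\<bar>sqrt 3 * h t * v t\<bar> = sqrt 3 * \<bar>h t * v t\<bar>" by (simp add: abs_mult)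
    ultimately show ?thesis using force[OF t] unfolding L_def by linarith
  qed
  \<comment> \<open>While \<open>\<bar>v\<bar>\<close> falls from \<open>e\<close> to \<open>e / 2\<close>, \<open>h\<close> gains at least \<open>\<eta>\<close>. This cannot happen once \<open>h\<close> is
    within \<open>\<eta>\<close> of its supremum.\<close>
  define \<eta> where "\<eta> = (e / 2)\<^sup>2 * (e / (2 * L))"
  have \<eta>: "0 < \<eta>" using e L0 by (simp add: \<eta>_def)
  have ne: "h ` {0..} \<noteq> {}" and bdd: "bdd_above (h ` {0..})" using H by (auto intro!: bdd_aboveI2)
  obtain s where s: "0 \<le> s" "Sup (h ` {0..}) - \<eta> < h s"
    using less_cSup_iff[OF ne bdd, of "Sup (h ` {0..}) - \<eta>"] \<eta> by auto
  have "\<bar>v t\<bar> < e" if t: "s \<le> t" for t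
  proof (rule ccontr)
    assume "\<not> \<bar>v t\<bar> < e"
    then have ve: "e \<le> \<bar>v t\<bar>" by simp
    define t' where "t' = t + e / (2 * L)"
    have t': "t \<le> t'" "t' - t = e / (2 * L)" using e L0 by (auto simp: t'_def)
    have sub: "{t..r} \<subseteq> life \<infinity>" for r using s t by (auto simp: life_infinity)
    have fast: "e / 2 \<le> \<bar>v r\<bar>" if r: "t \<le> r" "r \<le> t'" for r
    proof -
      have "\<bar>v r - v t\<bar> \<le> L * (r - t)"
      proof (rule increment_abs_le[OF r(1) sub])
        fix x assume "t \<le> x"
        then have "0 \<le> x" using s t by simp
        then show "(v has_real_derivative sqrt 3 * h x * v x - W (\<phi> x)) (at x within life \<infinity>)"
          "\<bar>sqrt 3 * h x * v x - W (\<phi> x)\<bar> \<le> L" by (rule od(1), rule acc)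
      qed
      also have "\<dots> \<le> L * (e / (2 * L))" using r L0 t'(2) by (intro mult_left_mono) auto
      also have "\<dots> = e / 2" using L0 by simp
      finally show ?thesis using ve by linarith
    qed
    have "(e / 2)\<^sup>2 * (t' - t) \<le> h t' - h t"
    proof (rule increment_ge[OF t'(1) sub])
      fix r assume r: "t \<le> r" "r \<le> t'"
      show "(h has_real_derivative sqrt 3 * (v r)\<^sup>2) (at r within life \<infinity>)" using r s t by (intro od(2)) simp
      have "(e / 2)\<^sup>2 \<le> \<bar>v r\<bar>\<^sup>2" using fast[OF r] e by (intro power_mono) auto
      then have "1 * (e / 2)\<^sup>2 \<le> sqrt 3 * (v r)\<^sup>2" using sqrt3_bounds by (intro mult_mono) auto
      then show "(e / 2)\<^sup>2 \<le> sqrt 3 * (v r)\<^sup>2" by simp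
    qed
    then have "\<eta> \<le> h t' - h t" unfolding t'(2) \<eta>_def .
    moreover have "h s \<le> h t" using orbit_h_mono[OF o s(1) t] s t by (simp add: life_infinity)
    moreover have "h t' \<le> Sup (h ` {0..})" using bdd s t t'(1) by (intro cSup_upper) auto
    ultimately show False using s(2) by linarith
  qed
  then show ?thesis using s(1) by (intro evI[of s]) (auto simp: life_infinity)
qed

text \<open>The limit of \<open>\<phi>\<close> exists, because the orbit finally avoids each noncritical point, and these
  are dense.\<close>

lemma bounded_orbit_converges:
  assumes o: "orbit V W \<infinity> \<phi> v h" and H: "\<And>t. 0 \<le> t \<Longrightarrow> h t \<le> H"
  obtains (right) "\<And>c. ev \<infinity> (\<lambda>t. c < \<phi> t)" | (left) "\<And>c. ev \<infinity> (\<lambda>t. \<phi> t < c)"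
    | (point) p where "W p = 0" "\<And>e. 0 < e \<Longrightarrow> ev \<infinity> (\<lambda>t. \<bar>\<phi> t - p\<bar> < e)"
proof -
  have slow: "ev \<infinity> (\<lambda>t. \<bar>v t\<bar> < e)" if "0 < e" for e
    using bounded_orbit_slow[OF o H that] .
  have side: "ev \<infinity> (\<lambda>t. q < \<phi> t) \<or> ev \<infinity> (\<lambda>t. \<phi> t < q)" if Wq: "W q \<noteq> 0" for q
  proof -
    obtain d where "0 < d" "ev \<infinity> (\<lambda>t. d < \<bar>\<phi> t - q\<bar>)"
      using slow_orbit_avoids_noncritical[OF o H slow Wq] by auto
    then obtain s where s: "0 \<le> s" "\<And>t. s \<le> t \<Longrightarrow> d < \<bar>\<phi> t - q\<bar>"
      unfolding ev_infinity by metis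
    then have ne: "\<phi> t \<noteq> q" if "s \<le> t" for t using that \<open>0 < d\<close> by fastforce
    have cont: "continuous_on {s..t} \<phi>" for t
      by (rule continuous_on_subset[OF orbit_continuous(1)[OF o]]) (use s in \<open>auto simp: life_infinity\<close>)
    show ?thesis
    proof (cases "q < \<phi> s")
      case True
      have "q < \<phi> t" if "s \<le> t" for t
        using IVT2'[of \<phi> t q s] cont[of t] that True ne by (metis atLeastAtMost_iff less_imp_le not_le)
      then show ?thesis using s(1) by (intro disjI1 evI[of s]) (auto simp: life_infinity)
    next
      case False
      have "\<phi> t < q" if "s \<le> t" for t
        using IVT'[of \<phi> s q t] cont[of t] that False ne by (metis atLeastAtMost_iff less_imp_le not_le)
      then show ?thesis using s(1) by (intro disjI2 evI[of s]) (auto simp: life_infinity)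
    qed
  qed
  \<comment> \<open>If the limit is finite, it is the supremum of the levels that \<open>\<phi>\<close> finally exceeds.\<close>
  define A where "A = {q. ev \<infinity> (\<lambda>t. q < \<phi> t)}"
  have above: "ev \<infinity> (\<lambda>t. \<phi> t < b)" if a: "a \<notin> A" "a < b" for a b
  proof -
    obtain q where q: "a < q" "q < b" "W q \<noteq> 0" using noncritical_between[OF a(2)] .
    have "q \<notin> A" using a(1) q(1) ev_mono[of \<infinity> "\<lambda>t. q < \<phi> t" "\<lambda>t. a < \<phi> t"] by (auto simp: A_def)
    then have "ev \<infinity> (\<lambda>t. \<phi> t < q)" using side[OF q(3)] by (simp add: A_def)
    then show ?thesis by (rule ev_mono) (use q in simp)
  qed
  consider "A = UNIV" | "A = {}" | "A \<noteq> {}" "A \<noteq> UNIV" by blast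
  then show ?thesis
  proof cases
    case 1
    then show ?thesis using right by (auto simp: A_def)
  next
    case 2
    have "ev \<infinity> (\<lambda>t. \<phi> t < c)" for c by (rule above[of "c - 1"]) (use 2 in auto)
    then show ?thesis by (rule left)
  next
    case 3
    then obtain b where b: "b \<notin> A" by blast
    have "a \<le> b" if "a \<in> A" for a
      using b that ev_mono[of \<infinity> "\<lambda>t. a < \<phi> t" "\<lambda>t. b < \<phi> t"] by (force simp: A_def)
    then have bdd: "bdd_above A" by (rule bdd_aboveI)
    define p where "p = Sup A"
    have near: "ev \<infinity> (\<lambda>t. \<bar>\<phi> t - p\<bar> < e)" if e: "0 < e" for e
    proof -
      obtain a where a: "a \<in> A" "p - e < a"
        using less_cSup_iff[OF 3(1) bdd, of "p - e"] e by (auto simp: p_def)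
      have "p + e / 2 \<notin> A" using cSup_upper[OF _ bdd, of "p + e / 2"] e by (auto simp: p_def)
      then have "ev \<infinity> (\<lambda>t. \<phi> t < p + e)" by (rule above) (use e in simp)
      moreover have "ev \<infinity> (\<lambda>t. a < \<phi> t)" using a by (simp add: A_def)
      ultimately have "ev \<infinity> (\<lambda>t. \<phi> t < p + e \<and> a < \<phi> t)" by (rule ev_conj)
      then show ?thesis by (rule ev_mono) (use a in auto)
    qed
    have "W p = 0"
    proof (rule ccontr)
      assume "W p \<noteq> 0"
      then obtain d where "0 < d" "ev \<infinity> (\<lambda>t. d < \<bar>\<phi> t - p\<bar>)"
        using slow_orbit_avoids_noncritical[OF o H slow, of p] by auto
      then have "ev \<infinity> (\<lambda>t. d < \<bar>\<phi> t - p\<bar> \<and> \<bar>\<phi> t - p\<bar> < d)" using ev_conj near by blast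
      then show False unfolding ev_infinity by force
    qed
    then show ?thesis using near by (rule point)
  qed
qed

end

definition rests :: "real \<Rightarrow> ereal \<Rightarrow> (real \<Rightarrow> real) \<Rightarrow> (real \<Rightarrow> real) \<Rightarrow> bool" where
  "rests p T \<phi> v \<longleftrightarrow> (\<exists>t\<in>life T. \<phi> t = p \<and> v t = 0)"

text \<open>The possible limits, other than \<open>-\<infinity>\<close>, of an orbit of bounded energy.\<close>

definition climb_ends :: "(real \<Rightarrow> real) \<Rightarrow> ereal set" where
  "climb_ends W = insert \<infinity> (ereal ` {p. W p = 0})"

context confining_potential
begin

text \<open>Critical points being isolated, \<open>W\<close> has a constant sign to the left of \<open>p\<close>; by the mean value
  theorem it is the sign of \<open>V(p) - V(y)\<close>.\<close>

lemma force_below_maximum: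
  assumes "\<forall>\<^sub>F y in at p. V y \<le> V p"
  obtains r where "0 < r" "\<And>y. p - r < y \<Longrightarrow> y < p \<Longrightarrow> 0 < W y"
proof -
  have "\<forall>\<^sub>F y in at p. V y \<le> V p \<and> W y \<noteq> 0"
    using assms noncritical_near[of p] by (rule eventually_conj)
  then obtain r where r: "0 < r" and *: "\<And>y. y \<noteq> p \<Longrightarrow> dist y p < r \<Longrightarrow> V y \<le> V p \<and> W y \<noteq> 0"
    unfolding eventually_at by blast
  have "0 < W y" if y: "p - r < y" "y < p" for y
  proof (rule ccontr)
    assume "\<not> 0 < W y"
    obtain z where z: "y < z" "z < p" "V p - V y = (p - y) * W z"
      using MVT2[OF y(2), of V W] V_deriv by blast
    have "V y \<le> V p" using *[of y] y by (simp add: dist_real_def)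
    then have "0 \<le> (p - y) * W z" using z(3) by linarith
    then have Wz: "0 \<le> W z" using y by (simp add: zero_le_mult_iff)
    have "continuous_on {y..z} W" using W_isCont by (intro continuous_at_imp_continuous_on) auto
    then obtain x where x: "y \<le> x" "x \<le> z" "W x = 0"
      using IVT'[of W y 0 z] \<open>\<not> 0 < W y\<close> Wz z(1) by auto
    then show False using *[of x] y z by (auto simp: dist_real_def)
  qed
  with r show ?thesis by (rule that)
qed

lemma slow_orbit_climbs_to_maximum:
  assumes o: "orbit V W T \<phi> v h" and slow: "\<And>e. 0 < e \<Longrightarrow> ev T (\<lambda>t. \<bar>v t\<bar> < e)"
    and near: "\<And>e. 0 < e \<Longrightarrow> ev T (\<lambda>t. \<bar>\<phi> t - p\<bar> < e)"
    and max: "\<forall>\<^sub>F y in at p. V y \<le> V p" and below: "ev T (\<lambda>t. \<phi> t < p)"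
  shows "climbs W (\<lambda>_. 0) (ereal p) T \<phi> v h"
proof -
  obtain r where r: "0 < r" "\<And>y. p - r < y \<Longrightarrow> y < p \<Longrightarrow> 0 < W y"
    using force_below_maximum[OF max] by metis
  show ?thesis
  proof (rule slow_orbit_climbs[OF o slow])
    show "ev T (\<lambda>t. 0 < W (\<phi> t) \<and> ereal (\<phi> t) < ereal p)"
      by (rule ev_mono[OF ev_conj[OF below near[OF r(1)]]]) (use r(2) in auto)
    show "ev T (\<lambda>t. c < \<phi> t)" if "ereal c < ereal p" for c
      by (rule ev_mono[OF near[of "p - c"]]) (use that in auto)
  qed
qed

text \<open>If \<open>\<phi>\<close> tends to a critical point \<open>p\<close>, then \<open>\<epsilon> \<le> 2 V(p)\<close> by monotonicity. Hence the orbit rests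
  whenever it is at \<open>p\<close>, and near a minimum it can do nothing else. At a maximum it climbs.\<close>

lemma bounded_orbit_exceptional:
  assumes o: "orbit V W \<infinity> \<phi> v h" and H: "\<And>t. 0 \<le> t \<Longrightarrow> h t \<le> H"
  shows "(\<exists>p. W p = 0 \<and> rests p \<infinity> \<phi> v) \<or> (\<exists>p\<in>climb_ends W. climbs W (\<lambda>_. 0) p \<infinity> \<phi> v h) \<or>
    (\<exists>p\<in>climb_ends (\<lambda>x. - W (- x)). climbs (\<lambda>x. - W (- x)) (\<lambda>_. 0) p \<infinity> (\<lambda>t. - \<phi> t) (\<lambda>t. - v t) h)"
proof -
  interpret M: confining_potential "\<lambda>x. V (- x)" "\<lambda>x. - W (- x)" "\<lambda>x. W' (- x)" R \<rho> K
    by (rule reflection)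
  have slow: "ev \<infinity> (\<lambda>t. \<bar>v t\<bar> < e)" if "0 < e" for e
    using bounded_orbit_slow[OF o H that] .
  have slow': "ev \<infinity> (\<lambda>t. \<bar>- v t\<bar> < e)" if "0 < e" for e
    using slow[OF that] by simp
  have inside: "0 \<le> t \<Longrightarrow> t \<in> life \<infinity>" for t by (simp add: life_infinity)
  show ?thesis
  proof (rule bounded_orbit_converges[OF o H])
    assume *: "\<And>c. ev \<infinity> (\<lambda>t. c < \<phi> t)"
    have "climbs W (\<lambda>_. 0) \<infinity> \<infinity> \<phi> v h"
    proof (rule slow_orbit_climbs[OF o slow])
      show "ev \<infinity> (\<lambda>t. 0 < W (\<phi> t) \<and> ereal (\<phi> t) < \<infinity>)"
        by (rule ev_mono[OF *[of R]]) (use far_right in auto)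
    qed (use * in auto)
    then show ?thesis by (auto simp: climb_ends_def)
  next
    assume *: "\<And>c. ev \<infinity> (\<lambda>t. \<phi> t < c)"
    have "climbs (\<lambda>x. - W (- x)) (\<lambda>_. 0) \<infinity> \<infinity> (\<lambda>t. - \<phi> t) (\<lambda>t. - v t) h"
    proof (rule slow_orbit_climbs[OF orbit_reflect[OF o] slow'])
      show "ev \<infinity> (\<lambda>t. 0 < - W (- (- \<phi> t)) \<and> ereal (- \<phi> t) < \<infinity>)"
        by (rule ev_mono[OF *[of "- R"]]) (use far_left in auto)
      show "ev \<infinity> (\<lambda>t. c < - \<phi> t)" for c
        by (rule ev_mono[OF *[of "- c"]]) auto
    qed auto
    then show ?thesis by (auto simp: climb_ends_def)
  next
    fix p assume p: "W p = 0" and near: "\<And>e. 0 < e \<Longrightarrow> ev \<infinity> (\<lambda>t. \<bar>\<phi> t - p\<bar> < e)"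
    have energy: "(h t)\<^sup>2 \<le> 2 * V p" if t: "0 \<le> t" for t
    proof (rule ccontr)
      assume neg: "\<not> (h t)\<^sup>2 \<le> 2 * V p"
      define e where "e = ((h t)\<^sup>2 - 2 * V p) / 4"
      have e: "0 < e" using neg by (simp add: e_def)
      obtain d where d: "0 < d" "\<And>x. dist x p < d \<Longrightarrow> dist (V x) (V p) < e"
        using V_isCont[of p] e unfolding continuous_at_eps_delta by metis
      have "ev \<infinity> (\<lambda>r. \<bar>v r\<bar> < sqrt e \<and> \<bar>\<phi> r - p\<bar> < d)"
        using e d by (intro ev_conj slow near) auto
      then obtain r where r: "t \<le> r" "\<bar>v r\<bar> < sqrt e" "\<bar>\<phi> r - p\<bar> < d"
        by (rule ev_after[OF _ inside[OF t]]) blast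
      have "0 \<le> r" using r t by simp
      have "h t \<le> h r" using orbit_h_mono[OF o t r(1)] inside[OF \<open>0 \<le> r\<close>] by simp
      then have "(h t)\<^sup>2 \<le> (h r)\<^sup>2" using orbitD(5)[OF o inside[OF t]] by (intro power_mono) auto
      moreover have "(v r)\<^sup>2 < e"
      proof -
        have "\<bar>v r\<bar>\<^sup>2 < (sqrt e)\<^sup>2" using r(2) by (intro power_strict_mono) auto
        then show ?thesis using e by simp
      qed
      moreover have "V (\<phi> r) < V p + e"
        using d(2)[of "\<phi> r"] r(3) by (auto simp: dist_real_def abs_if split: if_splits)
      moreover have "(h r)\<^sup>2 = (v r)\<^sup>2 + 2 * V (\<phi> r)" by (rule orbitD(4)[OF o inside[OF \<open>0 \<le> r\<close>]])
      moreover have "4 * e = (h t)\<^sup>2 - 2 * V p" by (simp add: e_def)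
      ultimately show False using e by linarith
    qed
    have still: "v t = 0" if "0 \<le> t" "V p \<le> V (\<phi> t)" for t
    proof -
      have "(v t)\<^sup>2 \<le> 0" using energy[OF that(1)] orbitD(4)[OF o inside[OF that(1)]] that(2) by linarith
      then show ?thesis by simp
    qed
    show ?thesis
    proof (cases "\<exists>t\<ge>0. \<phi> t = p")
      case True
      then obtain t where "0 \<le> t" "\<phi> t = p" by blast
      then have "rests p \<infinity> \<phi> v" using still[of t] inside unfolding rests_def by (intro bexI[of _ t]) auto
      then show ?thesis using p by blast
    next
      case False
      have "\<not> (\<forall>\<^sub>F y in at p. V p \<le> V y)"
      proof
        assume "\<forall>\<^sub>F y in at p. V p \<le> V y"
        then obtain d where d: "0 < d" "\<And>x. x \<noteq> p \<Longrightarrow> dist x p < d \<Longrightarrow> V p \<le> V x"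
          unfolding eventually_at by blast
        obtain s where s: "0 \<le> s" "\<And>t. s \<le> t \<Longrightarrow> \<bar>\<phi> t - p\<bar> < d"
          using near[OF d(1)] unfolding ev_infinity by metis
        have v0: "v t = 0" if "s \<le> t" for t
          using still[of t] d(2)[of "\<phi> t"] s(2)[OF that] s(1) that by (cases "\<phi> t = p") (auto simp: dist_real_def)
        have const: "\<phi> t = \<phi> s" if "s \<le> t" for t
        proof -
          have "\<bar>\<phi> t - \<phi> s\<bar> \<le> 0 * (t - s)"
          proof (rule increment_abs_le[OF that])
            show "{s..t} \<subseteq> life \<infinity>" using s(1) by (auto simp: life_infinity)
            fix r assume r: "s \<le> r"
            then have "0 \<le> r" using s(1) by simp
            then show "(\<phi> has_real_derivative v r) (at r within life \<infinity>)" by (intro orbitD(1)[OF o inside])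
            show "\<bar>v r\<bar> \<le> 0" using v0[OF r] by simp
          qed
          then show ?thesis by simp
        qed
        have "0 < \<bar>\<phi> s - p\<bar>" using False s(1) by auto
        then have "ev \<infinity> (\<lambda>t. \<bar>\<phi> t - p\<bar> < \<bar>\<phi> s - p\<bar>)" by (rule near)
        then obtain t where "s \<le> t" "\<bar>\<phi> t - p\<bar> < \<bar>\<phi> s - p\<bar>"
          by (rule ev_after[OF _ inside[OF s(1)]])
        then show False using const[OF \<open>s \<le> t\<close>] by simp
      qed
      then have max: "\<forall>\<^sub>F y in at p. V y \<le> V p" using critical[OF p] by blast
      have cont: "continuous_on {0..t} \<phi>" for t
        by (rule continuous_on_subset[OF orbit_continuous(1)[OF o]]) (auto simp: life_infinity)
      show ?thesis
      proof (cases "\<phi> 0 < p")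
        case True
        have "\<phi> t < p" if t: "0 \<le> t" for t
        proof (rule ccontr)
          assume "\<not> \<phi> t < p"
          then obtain r where "0 \<le> r" "\<phi> r = p" using IVT'[of \<phi> 0 p t] cont[of t] t True by auto
          then show False using False by blast
        qed
        then have "ev \<infinity> (\<lambda>t. \<phi> t < p)" unfolding ev_infinity by blast
        then have "climbs W (\<lambda>_. 0) (ereal p) \<infinity> \<phi> v h"
          by (intro slow_orbit_climbs_to_maximum[OF o slow near max])
        then show ?thesis using p by (auto simp: climb_ends_def)
      next
        case F: False
        then have "p < \<phi> 0" using False by (metis linorder_neqE order_refl)
        have "p < \<phi> t" if t: "0 \<le> t" for t
        proof (rule ccontr)
          assume "\<not> p < \<phi> t"
          then obtain r where "0 \<le> r" "\<phi> r = p" using IVT2'[of \<phi> t p 0] cont[of t] t \<open>p < \<phi> 0\<close> by auto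
          then show False using False by blast
        qed
        then have below: "ev \<infinity> (\<lambda>t. - \<phi> t < - p)" unfolding ev_infinity by auto
        have near': "ev \<infinity> (\<lambda>t. \<bar>- \<phi> t - - p\<bar> < e)" if "0 < e" for e
          using near[OF that] by (simp add: abs_minus_commute)
        have "\<forall>\<^sub>F y in at (- p). V (- y) \<le> V (- (- p))"
          using max eventually_filtermap[of "\<lambda>y. V (- y) \<le> V p" uminus "at p"] by (simp add: filtermap_at_minus)
        then have "climbs (\<lambda>x. - W (- x)) (\<lambda>_. 0) (ereal (- p)) \<infinity> (\<lambda>t. - \<phi> t) (\<lambda>t. - v t) h"
          using below by (intro M.slow_orbit_climbs_to_maximum[OF orbit_reflect[OF o] slow' near'])
        moreover have "ereal (- p) \<in> climb_ends (\<lambda>x. - W (- x))"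
          unfolding climb_ends_def using p by (intro insertI2 imageI) simp
        ultimately show ?thesis by blast
      qed
    qed
  qed
qed

end

section \<open>Orbits of unbounded energy\<close>

text \<open>In terms of \<open>x = v / h\<close> the equation of motion is \<open>x' = sqrt 3 h (1 - x\<^sup>2) (x - u)\<close> with
  \<open>\<bar>u\<bar> \<le> \<rho> < 1\<close> for large \<open>\<bar>\<phi>\<bar>\<close>; for bounded \<open>\<phi>\<close> and large \<open>h\<close>, \<open>x\<^sup>2\<close> is close to \<open>1\<close>. So at high
  energy the regions \<open>x \<ge> \<kappa>\<close> and \<open>x \<le> - \<kappa>\<close> are traps for each \<open>\<kappa>\<close> between \<open>\<rho>\<close> and \<open>1\<close>.\<close>

context confining_potential
begin

lemma fast_motion_persists:
  assumes o: "orbit V W T \<phi> v h" and \<kappa>: "\<rho> < \<kappa>" "0 < \<kappa>" "\<kappa> < 1"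
    and s: "0 \<le> s" "s \<le> t" "t \<in> life T"
    and inner: "\<And>r. s \<le> r \<Longrightarrow> r \<le> t \<Longrightarrow> \<bar>\<phi> r\<bar> \<le> R \<Longrightarrow> 2 * V (\<phi> r) < (1 - \<kappa>\<^sup>2) * (h r)\<^sup>2"
    and v: "\<kappa> * h s \<le> v s"
  shows "\<kappa> * h t \<le> v t"
proof -
  have sub: "{s..t} \<subseteq> life T" using life_Icc[OF s(1,3)] .
  have "0 \<le> v t - \<kappa> * h t"
  proof (rule barrier[OF s(2) sub, of "\<lambda>r. v r - \<kappa> * h r"
        "\<lambda>r. sqrt 3 * h r * v r - W (\<phi> r) - \<kappa> * (sqrt 3 * (v r)\<^sup>2)"])
    fix r assume r: "s \<le> r" "r \<le> t"
    then have rl: "r \<in> life T" using sub by auto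
    show "((\<lambda>r. v r - \<kappa> * h r) has_real_derivative
        sqrt 3 * h r * v r - W (\<phi> r) - \<kappa> * (sqrt 3 * (v r)\<^sup>2)) (at r within life T)"
      by (intro DERIV_diff DERIV_cmult orbitD[OF o rl])
    assume "v r - \<kappa> * h r = 0"
    then have vr: "v r = \<kappa> * h r" by simp
    have h: "0 < h r" by (rule orbitD(5)[OF o rl])
    have V: "2 * V (\<phi> r) = (1 - \<kappa>\<^sup>2) * (h r)\<^sup>2"
      using orbitD(4)[OF o rl] unfolding vr by (simp add: power_mult_distrib algebra_simps)
    have pos: "0 < sqrt 3 * ((1 - \<kappa>\<^sup>2) * (h r)\<^sup>2)"
      using \<kappa> h by (auto intro!: mult_pos_pos simp: power_less_one_iff)
    have eq: "sqrt 3 * h r * v r - \<kappa> * (sqrt 3 * (v r)\<^sup>2) = \<kappa> * (sqrt 3 * ((1 - \<kappa>\<^sup>2) * (h r)\<^sup>2))"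
      unfolding vr by (simp add: power2_eq_square algebra_simps)
    have out: "\<not> \<bar>\<phi> r\<bar> \<le> R" using inner[OF r] V by auto
    have "W (\<phi> r) < \<kappa> * (sqrt 3 * ((1 - \<kappa>\<^sup>2) * (h r)\<^sup>2))"
    proof (cases "R \<le> \<phi> r")
      case True
      have "W (\<phi> r) \<le> \<rho> * (sqrt 3 * (2 * V (\<phi> r)))" using far_right[OF True] by (simp add: ac_simps)
      also have "\<dots> < \<kappa> * (sqrt 3 * (2 * V (\<phi> r)))"
        using \<kappa>(1) pos unfolding V by (rule mult_strict_right_mono)
      finally show ?thesis unfolding V .
    next
      case False
      then have "W (\<phi> r) < 0" using far_left[of "\<phi> r"] out by auto
      also have "0 < \<kappa> * (sqrt 3 * ((1 - \<kappa>\<^sup>2) * (h r)\<^sup>2))" by (rule mult_pos_pos[OF \<kappa>(2) pos])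
      finally show ?thesis .
    qed
    then show "0 < sqrt 3 * h r * v r - W (\<phi> r) - \<kappa> * (sqrt 3 * (v r)\<^sup>2)" using eq by linarith
  qed (use v in simp)
  then show ?thesis by simp
qed

end

text \<open>The unstable branch \<open>x = u(\<phi>)\<close>. The potential and the force are separate arguments for the sake of
  the reflected potential.\<close>

definition slope :: "(real \<Rightarrow> real) \<Rightarrow> (real \<Rightarrow> real) \<Rightarrow> real \<Rightarrow> real" where
  "slope V W x = W x / (2 * sqrt 3 * V x)"

context confining_potential
begin

text \<open>An orbit that runs off to the right without ever becoming fast follows the unstable branch
  \<open>x = u(\<phi>)\<close>: once \<open>u'\<close> is small, a deviation \<open>y = x - u\<close> of size \<open>e\<close> would grow, with
  \<open>(y\<^sup>2)' \<ge> k (ln h)'\<close> for some \<open>k > 0\<close>, although \<open>y\<close> is bounded and \<open>h\<close> is not.\<close>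

lemma never_fast_orbit_follows_slope:
  assumes o: "orbit V W T \<phi> v h" and unb: "\<And>B. ev T (\<lambda>t. B < h t)" and \<kappa>: "0 < \<kappa>" "\<kappa> < 1"
    and not_fast: "ev T (\<lambda>t. \<bar>v t\<bar> < \<kappa> * h t)" and out: "ev T (\<lambda>t. R < \<phi> t)"
    and lim: "\<And>c. ev T (\<lambda>t. c < \<phi> t)" and e: "0 < e"
  shows "ev T (\<lambda>t. \<bar>v t / h t - slope V W (\<phi> t)\<bar> < e)"
proof -
  define U where "U x = (W' x * V x - (W x)\<^sup>2) / (V x)\<^sup>2 / (2 * sqrt 3)" for x
  have slope_deriv: "(slope V W has_real_derivative U x) (at x)" if "R \<le> x" for x
  proof -
    have "V x \<noteq> 0" using far_right[OF that] by auto
    then have "((\<lambda>x. W x / V x / (2 * sqrt 3)) has_real_derivative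
        (W' x * V x - W x * W x) / (V x * V x) / (2 * sqrt 3)) (at x)"
      by (intro DERIV_cdivide DERIV_divide W_deriv V_deriv)
    moreover have "slope V W = (\<lambda>x. W x / V x / (2 * sqrt 3))" by (simp add: slope_def fun_eq_iff ac_simps)
    ultimately show ?thesis by (simp add: U_def power2_eq_square)
  qed
  define c1 where "c1 = sqrt 3 * (1 - \<kappa>\<^sup>2)"
  have c1: "0 < c1" using \<kappa> by (simp add: c1_def power_less_one_iff)
  have "(U \<longlongrightarrow> 0 / (2 * sqrt 3)) at_top"
    unfolding U_def by (intro tendsto_divide slope_right tendsto_const) simp
  then have "\<forall>\<^sub>F x in at_top. dist (U x) 0 < c1 * e / 2"
    using c1 e by (intro tendstoD) auto
  then obtain c where c: "\<And>x. c \<le> x \<Longrightarrow> \<bar>U x\<bar> < c1 * e / 2"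
    unfolding eventually_at_top_linorder by auto
  have "ev T (\<lambda>t. \<bar>v t\<bar> < \<kappa> * h t \<and> R < \<phi> t \<and> c < \<phi> t)"
    by (intro ev_conj not_fast out lim)
  then obtain s where s: "s \<in> life T"
    and late: "\<And>t. t \<in> life T \<Longrightarrow> s \<le> t \<Longrightarrow> \<bar>v t\<bar> < \<kappa> * h t \<and> R < \<phi> t \<and> c < \<phi> t"
    unfolding ev_def by metis
  define x where "x t = v t / h t" for t
  define y where "y t = x t - slope V W (\<phi> t)" for t
  define D where "D t = h t * (sqrt 3 * (1 - (x t)\<^sup>2) * y t - U (\<phi> t) * x t)" for t
  have x: "\<bar>x t\<bar> < \<kappa>" and u: "0 \<le> slope V W (\<phi> t)" "slope V W (\<phi> t) \<le> 1"
    and deriv: "(y has_real_derivative D t) (at t within life T)"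
    and push: "e \<le> \<bar>y t\<bar> \<Longrightarrow> h t * (c1 * e\<^sup>2) \<le> 2 * y t * D t"
    if t: "t \<in> life T" "s \<le> t" for t
  proof -
    have h: "0 < h t" by (rule orbitD(5)[OF o t(1)])
    note L = late[OF t]
    show x: "\<bar>x t\<bar> < \<kappa>" using L h by (simp add: x_def abs_divide field_simps)
    have far: "0 < V (\<phi> t)" "0 < W (\<phi> t)" "W (\<phi> t) \<le> \<rho> * (2 * sqrt 3 * V (\<phi> t))"
      using far_right[of "\<phi> t"] L by auto
    show "0 \<le> slope V W (\<phi> t)" using far by (simp add: slope_def)
    have "\<rho> * (2 * sqrt 3 * V (\<phi> t)) \<le> 1 * (2 * sqrt 3 * V (\<phi> t))"
      using far(1) \<rho>_less by (intro mult_right_mono) auto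
    then have "W (\<phi> t) \<le> 1 * (2 * sqrt 3 * V (\<phi> t))" by (rule order_trans[OF far(3)])
    then show "slope V W (\<phi> t) \<le> 1" using far(1) by (simp add: slope_def)
    have v: "v t = x t * h t" using h by (simp add: x_def)
    have V: "2 * V (\<phi> t) = (h t)\<^sup>2 - (v t)\<^sup>2" using orbitD(4)[OF o t(1)] by simp
    have "W (\<phi> t) = sqrt 3 * (2 * V (\<phi> t)) * slope V W (\<phi> t)"
      using far(1) by (simp add: slope_def)
    then have W: "W (\<phi> t) = sqrt 3 * ((h t)\<^sup>2 * (1 - (x t)\<^sup>2)) * slope V W (\<phi> t)"
      unfolding V v by (simp add: power_mult_distrib algebra_simps)
    have d1: "(x has_real_derivative ((sqrt 3 * h t * v t - W (\<phi> t)) * h t - v t * (sqrt 3 * (v t)\<^sup>2)) / (h t * h t))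
        (at t within life T)"
      unfolding x_def using h by (intro DERIV_divide orbitD(2,3)[OF o t(1)]) simp
    have d2: "((\<lambda>t. slope V W (\<phi> t)) has_real_derivative U (\<phi> t) * v t) (at t within life T)"
      by (rule DERIV_chain2[OF slope_deriv orbitD(1)[OF o t(1)]]) (use L in simp)
    have "((sqrt 3 * h t * v t - W (\<phi> t)) * h t - v t * (sqrt 3 * (v t)\<^sup>2)) / (h t * h t) - U (\<phi> t) * v t = D t"
      unfolding W v D_def y_def using h by (simp add: field_simps power2_eq_square)
    then show "(y has_real_derivative D t) (at t within life T)"
      using DERIV_diff[OF d1 d2] unfolding y_def by simp
    assume big: "e \<le> \<bar>y t\<bar>"
    have "(x t)\<^sup>2 \<le> \<kappa>\<^sup>2" using x \<kappa> by (intro abs_le_square_iff[THEN iffD1]) simp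
    then have "c1 \<le> sqrt 3 * (1 - (x t)\<^sup>2)" unfolding c1_def by (intro mult_left_mono) auto
    then have 1: "c1 * (y t)\<^sup>2 \<le> sqrt 3 * (1 - (x t)\<^sup>2) * (y t)\<^sup>2" by (rule mult_right_mono) simp
    have "\<bar>U (\<phi> t)\<bar> * \<bar>x t\<bar> \<le> (c1 * e / 2) * 1"
      using c[of "\<phi> t"] L x \<kappa> c1 e by (intro mult_mono) auto
    then have "\<bar>U (\<phi> t)\<bar> * \<bar>x t\<bar> * \<bar>y t\<bar> \<le> (c1 * e / 2) * \<bar>y t\<bar>" by (intro mult_right_mono) auto
    also have "\<dots> = c1 / 2 * (e * \<bar>y t\<bar>)" by simp
    also have "\<dots> \<le> c1 / 2 * (\<bar>y t\<bar> * \<bar>y t\<bar>)" using big c1 by (intro mult_left_mono mult_right_mono) auto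
    finally have "\<bar>U (\<phi> t) * x t * y t\<bar> \<le> c1 / 2 * (y t)\<^sup>2" by (simp add: abs_mult power2_eq_square)
    then have 2: "U (\<phi> t) * x t * y t \<le> c1 / 2 * (y t)\<^sup>2" by (rule order_trans[OF abs_ge_self])
    have "c1 / 2 * e\<^sup>2 \<le> c1 / 2 * (y t)\<^sup>2"
      using big e c1 by (intro mult_left_mono) (auto simp flip: abs_le_square_iff)
    also have "\<dots> = c1 * (y t)\<^sup>2 - c1 / 2 * (y t)\<^sup>2" by simp
    also have "\<dots> \<le> sqrt 3 * (1 - (x t)\<^sup>2) * (y t)\<^sup>2 - U (\<phi> t) * x t * y t" by (rule diff_mono[OF 1 2])
    finally have "2 * h t * (c1 / 2 * e\<^sup>2) \<le> 2 * h t * (sqrt 3 * (1 - (x t)\<^sup>2) * (y t)\<^sup>2 - U (\<phi> t) * x t * y t)"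
      using h by (intro mult_left_mono) auto
    also have "\<dots> = 2 * y t * D t" unfolding D_def by (simp add: power2_eq_square algebra_simps)
    finally show "h t * (c1 * e\<^sup>2) \<le> 2 * y t * D t" by (simp add: ac_simps)
  qed
  have deriv2: "((\<lambda>t. (y t)\<^sup>2) has_real_derivative 2 * y t * D t) (at t within life T)"
    if "t \<in> life T" "s \<le> t" for t
    by (rule derivative_eq_intros deriv[OF that] refl | simp)+
  have "\<bar>y t1\<bar> < e" if t1: "t1 \<in> life T" "s \<le> t1" for t1
  proof (rule ccontr)
    assume start: "\<not> \<bar>y t1\<bar> < e"
    have t10: "0 \<le> t1" by (rule life_nonneg[OF t1(1)])
    have mem: "r \<in> life T \<and> s \<le> r" if "t1 \<le> r" "r \<le> t" "t \<in> life T" for r t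
      using life_downward_closed[of r t T] that t10 t1 by simp
    have stay: "e \<le> \<bar>y t\<bar>" if t: "t1 \<le> t" "t \<in> life T" for t
    proof -
      have "e\<^sup>2 \<le> (y t)\<^sup>2"
      proof (rule barrier[OF t(1) life_Icc[OF t10 t(2)]])
        show "((\<lambda>t. (y t)\<^sup>2) has_real_derivative 2 * y r * D r) (at r within life T)"
          if "t1 \<le> r" "r \<le> t" for r
          using mem[OF that t(2)] by (intro deriv2) auto
        have "\<bar>e\<bar> \<le> \<bar>y t1\<bar>" using start e by simp
        then show "e\<^sup>2 \<le> (y t1)\<^sup>2" by (simp only: abs_le_square_iff)
        fix r assume r: "t1 \<le> r" "r \<le> t" "(y r)\<^sup>2 = e\<^sup>2"
        then have "e \<le> \<bar>y r\<bar>" using e by (auto simp: power2_eq_iff)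
        then have "h r * (c1 * e\<^sup>2) \<le> 2 * y r * D r" using mem[OF r(1,2) t(2)] by (intro push) auto
        moreover have "0 < h r * (c1 * e\<^sup>2)"
          using orbitD(5)[OF o] mem[OF r(1,2) t(2)] c1 e by simp
        ultimately show "0 < 2 * y r * D r" by linarith
      qed
      then have "\<bar>e\<bar> \<le> \<bar>y t\<bar>" by (simp only: abs_le_square_iff)
      then show ?thesis using e by simp
    qed
    \<comment> \<open>\<open>y\<^sup>2 - k ln h\<close> increases, so \<open>y\<^sup>2\<close> exceeds its upper bound \<open>4\<close> when \<open>h\<close> has grown by the
      factor \<open>exp (4 / k)\<close>.\<close>
    define k where "k = c1 * e\<^sup>2 / sqrt 3"
    have k: "0 < k" using c1 e by (simp add: k_def)
    define B where "B = h t1 * exp (4 / k)"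
    have ht1: "0 < h t1" by (rule orbitD(5)[OF o t1(1)])
    obtain t where t: "t \<in> life T" "t1 \<le> t" "B < h t" by (rule ev_after[OF unb t1(1)])
    have "(y t1)\<^sup>2 - k * ln (h t1) \<le> (y t)\<^sup>2 - k * ln (h t)"
    proof (rule nondecreasing_of_deriv_nonneg[OF t(2) life_Icc[OF t10 t(1)],
          of "\<lambda>t. (y t)\<^sup>2 - k * ln (h t)" "\<lambda>t. 2 * y t * D t - k * (1 / h t * (sqrt 3 * (v t)\<^sup>2))"])
      fix r assume r: "t1 \<le> r" "r \<le> t"
      note m = mem[OF r t(1)]
      then have hr: "0 < h r" using orbitD(5)[OF o] by simp
      show "((\<lambda>t. (y t)\<^sup>2 - k * ln (h t)) has_real_derivative
          2 * y r * D r - k * (1 / h r * (sqrt 3 * (v r)\<^sup>2))) (at r within life T)"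
        using m by (intro DERIV_diff deriv2 DERIV_cmult DERIV_chain2[OF DERIV_ln_divide[OF hr] orbitD(3)[OF o]]) auto
      have "\<kappa> * h r \<le> 1 * h r" using \<kappa> hr by (intro mult_right_mono) auto
      moreover have "\<bar>v r\<bar> < \<kappa> * h r" using late[of r] m by simp
      ultimately have "\<bar>v r\<bar> \<le> \<bar>h r\<bar>" by linarith
      then have "(v r)\<^sup>2 \<le> (h r)\<^sup>2" by (simp only: abs_le_square_iff)
      then have "1 / h r * (sqrt 3 * (v r)\<^sup>2) \<le> 1 / h r * (sqrt 3 * (h r)\<^sup>2)"
        using hr by (intro mult_left_mono) auto
      also have "\<dots> = sqrt 3 * h r" using hr by (simp add: power2_eq_square)
      finally have "k * (1 / h r * (sqrt 3 * (v r)\<^sup>2)) \<le> k * (sqrt 3 * h r)"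
        using k by (intro mult_left_mono) auto
      also have "\<dots> = h r * (c1 * e\<^sup>2)" by (simp add: k_def)
      also have "\<dots> \<le> 2 * y r * D r"
        using m stay[OF r(1)] by (intro push) auto
      finally show "0 \<le> 2 * y r * D r - k * (1 / h r * (sqrt 3 * (v r)\<^sup>2))" by simp
    qed
    moreover have "ln B < ln (h t)" using t(3) ht1 orbitD(5)[OF o t(1)] by (subst ln_less_cancel_iff) (auto simp: B_def)
    then have "k * (ln (h t1) + 4 / k) < k * ln (h t)"
      using k ht1 by (intro mult_strict_left_mono) (auto simp: B_def ln_mult)
    then have "k * ln (h t1) + 4 < k * ln (h t)" using k by (simp add: distrib_left)
    moreover have "0 \<le> (y t1)\<^sup>2" by simp
    ultimately have "4 < (y t)\<^sup>2" by linarith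
    moreover have "\<bar>y t\<bar> \<le> \<bar>2\<bar>" using x[of t] u[of t] t(1,2) t1(2) \<kappa> by (simp add: y_def abs_le_iff abs_less_iff)
    then have "(y t)\<^sup>2 \<le> 2\<^sup>2" by (simp only: abs_le_square_iff)
    ultimately show False by simp
  qed
  then show ?thesis unfolding y_def x_def by (rule evI[OF s])
qed

text \<open>As \<open>2 V = h\<^sup>2 - v\<^sup>2 \<ge> (1 - \<kappa>\<^sup>2) h\<^sup>2\<close> diverges, \<open>\<phi>\<close> leaves every bounded set.\<close>

lemma never_fast_orbit_climbs:
  assumes o: "orbit V W T \<phi> v h" and unb: "\<And>B. ev T (\<lambda>t. B < h t)" and \<kappa>: "0 < \<kappa>" "\<kappa> < 1"
    and not_fast: "ev T (\<lambda>t. \<bar>v t\<bar> < \<kappa> * h t)" and out: "ev T (\<lambda>t. R < \<phi> t)"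
  shows "climbs W (slope V W) \<infinity> T \<phi> v h"
proof -
  have lim: "ev T (\<lambda>t. c < \<phi> t)" for c
  proof -
    obtain M where M: "\<forall>x\<in>{R..c}. \<bar>V x\<bar> \<le> M" using V_bounded by blast
    define B where "B = 1 + 2 * \<bar>M\<bar> / (1 - \<kappa>\<^sup>2)"
    have \<kappa>2: "0 < 1 - \<kappa>\<^sup>2" using \<kappa> by (simp add: power_less_one_iff)
    have B1: "1 \<le> B" using \<kappa>2 by (simp add: B_def)
    have "ev T (\<lambda>t. B < h t \<and> \<bar>v t\<bar> < \<kappa> * h t \<and> R < \<phi> t)" by (intro ev_conj unb not_fast out)
    then show ?thesis
    proof (rule ev_mono)
      fix t assume t: "t \<in> life T" and *: "B < h t \<and> \<bar>v t\<bar> < \<kappa> * h t \<and> R < \<phi> t"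
      show "c < \<phi> t"
      proof (rule ccontr)
        assume "\<not> c < \<phi> t"
        then have VM: "V (\<phi> t) \<le> \<bar>M\<bar>" using M[rule_format, of "\<phi> t"] * by auto
        have "\<bar>v t\<bar> \<le> \<bar>\<kappa> * h t\<bar>" using * abs_ge_self[of "\<kappa> * h t"] by linarith
        then have "(v t)\<^sup>2 \<le> (\<kappa> * h t)\<^sup>2" by (simp only: abs_le_square_iff)
        then have "(1 - \<kappa>\<^sup>2) * (h t)\<^sup>2 \<le> 2 * V (\<phi> t)"
          using orbitD(4)[OF o t] by (simp add: power_mult_distrib algebra_simps)
        then have 1: "(1 - \<kappa>\<^sup>2) * (h t)\<^sup>2 \<le> 2 * \<bar>M\<bar>" using VM by linarith
        have "B * 1 \<le> h t * h t" using * B1 by (intro mult_mono) auto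
        then have "(1 - \<kappa>\<^sup>2) * B \<le> (1 - \<kappa>\<^sup>2) * (h t)\<^sup>2"
          using \<kappa>2 by (intro mult_left_mono) (auto simp: power2_eq_square)
        moreover have "(1 - \<kappa>\<^sup>2) * B = (1 - \<kappa>\<^sup>2) + 2 * \<bar>M\<bar>"
          using \<kappa>2 by (simp add: B_def distrib_left)
        ultimately show False using 1 \<kappa>2 by linarith
      qed
    qed
  qed
  have W: "ev T (\<lambda>t. 0 < W (\<phi> t) \<and> ereal (\<phi> t) < \<infinity>)"
    by (rule ev_mono[OF out]) (use far_right in auto)
  have "ev T (\<lambda>t. 0 < v t \<and> 0 < W (\<phi> t) \<and> v t \<le> \<kappa> * h t \<and> ereal (\<phi> t) < \<infinity>)"
    by (rule ev_mono[OF ev_conj[OF velocity_eventually_positive[OF o W lim] ev_conj[OF W not_fast]]]) auto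
  then show ?thesis
    unfolding climbs_def
    using lim \<kappa>(2) never_fast_orbit_follows_slope[OF o unb \<kappa> not_fast out lim]
    by (intro conjI exI[of _ \<kappa>]) auto
qed

text \<open>At high energy an orbit with \<open>\<bar>x\<bar> < \<kappa>\<close> must satisfy \<open>\<bar>\<phi>\<bar> > R\<close>, because \<open>V\<close> is bounded on \<open>[-R, R]\<close>.
  So it either enters a trap or stays on one side for ever.\<close>

lemma unbounded_orbit_exceptional_or_fast:
  assumes o: "orbit V W T \<phi> v h" and unb: "\<And>B. ev T (\<lambda>t. B < h t)" and \<kappa>: "\<rho> < \<kappa>" "0 < \<kappa>" "\<kappa> < 1"
  shows "ev T (\<lambda>t. \<kappa> * h t \<le> \<bar>v t\<bar>) \<or> climbs W (slope V W) \<infinity> T \<phi> v h \<or>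
    climbs (\<lambda>x. - W (- x)) (slope (\<lambda>x. V (- x)) (\<lambda>x. - W (- x))) \<infinity> T (\<lambda>t. - \<phi> t) (\<lambda>t. - v t) h"
proof -
  interpret M: confining_potential "\<lambda>x. V (- x)" "\<lambda>x. - W (- x)" "\<lambda>x. W' (- x)" R \<rho> K
    by (rule reflection)
  have \<kappa>2: "0 < 1 - \<kappa>\<^sup>2" using \<kappa> by (simp add: power_less_one_iff)
  obtain B where B: "\<forall>x\<in>{-R..R}. \<bar>V x\<bar> \<le> B" using V_bounded by blast
  obtain s where s: "s \<in> life T" and hs: "\<And>t. t \<in> life T \<Longrightarrow> s \<le> t \<Longrightarrow> 1 + 2 * \<bar>B\<bar> / (1 - \<kappa>\<^sup>2) < h t"
    using unb[of "1 + 2 * \<bar>B\<bar> / (1 - \<kappa>\<^sup>2)"] unfolding ev_def by metis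
  have s0: "0 \<le> s" by (rule life_nonneg[OF s])
  have inner: "2 * V (\<phi> t) < (1 - \<kappa>\<^sup>2) * (h t)\<^sup>2" if t: "t \<in> life T" "s \<le> t" "\<bar>\<phi> t\<bar> \<le> R" for t
  proof -
    define b where "b = 1 + 2 * \<bar>B\<bar> / (1 - \<kappa>\<^sup>2)"
    have "1 \<le> b" using \<kappa>2 by (simp add: b_def)
    then have "b * 1 \<le> h t * h t" using hs[OF t(1,2)] unfolding b_def[symmetric] by (intro mult_mono) auto
    then have "(1 - \<kappa>\<^sup>2) * b \<le> (1 - \<kappa>\<^sup>2) * (h t)\<^sup>2"
      using \<kappa>2 by (intro mult_left_mono) (auto simp: power2_eq_square)
    moreover have "(1 - \<kappa>\<^sup>2) * b = (1 - \<kappa>\<^sup>2) + 2 * \<bar>B\<bar>" using \<kappa>2 by (simp add: b_def distrib_left)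
    moreover have "V (\<phi> t) \<le> \<bar>B\<bar>" using B[rule_format, of "\<phi> t"] t(3) by (auto simp: abs_le_iff)
    ultimately show ?thesis using \<kappa>2 by linarith
  qed
  have mem: "r \<in> life T \<and> s \<le> r" if "t \<le> r" "r \<le> t'" "t' \<in> life T" "s \<le> t" for r t t'
    using life_downward_closed[of r t' T] that s0 by simp
  show ?thesis
  proof (cases "\<exists>t\<in>life T. s \<le> t \<and> \<kappa> * h t \<le> \<bar>v t\<bar>")
    case True
    then obtain t where t: "t \<in> life T" "s \<le> t" "\<kappa> * h t \<le> \<bar>v t\<bar>" by blast
    have t0: "0 \<le> t" by (rule life_nonneg[OF t(1)])
    have "\<kappa> * h t' \<le> \<bar>v t'\<bar>" if t': "t' \<in> life T" "t \<le> t'" for t'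
    proof (cases "0 \<le> v t")
      case True
      have "\<kappa> * h t' \<le> v t'"
        by (rule fast_motion_persists[OF o \<kappa> t0 t'(2,1)]) (use mem[OF _ _ t'(1) t(2)] inner True t(3) in auto)
      then show ?thesis by simp
    next
      case False
      have "\<kappa> * h t' \<le> - v t'"
        by (rule M.fast_motion_persists[OF orbit_reflect[OF o] \<kappa> t0 t'(2,1)])
           (use mem[OF _ _ t'(1) t(2)] inner False t(3) in auto)
      then show ?thesis by simp
    qed
    then show ?thesis using t(1) by (intro disjI1 evI)
  next
    case False
    have slow: "\<bar>v t\<bar> < \<kappa> * h t" if "t \<in> life T" "s \<le> t" for t using False that by (meson not_le)
    have out: "R < \<bar>\<phi> t\<bar>" if t: "t \<in> life T" "s \<le> t" for t
    proof (rule ccontr)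
      assume "\<not> R < \<bar>\<phi> t\<bar>"
      then have "2 * V (\<phi> t) < (1 - \<kappa>\<^sup>2) * (h t)\<^sup>2" using inner t by simp
      moreover have "\<bar>v t\<bar> \<le> \<bar>\<kappa> * h t\<bar>" using slow[OF t] abs_ge_self[of "\<kappa> * h t"] by linarith
      then have "(v t)\<^sup>2 \<le> (\<kappa> * h t)\<^sup>2" by (simp only: abs_le_square_iff)
      ultimately show False using orbitD(4)[OF o t(1)] by (simp add: power_mult_distrib algebra_simps)
    qed
    have cont: "continuous_on {s..t} \<phi>" if "t \<in> life T" for t
      by (rule continuous_on_subset[OF orbit_continuous(1)[OF o] life_Icc[OF s0 that]])
    show ?thesis
    proof (cases "0 < \<phi> s")
      case True
      have "R < \<phi> t" if t: "t \<in> life T" "s \<le> t" for t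
      proof (rule ccontr)
        assume "\<not> R < \<phi> t"
        then have "\<phi> t \<le> 0" using out[OF t] by (auto simp: abs_if split: if_splits)
        then obtain r where "s \<le> r" "r \<le> t" "\<phi> r = 0" using IVT2'[of \<phi> t 0 s] True t(2) cont[OF t(1)] by auto
        then show False using out[of r] mem[of s r t] t(1) R_pos by auto
      qed
      then have "climbs W (slope V W) \<infinity> T \<phi> v h"
        by (intro never_fast_orbit_climbs[OF o unb \<kappa>(2,3)] evI[OF s] slow)
      then show ?thesis by blast
    next
      case F: False
      have "R < - \<phi> t" if t: "t \<in> life T" "s \<le> t" for t
      proof (rule ccontr)
        assume "\<not> R < - \<phi> t"
        then have "0 \<le> \<phi> t" using out[OF t] by (auto simp: abs_if split: if_splits)
        then obtain r where "s \<le> r" "r \<le> t" "\<phi> r = 0" using IVT'[of \<phi> s 0 t] F t(2) cont[OF t(1)] by auto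
        then show False using out[of r] mem[of s r t] t(1) R_pos by auto
      qed
      then have "climbs (\<lambda>x. - W (- x)) (slope (\<lambda>x. V (- x)) (\<lambda>x. - W (- x))) \<infinity> T (\<lambda>t. - \<phi> t) (\<lambda>t. - v t) h"
        using slow by (intro M.never_fast_orbit_climbs[OF orbit_reflect[OF o] unb \<kappa>(2,3)] evI[OF s]) auto
      then show ?thesis by blast
    qed
  qed
qed

end

section \<open>Fast orbits collapse to a black hole\<close>

text \<open>Here \<open>(1 / h)' = - sqrt 3 v\<^sup>2 / h\<^sup>2 \<le> - \<kappa>\<^sup>2\<close>, so that \<open>1 / h\<close> would reach \<open>0\<close>.\<close>

lemma fast_orbit_finite_lifetime:
  assumes o: "orbit V W T \<phi> v h" and \<kappa>: "0 < \<kappa>" and fast: "ev T (\<lambda>t. \<kappa> * h t \<le> \<bar>v t\<bar>)"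
  shows "T \<noteq> \<infinity>"
proof
  assume T: "T = \<infinity>"
  obtain s where s: "0 \<le> s" and f: "\<And>t. s \<le> t \<Longrightarrow> \<kappa> * h t \<le> \<bar>v t\<bar>"
    using fast unfolding T ev_infinity by metis
  have m: "t \<in> life T" if "s \<le> t" for t using that s unfolding T life_infinity by simp
  have pos: "0 < h t" if "s \<le> t" for t using orbitD(5)[OF o m[OF that]] .
  define t where "t = s + 1 / (h s * \<kappa>\<^sup>2)"
  have t: "s \<le> t" using pos[of s] \<kappa> by (simp add: t_def)
  have "inverse (h t) - inverse (h s) \<le> - \<kappa>\<^sup>2 * (t - s)"
  proof (rule increment_le[OF t life_Icc[OF s m[OF t]], of _ "\<lambda>r. - (sqrt 3 * (v r)\<^sup>2 * inverse ((h r)\<^sup>2))"])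
    fix r assume r: "s \<le> r"
    show "((\<lambda>r. inverse (h r)) has_real_derivative - (sqrt 3 * (v r)\<^sup>2 * inverse ((h r)\<^sup>2))) (at r within life T)"
      using DERIV_inverse_fun[OF orbitD(3)[OF o m[OF r]]] pos[OF r] by (simp add: power2_eq_square numeral_2_eq_2)
    have "(\<kappa> * h r)\<^sup>2 \<le> \<bar>v r\<bar>\<^sup>2" using f[OF r] pos[OF r] \<kappa> by (intro power_mono) auto
    then have "\<kappa>\<^sup>2 * (h r)\<^sup>2 \<le> (v r)\<^sup>2" by (simp add: power_mult_distrib)
    then have "1 * (\<kappa>\<^sup>2 * (h r)\<^sup>2) \<le> sqrt 3 * (v r)\<^sup>2" using sqrt3_bounds by (intro mult_mono) auto
    then have "1 * (\<kappa>\<^sup>2 * (h r)\<^sup>2) * inverse ((h r)\<^sup>2) \<le> sqrt 3 * (v r)\<^sup>2 * inverse ((h r)\<^sup>2)"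
      by (rule mult_right_mono) simp
    moreover have "1 * (\<kappa>\<^sup>2 * (h r)\<^sup>2) * inverse ((h r)\<^sup>2) = \<kappa>\<^sup>2" using pos[OF r] by simp
    ultimately show "- (sqrt 3 * (v r)\<^sup>2 * inverse ((h r)\<^sup>2)) \<le> - \<kappa>\<^sup>2" by (simp only: neg_le_iff_le)
  qed
  moreover have "- \<kappa>\<^sup>2 * (t - s) = - inverse (h s)" using pos[of s] \<kappa> by (simp add: t_def inverse_eq_divide)
  ultimately have "inverse (h t) \<le> 0" by simp
  then show False using pos[OF t] by simp
qed

text \<open>The scale factor obeys \<open>a' = - a h / sqrt 3\<close>. Since \<open>h' = sqrt 3 v\<^sup>2\<close>, the quantity \<open>a\<^sup>6 h\<close>
  decreases when \<open>v\<^sup>2 \<le> 2 h\<^sup>2\<close>, and \<open>a\<^sup>3 h\<^sup>2\<close> increases when \<open>h\<^sup>2 \<le> 2 v\<^sup>2\<close>. As \<open>h\<close> diverges, the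
  first fact yields \<open>a \<rightarrow> 0\<close> and the second one \<open>a h \<rightarrow> \<infinity>\<close>.\<close>

lemma scale_factor_vanishes:
  assumes o: "orbit V W T \<phi> v h" and unb: "\<And>B. ev T (\<lambda>t. B < h t)" and V: "\<And>x. - K \<le> V x"
    and a: "\<And>t. t \<in> life T \<Longrightarrow> (a has_real_derivative - (a t * h t / sqrt 3)) (at t within life T)"
      "\<And>t. t \<in> life T \<Longrightarrow> 0 < a t" and e: "0 < e"
  shows "ev T (\<lambda>t. a t < e)"
proof -
  obtain s where s: "s \<in> life T" and hs: "\<And>t. t \<in> life T \<Longrightarrow> s \<le> t \<Longrightarrow> 1 + 2 * \<bar>K\<bar> < h t"
    using unb unfolding ev_def by metis
  have s0: "0 \<le> s" by (rule life_nonneg[OF s])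
  have decr: "(a t) ^ 6 * h t \<le> (a s) ^ 6 * h s" if t: "t \<in> life T" "s \<le> t" for t
  proof -
    have "- ((a s) ^ 6 * h s) \<le> - ((a t) ^ 6 * h t)"
    proof (rule nondecreasing_of_deriv_nonneg[OF t(2) life_Icc[OF s0 t(1)], of _ "\<lambda>r. (a r) ^ 6 * (sqrt 3 * (2 * (h r)\<^sup>2 - (v r)\<^sup>2))"])
      fix r assume "s \<le> r" "r \<le> t"
      then have r: "r \<in> life T" "s \<le> r" using life_downward_closed[of r t T] s0 t(1) by auto
      have "6 * (a r) ^ 5 * - (a r * h r / sqrt 3) * h r + sqrt 3 * (v r)\<^sup>2 * (a r) ^ 6 =
          - ((a r) ^ 6 * (6 / sqrt 3 * (h r)\<^sup>2 - sqrt 3 * (v r)\<^sup>2))"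
        by (simp add: algebra_simps power2_eq_square power_numeral_reduce)
      also have "6 / sqrt 3 = 2 * sqrt (3::real)" by (simp add: field_simps)
      finally have eq: "6 * (a r) ^ 5 * - (a r * h r / sqrt 3) * h r + sqrt 3 * (v r)\<^sup>2 * (a r) ^ 6 =
          - ((a r) ^ 6 * (sqrt 3 * (2 * (h r)\<^sup>2 - (v r)\<^sup>2)))" by (simp add: algebra_simps)
      have "((\<lambda>r. (a r) ^ 6 * h r) has_real_derivative
          6 * (a r) ^ 5 * - (a r * h r / sqrt 3) * h r + sqrt 3 * (v r)\<^sup>2 * (a r) ^ 6) (at r within life T)"
        by (rule derivative_eq_intros a(1)[OF r(1)] orbitD(3)[OF o r(1)] refl | simp)+
      then show "((\<lambda>r. - ((a r) ^ 6 * h r)) has_real_derivative (a r) ^ 6 * (sqrt 3 * (2 * (h r)\<^sup>2 - (v r)\<^sup>2))) (at r within life T)"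
        unfolding eq by (rule DERIV_minus[THEN DERIV_cong]) simp
      have "(1 + 2 * \<bar>K\<bar>) * 1 \<le> h r * h r" using hs[OF r] by (intro mult_mono) auto
      then have "2 * K \<le> (h r)\<^sup>2" by (simp add: power2_eq_square)
      then have "(v r)\<^sup>2 \<le> 2 * (h r)\<^sup>2" using orbitD(4)[OF o r(1)] V[of "\<phi> r"] by linarith
      then show "0 \<le> (a r) ^ 6 * (sqrt 3 * (2 * (h r)\<^sup>2 - (v r)\<^sup>2))" by simp
    qed
    then show ?thesis by simp
  qed
  define C where "C = (a s) ^ 6 * h s"
  have "ev T (\<lambda>t. C / e ^ 6 < h t \<and> s \<le> t)" using s by (intro ev_conj unb evI[of s])
  then show ?thesis
  proof (rule ev_mono)
    fix t assume t: "t \<in> life T" "C / e ^ 6 < h t \<and> s \<le> t"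
    show "a t < e"
    proof (rule ccontr)
      assume "\<not> a t < e"
      then have "e ^ 6 \<le> (a t) ^ 6" using e by (intro power_mono) auto
      then have "e ^ 6 * h t \<le> (a t) ^ 6 * h t" using orbitD(5)[OF o t(1)] by (intro mult_right_mono) auto
      also have "\<dots> \<le> C" unfolding C_def using decr t by simp
      finally have "h t \<le> C / e ^ 6" using e by (simp add: field_simps)
      then show False using t(2) by simp
    qed
  qed
qed

lemma expansion_rate_diverges:
  assumes o: "orbit V W T \<phi> v h" and unb: "\<And>B. ev T (\<lambda>t. B < h t)" and fast: "ev T (\<lambda>t. (h t)\<^sup>2 \<le> 2 * (v t)\<^sup>2)"
    and a: "\<And>t. t \<in> life T \<Longrightarrow> (a has_real_derivative - (a t * h t / sqrt 3)) (at t within life T)"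
      "\<And>t. t \<in> life T \<Longrightarrow> 0 < a t"
  shows "ev T (\<lambda>t. B < a t * h t)"
proof -
  obtain s where s: "s \<in> life T" and f: "\<And>t. t \<in> life T \<Longrightarrow> s \<le> t \<Longrightarrow> (h t)\<^sup>2 \<le> 2 * (v t)\<^sup>2"
    using fast unfolding ev_def by metis
  have s0: "0 \<le> s" by (rule life_nonneg[OF s])
  have incr: "(a s) ^ 3 * (h s)\<^sup>2 \<le> (a t) ^ 3 * (h t)\<^sup>2" if t: "t \<in> life T" "s \<le> t" for t
  proof (rule nondecreasing_of_deriv_nonneg[OF t(2) life_Icc[OF s0 t(1)], of _ "\<lambda>r. (a r) ^ 3 * h r * (sqrt 3 * (2 * (v r)\<^sup>2 - (h r)\<^sup>2))"])
    fix r assume "s \<le> r" "r \<le> t"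
    then have r: "r \<in> life T" "s \<le> r" using life_downward_closed[of r t T] s0 t(1) by auto
    have "3 * (a r)\<^sup>2 * - (a r * h r / sqrt 3) * (h r)\<^sup>2 + 2 * h r * (sqrt 3 * (v r)\<^sup>2) * (a r) ^ 3 =
          (a r) ^ 3 * h r * (2 * sqrt 3 * (v r)\<^sup>2 - 3 / sqrt 3 * (h r)\<^sup>2)"
      by (simp add: algebra_simps power2_eq_square power3_eq_cube)
    also have "3 / sqrt 3 = sqrt (3::real)" by (simp add: field_simps)
    finally have eq: "3 * (a r)\<^sup>2 * - (a r * h r / sqrt 3) * (h r)\<^sup>2 + 2 * h r * (sqrt 3 * (v r)\<^sup>2) * (a r) ^ 3 =
          (a r) ^ 3 * h r * (sqrt 3 * (2 * (v r)\<^sup>2 - (h r)\<^sup>2))" by (simp add: algebra_simps)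
    have "((\<lambda>r. (a r) ^ 3 * (h r)\<^sup>2) has_real_derivative
        3 * (a r)\<^sup>2 * - (a r * h r / sqrt 3) * (h r)\<^sup>2 + 2 * h r * (sqrt 3 * (v r)\<^sup>2) * (a r) ^ 3) (at r within life T)"
      by (rule derivative_eq_intros a(1)[OF r(1)] orbitD(3)[OF o r(1)] refl | simp)+
    then show "((\<lambda>r. (a r) ^ 3 * (h r)\<^sup>2) has_real_derivative
        (a r) ^ 3 * h r * (sqrt 3 * (2 * (v r)\<^sup>2 - (h r)\<^sup>2))) (at r within life T)"
      unfolding eq .
    show "0 \<le> (a r) ^ 3 * h r * (sqrt 3 * (2 * (v r)\<^sup>2 - (h r)\<^sup>2))"
      using f[OF r] a(2)[OF r(1)] orbitD(5)[OF o r(1)] by simp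
  qed
  define C where "C = (a s) ^ 3 * (h s)\<^sup>2"
  have C: "0 < C" unfolding C_def using a(2)[OF s] orbitD(5)[OF o s] by simp
  have "ev T (\<lambda>t. \<bar>B\<bar> ^ 3 / C < h t \<and> s \<le> t)" using s by (intro ev_conj unb evI[of s])
  then show ?thesis
  proof (rule ev_mono)
    fix t assume t: "t \<in> life T" "\<bar>B\<bar> ^ 3 / C < h t \<and> s \<le> t"
    have pos: "0 < a t" "0 < h t" using a(2)[OF t(1)] orbitD(5)[OF o t(1)] by auto
    have "\<bar>B\<bar> ^ 3 < C * h t" using t(2) C by (simp add: field_simps)
    also have "\<dots> \<le> (a t) ^ 3 * (h t)\<^sup>2 * h t" unfolding C_def using incr[OF t(1)] t(2) pos by (intro mult_right_mono) auto
    also have "\<dots> = (a t * h t) ^ 3" by (simp add: power3_eq_cube power2_eq_square)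
    finally have "\<bar>B\<bar> < a t * h t" by (rule power_less_imp_less_base) (use pos in simp)
    then show "B < a t * h t" by simp
  qed
qed

section \<open>Local existence and continuation\<close>

text \<open>Picard's theorem: composing the vector field with the nearest-point projection onto the ball
  makes it globally Lipschitz and bounded, so that the Picard operator is a contraction of the whole
  space of bounded continuous curves, and its fixed point does not leave the ball.\<close>

lemma local_solution:
  fixes f :: "'a::euclidean_space \<Rightarrow> 'a"
  assumes lip: "L-lipschitz_on (cball p r) f" and r: "0 < r"
  obtains b x where "0 < b" "x 0 = p"
    "\<And>t. t \<in> {0..b} \<Longrightarrow> (x has_vector_derivative f (x t)) (at t within {0..b::real})"
proof -
  define c where "c = closest_point (cball p r)"
  define g where "g = f \<circ> c"
  have ne: "cball p r \<noteq> {}" using r by simp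
  have cball: "c y \<in> cball p r" for y unfolding c_def by (rule closest_point_in_set) (use ne in auto)
  have c_id: "c y = y" if "y \<in> cball p r" for y unfolding c_def using that by (rule closest_point_self)
  have L: "0 \<le> L" using lip by (rule lipschitz_on_nonneg)
  have glip: "dist (g x) (g y) \<le> L * dist x y" for x y
  proof -
    have "dist (g x) (g y) \<le> L * dist (c x) (c y)"
      unfolding g_def o_def by (rule lipschitz_onD[OF lip cball cball])
    also have "\<dots> \<le> L * dist x y"
      unfolding c_def by (intro mult_left_mono closest_point_lipschitz L) (use ne in auto)
    finally show ?thesis .
  qed
  have gcont: "continuous_on UNIV g"
    by (rule lipschitz_on_continuous_on[of L], rule lipschitz_onI) (use glip L in auto)
  define M where "M = norm (f p) + L * r + 1"
  have M: "norm (g y) \<le> M" for y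
  proof -
    have "dist (f (c y)) (f p) \<le> L * dist (c y) p"
      by (rule lipschitz_onD[OF lip cball]) (use r in simp)
    also have "\<dots> \<le> L * r" using cball[of y] L by (intro mult_left_mono) (auto simp: dist_commute)
    finally have "norm (f (c y) - f p) \<le> L * r" by (simp add: dist_norm)
    then show ?thesis using norm_triangle_ineq[of "f (c y) - f p" "f p"] by (simp add: M_def g_def)
  qed
  have M1: "1 \<le> M" using L r by (simp add: M_def)
  \<comment> \<open>Short enough for a contraction with factor \<open>1 / 2\<close>, and for curves of speed \<open>M\<close> to stay in the
    ball.\<close>
  define b where "b = min (1 / (2 * (L + 1))) (r / M)"
  have b: "0 < b" using L r M1 by (simp add: b_def)
  have "b \<le> r / M" by (simp add: b_def)
  then have bM: "M * b \<le> r" using M1 by (simp add: field_simps)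
  have "b \<le> 1 / (2 * (L + 1))" by (simp add: b_def)
  then have "(L + 1) * b \<le> (L + 1) * (1 / (2 * (L + 1)))" using L by (intro mult_left_mono) auto
  also have "\<dots> = 1 / 2" using L by simp
  finally have bL: "L * b \<le> 1 / 2" using b by (simp add: distrib_right)
  define cl where "cl t = max 0 (min t b)" for t :: real
  have cl: "cl t \<in> {0..b}" for t using b by (simp add: cl_def)
  have gx: "continuous_on A (\<lambda>s. g (apply_bcontfun x s))" for x :: "real \<Rightarrow>\<^sub>C 'a" and A
    by (rule continuous_on_compose2[OF gcont continuous_on_apply_bcontfun]) auto
  define P where "P x t = p + integral {0..cl t} (\<lambda>s. g (apply_bcontfun x s))" for x :: "real \<Rightarrow>\<^sub>C 'a" and t
  have intb: "norm (integral {0..t} (\<lambda>s. g (apply_bcontfun x s))) \<le> M * t" if "0 \<le> t" for x :: "real \<Rightarrow>\<^sub>C 'a" and t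
    using integral_bound[OF that gx[of _ x], of M] M by simp
  have Pb: "P x \<in> bcontfun" for x
  proof (rule bcontfun_normI)
    have "continuous_on {0..b} (\<lambda>t. integral {0..t} (\<lambda>s. g (apply_bcontfun x s)))"
      by (intro indefinite_integral_continuous_1 integrable_continuous_real gx)
    moreover have "continuous_on UNIV cl" unfolding cl_def by (intro continuous_intros)
    ultimately have "continuous_on UNIV (\<lambda>t. integral {0..cl t} (\<lambda>s. g (apply_bcontfun x s)))"
      by (rule continuous_on_compose2) (use cl in auto)
    then show "continuous_on UNIV (P x)" unfolding P_def by (intro continuous_intros)
    fix t
    have "norm (P x t) \<le> norm p + norm (integral {0..cl t} (\<lambda>s. g (apply_bcontfun x s)))"
      unfolding P_def by (rule norm_triangle_ineq)
    also have "\<dots> \<le> norm p + M * cl t" using cl[of t] by (intro add_left_mono intb) auto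
    also have "\<dots> \<le> norm p + M * b" using cl[of t] M1 by (intro add_left_mono mult_left_mono) auto
    finally show "norm (P x t) \<le> norm p + M * b" .
  qed
  define Q where "Q x = Bcontfun (P x)" for x
  have Q: "apply_bcontfun (Q x) = P x" for x unfolding Q_def by (rule Bcontfun_inverse[OF Pb])
  have contraction: "dist (Q x) (Q y) \<le> 1 / 2 * dist x y" for x y
  proof (rule dist_bound)
    fix t
    have "P x t - P y t = integral {0..cl t} (\<lambda>s. g (apply_bcontfun x s) - g (apply_bcontfun y s))"
      unfolding P_def by (simp add: integral_diff integrable_continuous_real gx)
    also have "norm \<dots> \<le> (L * dist x y) * (cl t - 0)"
    proof (rule integral_bound)
      show "continuous_on {0..cl t} (\<lambda>s. g (apply_bcontfun x s) - g (apply_bcontfun y s))"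
        by (intro continuous_on_diff gx)
      fix s
      have "dist (g (apply_bcontfun x s)) (g (apply_bcontfun y s)) \<le> L * dist (apply_bcontfun x s) (apply_bcontfun y s)"
        by (rule glip)
      also have "\<dots> \<le> L * dist x y" by (intro mult_left_mono dist_bounded L)
      finally show "norm (g (apply_bcontfun x s) - g (apply_bcontfun y s)) \<le> L * dist x y" by (simp add: dist_norm)
    qed (use cl in auto)
    also have "\<dots> \<le> (L * dist x y) * b" using cl[of t] L by (intro mult_left_mono) auto
    also have "\<dots> = (L * b) * dist x y" by simp
    also have "\<dots> \<le> 1 / 2 * dist x y" by (rule mult_right_mono[OF bL]) simp
    finally show "dist (apply_bcontfun (Q x) t) (apply_bcontfun (Q y) t) \<le> 1 / 2 * dist x y"
      unfolding Q dist_norm .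
  qed
  have "\<exists>!x. Q x = x" by (rule banach_fix_type[of "1/2"]) (use contraction in auto)
  then obtain x where "Q x = x" by blast
  then have x: "apply_bcontfun x t = P x t" for t using Q by metis
  define X where "X = apply_bcontfun x"
  have X: "X t = p + integral {0..t} (\<lambda>s. g (X s))" if "t \<in> {0..b}" for t
  proof -
    have "cl t = t" using that by (simp add: cl_def)
    then show ?thesis using x[of t] unfolding X_def P_def by simp
  qed
  have inside: "c (X t) = X t" if t: "t \<in> {0..b}" for t
  proof (rule c_id)
    have "norm (integral {0..t} (\<lambda>s. g (X s))) \<le> M * t" unfolding X_def by (rule intb) (use t in auto)
    also have "\<dots> \<le> M * b" using t M1 by (intro mult_left_mono) auto
    also have "\<dots> \<le> r" by (rule bM)
    finally show "X t \<in> cball p r" unfolding X[OF t] by (simp add: dist_norm)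
  qed
  show ?thesis
  proof (rule that[OF b])
    show "X 0 = p" using X[of 0] b by simp
    fix t assume t: "t \<in> {0..b}"
    have "((\<lambda>t. integral {0..t} (\<lambda>s. g (X s))) has_vector_derivative g (X t)) (at t within {0..b})"
      unfolding X_def by (rule integral_has_vector_derivative[OF gx t])
    then have "((\<lambda>t. p + integral {0..t} (\<lambda>s. g (X s))) has_vector_derivative g (X t)) (at t within {0..b})"
      by (rule has_vector_derivative_eq_rhs[OF has_vector_derivative_add[OF has_vector_derivative_const]]) simp
    then have "(X has_vector_derivative g (X t)) (at t within {0..b})"
      by (rule has_vector_derivative_transform[OF t, rotated]) (rule X)
    then show "(X has_vector_derivative f (X t)) (at t within {0..b})" by (simp add: g_def inside[OF t])
  qed
qed

text \<open>A solution with bounded velocity on \<open>[0, \<tau>)\<close> has a limit at \<open>\<tau>\<close> and continues from there. The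
  concatenation solves the integral equation, hence is differentiable also at \<open>\<tau>\<close>.\<close>

lemma solution_continues:
  fixes F :: "'a::euclidean_space \<Rightarrow> 'a"
  assumes \<tau>: "0 < \<tau>" and S: "\<And>t. t \<in> {0..<\<tau>} \<Longrightarrow> (S has_vector_derivative F (S t)) (at t within {0..<\<tau>})"
    and M: "\<And>t. t \<in> {0..<\<tau>} \<Longrightarrow> norm (F (S t)) \<le> M"
    and Fcont: "continuous_on UNIV F" and Flip: "\<And>p. \<exists>L. L-lipschitz_on (cball p 1) F"
  obtains \<tau>' S' where "\<tau> < \<tau>'" "\<And>t. t \<in> {0..<\<tau>} \<Longrightarrow> S' t = S t"
    "\<And>t. t \<in> {0..<\<tau>'} \<Longrightarrow> (S' has_vector_derivative F (S' t)) (at t within {0..<\<tau>'})"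
proof -
  have "0 \<le> M" using M[of 0] \<tau> order_trans[OF norm_ge_zero[of "F (S 0)"]] by simp
  then have "M-lipschitz_on {0..<\<tau>} S"
    by (intro bounded_derivative_imp_lipschitz[of _ _ "\<lambda>t y. y *\<^sub>R F (S t)"])
       (use S M in \<open>auto simp: has_vector_derivative_def onorm_scaleR_left onorm_id\<close>)
  then have "uniformly_continuous_on {0..<\<tau>} S" by (rule lipschitz_on_uniformly_continuous)
  then obtain G where G: "uniformly_continuous_on (closure {0..<\<tau>}) G" "\<And>t. t \<in> {0..<\<tau>} \<Longrightarrow> S t = G t"
    by (rule uniformly_continuous_on_extension_on_closure) blast
  have Gcont: "continuous_on {0..\<tau>} G" using uniformly_continuous_imp_continuous[OF G(1)] \<tau> by simp
  obtain L where L: "L-lipschitz_on (cball (G \<tau>) 1) F" using Flip by blast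
  obtain b Y where b: "0 < b" and Y0: "Y 0 = G \<tau>"
    and Y: "\<And>t. t \<in> {0..b} \<Longrightarrow> (Y has_vector_derivative F (Y t)) (at t within {0..b})"
    using local_solution[OF L] zero_less_one by blast
  have Ycont: "continuous_on {0..b} Y" 
    using has_vector_derivative_continuous[OF Y] by (simp add: continuous_on_eq_continuous_within)
  define Z where "Z t = (if t \<le> \<tau> then G t else Y (t - \<tau>))" for t
  have Zcont: "continuous_on {0..\<tau> + b} Z"
    unfolding Z_def
  proof (rule continuous_on_cases_le)
    show "continuous_on {t \<in> {0..\<tau> + b}. t \<le> \<tau>} G" by (rule continuous_on_subset[OF Gcont]) auto
    show "continuous_on {t \<in> {0..\<tau> + b}. \<tau> \<le> t} (\<lambda>t. Y (t - \<tau>))"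
      by (rule continuous_on_compose2[OF Ycont]) (auto intro!: continuous_intros)
  qed (use Y0 in \<open>auto intro!: continuous_intros\<close>)
  have Zder: "(Z has_vector_derivative F (Z t)) (at t)" if t: "0 < t" "t < \<tau> + b" "t \<noteq> \<tau>" for t
  proof (cases "t < \<tau>")
    case True
    have "at t within {0..<\<tau>} = at t" by (rule at_within_interior) (use t True in \<open>auto simp: interior_atLeastLessThan\<close>)
    then have "(S has_vector_derivative F (S t)) (at t)" using S[of t] t True by simp
    then have "(Z has_vector_derivative F (S t)) (at t)"
      by (rule has_vector_derivative_transform_within_open[of _ _ _ "{0<..<\<tau>}"]) (use t True G(2) in \<open>auto simp: Z_def\<close>)
    then show ?thesis using G(2)[of t] t True by (simp add: Z_def)
  next
    case False
    then have t': "0 < t - \<tau>" "t - \<tau> < b" using t by auto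
    have "at (t - \<tau>) within {0..b} = at (t - \<tau>)" by (rule at_within_interior) (use t' in auto)
    then have "(Y has_vector_derivative F (Y (t - \<tau>))) (at (t - \<tau>))" using Y[of "t - \<tau>"] t' by simp
    moreover have "((\<lambda>t. t - \<tau>) has_vector_derivative 1) (at t)"
      unfolding has_real_derivative_iff_has_vector_derivative[symmetric] by (auto intro!: derivative_eq_intros)
    ultimately have "((\<lambda>t. Y (t - \<tau>)) has_vector_derivative F (Y (t - \<tau>))) (at t)"
      using vector_diff_chain_at[of "\<lambda>t. t - \<tau>" 1 t Y] by (simp add: o_def)
    then have "(Z has_vector_derivative F (Y (t - \<tau>))) (at t)"
      by (rule has_vector_derivative_transform_within_open[of _ _ _ "{\<tau><..}"]) (use t' in \<open>auto simp: Z_def\<close>)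
    then show ?thesis using t' by (simp add: Z_def)
  qed
  have FZ: "continuous_on {0..\<tau> + b} (\<lambda>t. F (Z t))"
    by (rule continuous_on_compose2[OF Fcont Zcont]) auto
  have Zint: "Z t = Z 0 + integral {0..t} (\<lambda>t. F (Z t))" if t: "t \<in> {0..\<tau> + b}" for t
  proof -
    have "((\<lambda>t. F (Z t)) has_integral Z t - Z 0) {0..t}"
    proof (rule fundamental_theorem_of_calculus_interior_strong[of "{\<tau>}"])
      show "continuous_on {0..t} Z" by (rule continuous_on_subset[OF Zcont]) (use t in auto)
    qed (use t Zder in auto)
    then show ?thesis by (simp add: integral_unique)
  qed
  show ?thesis
  proof (rule that[of "\<tau> + b" Z])
    show "\<tau> < \<tau> + b" using b by simp
    show "Z t = S t" if "t \<in> {0..<\<tau>}" for t using that G(2) by (simp add: Z_def)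
    fix t assume "t \<in> {0..<\<tau> + b}"
    then have t: "t \<in> {0..\<tau> + b}" by simp
    have "((\<lambda>t. integral {0..t} (\<lambda>t. F (Z t))) has_vector_derivative F (Z t)) (at t within {0..\<tau> + b})"
      by (rule integral_has_vector_derivative[OF FZ t])
    then have "((\<lambda>t. Z 0 + integral {0..t} (\<lambda>t. F (Z t))) has_vector_derivative F (Z t)) (at t within {0..\<tau> + b})"
      by (rule has_vector_derivative_eq_rhs[OF has_vector_derivative_add[OF has_vector_derivative_const]]) simp
    then have "(Z has_vector_derivative F (Z t)) (at t within {0..\<tau> + b})"
      by (rule has_vector_derivative_transform[OF t, rotated]) (rule Zint)
    then show "(Z has_vector_derivative F (Z t)) (at t within {0..<\<tau> + b})"
      by (rule has_vector_derivative_within_subset) auto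
  qed
qed

section \<open>Solutions of the collapsing equations as orbits\<close>

lemma ddt_eqI:
  assumes "t \<in> life T" "(f has_real_derivative d) (at t within life T)"
  shows "ddt T f t = d"
proof -
  obtain t' where t': "t < t'" "t' \<in> life T" by (rule life_later[OF assms(1)])
  have "at t within {t..t'} \<noteq> bot"
    using t'(1) by (simp add: at_within_Icc_at_right trivial_limit_at_right_real)
  moreover have "at t within {t..t'} \<le> at t within life T"
    by (rule at_le[OF life_Icc[OF life_nonneg[OF assms(1)] t'(2)]])
  ultimately have "at t within life T \<noteq> bot" by (metis bot.extremum_unique)
  then show ?thesis
    unfolding ddt_def using assms(2) by (simp add: vector_derivative_within has_real_derivative_iff_has_vector_derivative)
qed

text \<open>The energy is nondecreasing, hence remains positive, and its square root remains differentiable.\<close>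

lemma collapsing_solution_orbit:
  assumes V: "\<And>x. (V has_real_derivative deriv V x) (at x)"
    and sol: "collapsing_solution V T a \<phi>" and pos: "energy V T \<phi> 0 > 0"
  defines "v \<equiv> ddt T \<phi>" and "h \<equiv> (\<lambda>t. sqrt (energy V T \<phi> t))"
  shows "orbit V (deriv V) T \<phi> v h"
    and "\<And>t. t \<in> life T \<Longrightarrow> (a has_real_derivative - (a t * h t / sqrt 3)) (at t within life T)"
proof -
  have T: "0 < T" and dif: "a differentiable_on life T" "\<phi> differentiable_on life T" "v differentiable_on life T"
    and eqs: "\<And>t. t \<in> life T \<Longrightarrow> a t > 0 \<and> energy V T \<phi> t \<ge> 0 \<and> ddt T a t / a t = - sqrt (energy V T \<phi> t / 3) \<and>
        ddt T v t + deriv V (\<phi> t) = sqrt 3 * sqrt (energy V T \<phi> t) * v t"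
    using sol unfolding collapsing_solution_def v_def by blast+
  have der: "(f has_real_derivative ddt T f t) (at t within life T)" if "f differentiable_on life T" "t \<in> life T" for f t
    using that unfolding ddt_def differentiable_on_def has_real_derivative_iff_has_vector_derivative
    by (simp add: vector_derivative_works[symmetric])
  have d\<phi>: "(\<phi> has_real_derivative v t) (at t within life T)" if "t \<in> life T" for t
    unfolding v_def by (rule der[OF dif(2) that])
  have dv: "(v has_real_derivative sqrt 3 * h t * v t - deriv V (\<phi> t)) (at t within life T)" if t: "t \<in> life T" for t
  proof -
    have "ddt T v t = sqrt 3 * h t * v t - deriv V (\<phi> t)" using eqs[OF t] by (simp add: h_def)
    then show ?thesis using der[OF dif(3) t] by simp
  qed
  have en: "energy V T \<phi> t = (v t)\<^sup>2 + 2 * V (\<phi> t)" for t by (simp add: energy_def v_def)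
  have hnn: "0 \<le> h t" if "t \<in> life T" for t using eqs[OF that] by (simp add: h_def)
  have dE: "(energy V T \<phi> has_real_derivative 2 * (sqrt 3 * h t * (v t)\<^sup>2)) (at t within life T)" if t: "t \<in> life T" for t
  proof -
    have "((\<lambda>t. (v t)\<^sup>2 + 2 * V (\<phi> t)) has_real_derivative
        2 * v t * (sqrt 3 * h t * v t - deriv V (\<phi> t)) + 2 * (deriv V (\<phi> t) * v t)) (at t within life T)"
      by (rule derivative_eq_intros dv[OF t] DERIV_chain2[OF V d\<phi>[OF t]] refl | simp)+
    moreover have "2 * v t * (sqrt 3 * h t * v t - deriv V (\<phi> t)) + 2 * (deriv V (\<phi> t) * v t) = 2 * (sqrt 3 * h t * (v t)\<^sup>2)"
      by (simp add: power2_eq_square algebra_simps)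
    moreover have "energy V T \<phi> = (\<lambda>t. (v t)\<^sup>2 + 2 * V (\<phi> t))" using en by blast
    ultimately show ?thesis by simp
  qed
  have Epos: "0 < energy V T \<phi> t" if t: "t \<in> life T" for t
  proof -
    have "energy V T \<phi> 0 \<le> energy V T \<phi> t"
    proof (rule nondecreasing_of_deriv_nonneg[OF life_nonneg[OF t] life_Icc[OF order_refl t]])
      fix r assume r: "0 \<le> r" "r \<le> t"
      then have rl: "r \<in> life T" using life_downward_closed t by blast
      show "(energy V T \<phi> has_real_derivative 2 * (sqrt 3 * h r * (v r)\<^sup>2)) (at r within life T)" by (rule dE[OF rl])
      show "0 \<le> 2 * (sqrt 3 * h r * (v r)\<^sup>2)" using hnn[OF rl] by simp
    qed
    then show ?thesis using pos by linarith
  qed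
  have dh: "(h has_real_derivative sqrt 3 * (v t)\<^sup>2) (at t within life T)" if t: "t \<in> life T" for t
  proof -
    have "0 < h t" using Epos[OF t] by (simp add: h_def)
    have "(h has_real_derivative inverse (sqrt (energy V T \<phi> t)) / 2 * (2 * (sqrt 3 * h t * (v t)\<^sup>2))) (at t within life T)"
      using DERIV_chain2[where f=sqrt and g="energy V T \<phi>", OF DERIV_real_sqrt[OF Epos[OF t]] dE[OF t]] unfolding h_def .
    moreover have "inverse (sqrt (energy V T \<phi> t)) / 2 * (2 * (sqrt 3 * h t * (v t)\<^sup>2)) = sqrt 3 * (v t)\<^sup>2"
    proof -
      have "sqrt (energy V T \<phi> t) = h t" by (simp add: h_def)
      then show ?thesis using \<open>0 < h t\<close> by simp
    qed
    ultimately show ?thesis by (simp only:)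
  qed
  show "orbit V (deriv V) T \<phi> v h"
    unfolding orbit_def using T d\<phi> dv dh Epos by (auto simp: h_def en less_imp_le)
  show "(a has_real_derivative - (a t * h t / sqrt 3)) (at t within life T)" if t: "t \<in> life T" for t
  proof -
    have "a t \<noteq> 0" using eqs[OF t] by auto
    then have "ddt T a t = a t * (ddt T a t / a t)" by simp
    also have "ddt T a t / a t = - (h t / sqrt 3)" using eqs[OF t] by (simp add: h_def real_sqrt_divide)
    finally have "ddt T a t = - (a t * h t / sqrt 3)" by simp
    then show ?thesis using der[OF dif(1) t] by (simp only:)
  qed
qed

text \<open>Positive energy excludes the spurious solutions with \<open>\<epsilon> = 0\<close> on an interval.\<close>

lemma orbit_collapsing_solution:
  assumes V: "\<And>x. (V has_real_derivative deriv V x) (at x)"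
    and o: "orbit V (deriv V) T \<phi> v h"
    and a: "\<And>t. t \<in> life T \<Longrightarrow> (a has_real_derivative - (a t * h t / sqrt 3)) (at t within life T)"
      "\<And>t. t \<in> life T \<Longrightarrow> 0 < a t"
  shows "collapsing_solution V T a \<phi>"
proof -
  have v: "ddt T \<phi> t = v t" if "t \<in> life T" for t by (rule ddt_eqI[OF that orbitD(1)[OF o that]])
  have dv: "(ddt T \<phi> has_real_derivative sqrt 3 * h t * v t - deriv V (\<phi> t)) (at t within life T)" if t: "t \<in> life T" for t
    unfolding has_real_derivative_iff_has_vector_derivative
    by (rule has_vector_derivative_transform[OF t v])
       (use orbitD(2)[OF o t] in \<open>auto simp: has_real_derivative_iff_has_vector_derivative\<close>)
  have E: "energy V T \<phi> t = (h t)\<^sup>2" "0 < h t" if "t \<in> life T" for t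
    using orbitD(4,5)[OF o that] v[OF that] by (auto simp: energy_def)
  have dif: "f differentiable_on life T" if "\<And>t. t \<in> life T \<Longrightarrow> (f has_real_derivative f' t) (at t within life T)" for f f'
    unfolding differentiable_on_def using that by (auto simp: has_field_derivative_def differentiable_def)
  have 1: "a differentiable_on life T" by (rule dif[OF a(1)])
  have 2: "\<phi> differentiable_on life T" by (rule dif[OF orbitD(1)[OF o]])
  have 3: "ddt T \<phi> differentiable_on life T" by (rule dif[OF dv])
  have 4: "0 < T" using o by (simp add: orbit_def)
  have 5: "a t > 0 \<and> energy V T \<phi> t \<ge> 0 \<and> ddt T a t / a t = - sqrt (energy V T \<phi> t / 3) \<and>
        ddt T (ddt T \<phi>) t + deriv V (\<phi> t) = sqrt 3 * sqrt (energy V T \<phi> t) * ddt T \<phi> t" if t: "t \<in> life T" for t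
    using a(2)[OF t] E[OF t] v[OF t] ddt_eqI[OF t a(1)[OF t]] ddt_eqI[OF t dv[OF t]]
    by (simp add: real_sqrt_divide)
  have 6: "\<not> (\<forall>t\<in>{c..d}. energy V T \<phi> t = 0)" if "c < d" "{c..d} \<subseteq> life T" for c d
  proof -
    have "c \<in> life T" "c \<in> {c..d}" using that by auto
    then show ?thesis using E[of c] by (intro notI) (auto dest!: bspec[of _ _ c])
  qed
  show ?thesis unfolding collapsing_solution_def
  proof (intro conjI allI impI)
    show "\<phi> constant_on {c..d}" if "c < d" "{c..d} \<subseteq> life T" "\<forall>t\<in>{c..d}. energy V T \<phi> t = 0" for c d
      using 6[OF that(1,2)] that(3) by contradiction
  qed (use 1 2 3 4 5 in simp_all)
qed

text \<open>A bound for \<open>h\<close> bounds \<open>v\<close>, as \<open>V\<close> is bounded below, then \<open>\<phi>\<close> and the force during a finite time.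
  So a maximal solution of positive energy that ends in finite time has unbounded energy.\<close>

lemma bounded_energy_continues:
  fixes V :: "real \<Rightarrow> real"
  assumes V: "\<And>x. (V has_real_derivative deriv V x) (at x)"
    and W: "\<And>x. (deriv V has_real_derivative W' x) (at x)" and W': "continuous_on UNIV W'"
    and below: "\<And>x. - K \<le> V x"
    and o: "orbit V (deriv V) (ereal \<tau>) \<phi> v h"
    and a: "\<And>t. t \<in> life (ereal \<tau>) \<Longrightarrow> (a has_real_derivative - (a t * h t / sqrt 3)) (at t within life (ereal \<tau>))"
      "\<And>t. t \<in> life (ereal \<tau>) \<Longrightarrow> 0 < a t"
    and H: "\<And>t. t \<in> life (ereal \<tau>) \<Longrightarrow> h t \<le> H"
  shows "\<exists>\<tau>' a' \<phi>'. \<tau> < \<tau>' \<and> collapsing_solution V (ereal \<tau>') a' \<phi>' \<and>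
    (\<forall>t\<in>life (ereal \<tau>). a' t = a t \<and> \<phi>' t = \<phi> t)"
proof -
  have life: "life (ereal x) = {0..<x}" for x by (auto simp: life_def)
  have \<tau>: "0 < \<tau>" using o by (simp add: orbit_def)
  define S where "S t = (\<phi> t, v t, h t, ln (a t))" for t
  define F where "F = collapse_field (deriv V)"
  have S: "(S has_vector_derivative F (S t)) (at t within {0..<\<tau>})" if t: "t \<in> {0..<\<tau>}" for t
  proof -
    have t': "t \<in> life (ereal \<tau>)" using t by (simp add: life)
    have "((\<lambda>t. ln (a t)) has_real_derivative 1 / a t * - (a t * h t / sqrt 3)) (at t within life (ereal \<tau>))"
      by (rule DERIV_chain2[OF DERIV_ln_divide[OF a(2)[OF t']] a(1)[OF t']])
    then have "((\<lambda>t. ln (a t)) has_real_derivative - (h t / sqrt 3)) (at t within life (ereal \<tau>))"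
      using a(2)[OF t'] by simp
    then show ?thesis
      using orbitD(1-3)[OF o t'] unfolding S_def F_def collapse_field_def prod.case life[symmetric]
      by (intro has_vector_derivative_Pair) (simp_all add: has_real_derivative_iff_has_vector_derivative)
  qed
  have Wc: "continuous_on UNIV (deriv V)" using DERIV_isCont[OF W] by (intro continuous_at_imp_continuous_on) auto
  define A where "A = sqrt (H\<^sup>2 + 2 * K)"
  have h: "0 < h t" "h t \<le> H" if "t \<in> {0..<\<tau>}" for t using that orbitD(5)[OF o] H by (auto simp: life)
  have v: "\<bar>v t\<bar> \<le> A" if t: "t \<in> {0..<\<tau>}" for t
  proof -
    have "(h t)\<^sup>2 \<le> H\<^sup>2" using h[OF t] by (intro power_mono) auto
    then have "(v t)\<^sup>2 \<le> H\<^sup>2 + 2 * K" using orbitD(4)[OF o, of t] below[of "\<phi> t"] t by (simp add: life)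
    then show ?thesis unfolding A_def by (intro real_le_rsqrt) simp
  qed
  have H0: "0 < H" and A0: "0 \<le> A" using h[of 0] v[of 0] \<tau> by auto
  have \<phi>: "\<bar>\<phi> t\<bar> \<le> \<bar>\<phi> 0\<bar> + A * \<tau>" if t: "t \<in> {0..<\<tau>}" for t
  proof -
    have "\<bar>\<phi> t - \<phi> 0\<bar> \<le> A * (t - 0)"
      by (rule increment_abs_le[of _ _ "life (ereal \<tau>)" _ v]) (use t v orbitD(1)[OF o] in \<open>auto simp: life\<close>)
    also have "\<dots> \<le> A * \<tau>" using t A0 by (intro mult_left_mono) auto
    finally show ?thesis by linarith
  qed
  define R where "R = \<bar>\<phi> 0\<bar> + A * \<tau>"
  obtain B where B: "\<forall>x\<in>{-R..R}. \<bar>deriv V x\<bar> \<le> B"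
    using bounded_on_Icc[OF continuous_on_subset[OF Wc]] by blast
  define M where "M = A + (2 * (H * A) + B) + 2 * A\<^sup>2 + H"
  have M: "norm (F (S t)) \<le> M" if t: "t \<in> {0..<\<tau>}" for t
  proof -
    have "\<bar>deriv V (\<phi> t)\<bar> \<le> B" using B \<phi>[OF t] by (simp add: R_def abs_le_iff)
    moreover have "\<bar>sqrt 3 * h t * v t\<bar> \<le> 2 * (H * A)"
    proof -
      have "\<bar>h t * v t\<bar> \<le> H * A" unfolding abs_mult using h[OF t] v[OF t] by (intro mult_mono) auto
      then have "sqrt 3 * \<bar>h t * v t\<bar> \<le> 2 * (H * A)" using sqrt3_bounds by (intro mult_mono) auto
      then show ?thesis by (simp add: abs_mult)
    qed
    moreover have "sqrt 3 * (v t)\<^sup>2 \<le> 2 * A\<^sup>2"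
      using sqrt3_bounds v[OF t] power_mono[OF v[OF t], of 2] by (intro mult_mono) auto
    moreover have "h t / sqrt 3 \<le> h t / 1" using sqrt3_bounds h(1)[OF t] by (intro divide_left_mono) auto
    moreover have "norm (F (S t)) \<le> \<bar>v t\<bar> + \<bar>sqrt 3 * h t * v t - deriv V (\<phi> t)\<bar> + \<bar>sqrt 3 * (v t)\<^sup>2\<bar> + \<bar>- (h t / sqrt 3)\<bar>"
      unfolding F_def S_def collapse_field_def prod.case by (rule norm4_le)
    moreover have "\<bar>sqrt 3 * (v t)\<^sup>2\<bar> = sqrt 3 * (v t)\<^sup>2" "\<bar>- (h t / sqrt 3)\<bar> = h t / sqrt 3"
      using h(1)[OF t] by (simp_all add: abs_mult)
    ultimately show ?thesis using v[OF t] h[OF t] unfolding M_def by linarith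
  qed
  obtain \<tau>' S' where \<tau>': "\<tau> < \<tau>'" and ext: "\<And>t. t \<in> {0..<\<tau>} \<Longrightarrow> S' t = S t"
    and S': "\<And>t. t \<in> {0..<\<tau>'} \<Longrightarrow> (S' has_vector_derivative F (S' t)) (at t within {0..<\<tau>'})"
    by (rule solution_continues[OF \<tau> S M]) (use continuous_collapse_field[OF Wc] collapse_field_lipschitz[OF W W'] in \<open>auto simp: F_def\<close>)
  define \<phi>' v' h' l' where "\<phi>' t = fst (S' t)" and "v' t = fst (snd (S' t))" and "h' t = fst (snd (snd (S' t)))"
    and "l' t = snd (snd (snd (S' t)))" for t
  note defs = \<phi>'_def v'_def h'_def l'_def
  let ?T = "ereal \<tau>'"
  have d: "(\<phi>' has_real_derivative v' t) (at t within life ?T)"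
    "(v' has_real_derivative sqrt 3 * h' t * v' t - deriv V (\<phi>' t)) (at t within life ?T)"
    "(h' has_real_derivative sqrt 3 * (v' t)\<^sup>2) (at t within life ?T)"
    "(l' has_real_derivative - (h' t / sqrt 3)) (at t within life ?T)" if t: "t \<in> life ?T" for t
  proof -
    have D: "(S' has_vector_derivative F (S' t)) (at t within life ?T)" using S'[of t] t by (simp add: life)
    note D1 = bounded_linear.has_vector_derivative[OF bounded_linear_fst D]
      and D2 = bounded_linear.has_vector_derivative[OF bounded_linear_snd D]
    note D21 = bounded_linear.has_vector_derivative[OF bounded_linear_fst D2]
      and D22 = bounded_linear.has_vector_derivative[OF bounded_linear_snd D2]
    note D221 = bounded_linear.has_vector_derivative[OF bounded_linear_fst D22]
      and D222 = bounded_linear.has_vector_derivative[OF bounded_linear_snd D22]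
    show "(\<phi>' has_real_derivative v' t) (at t within life ?T)"
      "(v' has_real_derivative sqrt 3 * h' t * v' t - deriv V (\<phi>' t)) (at t within life ?T)"
      "(h' has_real_derivative sqrt 3 * (v' t)\<^sup>2) (at t within life ?T)"
      "(l' has_real_derivative - (h' t / sqrt 3)) (at t within life ?T)"
      using D1 D21 D221 D222 unfolding defs F_def collapse_field_def
      by (simp_all add: has_real_derivative_iff_has_vector_derivative split_beta)
  qed
  have S0: "S' 0 = S 0" using ext[of 0] \<tau> by simp
  have z: "0 \<in> life (ereal \<tau>)" using \<tau> by (simp add: life)
  have con: "(h' t)\<^sup>2 = (v' t)\<^sup>2 + 2 * V (\<phi>' t)" if t: "t \<in> life ?T" for t
  proof -
    define E where "E t = (h' t)\<^sup>2 - (v' t)\<^sup>2 - 2 * V (\<phi>' t)" for t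
    have dE: "(E has_real_derivative 0) (at r within life ?T)" if r: "r \<in> life ?T" for r
    proof -
      have "(E has_real_derivative 2 * h' r * (sqrt 3 * (v' r)\<^sup>2) - 2 * v' r * (sqrt 3 * h' r * v' r - deriv V (\<phi>' r))
          - 2 * (deriv V (\<phi>' r) * v' r)) (at r within life ?T)"
        unfolding E_def by (rule derivative_eq_intros d[OF r] DERIV_chain2[OF V d(1)[OF r]] refl | simp)+
      moreover have "2 * h' r * (sqrt 3 * (v' r)\<^sup>2) - 2 * v' r * (sqrt 3 * h' r * v' r - deriv V (\<phi>' r))
          - 2 * (deriv V (\<phi>' r) * v' r) = 0" by (simp add: power2_eq_square algebra_simps)
      ultimately show ?thesis by simp
    qed
    have "\<bar>E t - E 0\<bar> \<le> 0 * (t - 0)"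
    proof (rule increment_abs_le[OF life_nonneg[OF t] life_Icc[OF order_refl t], of _ "\<lambda>_. 0"])
      show "(E has_real_derivative 0) (at r within life ?T)" if "0 \<le> r" "r \<le> t" for r
        by (rule dE[OF life_downward_closed[OF that t]])
    qed simp
    moreover have "E 0 = 0" using orbitD(4)[OF o z] S0 by (simp add: E_def defs S_def)
    ultimately show ?thesis by (simp add: E_def)
  qed
  have hpos: "0 < h' t" if t: "t \<in> life ?T" for t
  proof -
    have "h' 0 \<le> h' t"
    proof (rule nondecreasing_of_deriv_nonneg[OF life_nonneg[OF t] life_Icc[OF order_refl t], of _ "\<lambda>t. sqrt 3 * (v' t)\<^sup>2"])
      show "(h' has_real_derivative sqrt 3 * (v' r)\<^sup>2) (at r within life ?T)" if "0 \<le> r" "r \<le> t" for r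
        by (rule d(3)[OF life_downward_closed[OF that t]])
    qed simp
    moreover have "h' 0 = h 0" using S0 by (simp add: defs S_def)
    ultimately show ?thesis using orbitD(5)[OF o z] by simp
  qed
  have o': "orbit V (deriv V) ?T \<phi>' v' h'"
    unfolding orbit_def using d con hpos \<tau> \<tau>' by auto
  define a' where "a' t = exp (l' t)" for t
  have "collapsing_solution V ?T a' \<phi>'"
  proof (rule orbit_collapsing_solution[OF V o'])
    fix t assume t: "t \<in> life ?T"
    show "(a' has_real_derivative - (a' t * h' t / sqrt 3)) (at t within life ?T)"
      unfolding a'_def using DERIV_chain2[OF DERIV_exp d(4)[OF t]] by simp
  qed (simp add: a'_def)
  moreover have "a' t = a t \<and> \<phi>' t = \<phi> t" if t: "t \<in> life (ereal \<tau>)" for t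
    using ext[of t] t a(2)[OF t] by (simp add: a'_def defs S_def life)
  ultimately show ?thesis using \<tau>' by (intro exI[of _ \<tau>'] exI[of _ a'] exI[of _ \<phi>']) simp
qed

section \<open>The exceptional initial data\<close>

definition initial_data ::
  "(real \<Rightarrow> real) \<Rightarrow> (real \<Rightarrow> real) \<Rightarrow> (ereal \<Rightarrow> (real \<Rightarrow> real) \<Rightarrow> (real \<Rightarrow> real) \<Rightarrow> (real \<Rightarrow> real) \<Rightarrow> bool) \<Rightarrow> (real \<times> real) set"
  where "initial_data V W Q = {p. \<exists>T \<phi> v h. orbit V W T \<phi> v h \<and> Q T \<phi> v h \<and> p = (\<phi> 0, v 0)}"

lemma initial_dataI: "orbit V W T \<phi> v h \<Longrightarrow> Q T \<phi> v h \<Longrightarrow> (\<phi> 0, v 0) \<in> initial_data V W Q"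
  unfolding initial_data_def by blast

context confining_potential
begin

lemma initial_data_negligible:
  assumes meet: "\<And>T1 \<phi>1 v1 h1 T2 \<phi>2 v2 h2. orbit V W T1 \<phi>1 v1 h1 \<Longrightarrow> Q T1 \<phi>1 v1 h1 \<Longrightarrow>
      orbit V W T2 \<phi>2 v2 h2 \<Longrightarrow> Q T2 \<phi>2 v2 h2 \<Longrightarrow>
      \<exists>t1\<in>life T1. \<exists>t2\<in>life T2. \<phi>1 t1 = \<phi>2 t2 \<and> v1 t1 = v2 t2"
  shows "negligible (initial_data V W Q)"
proof -
  have "\<forall>p. \<exists>T \<phi> v h. p \<in> initial_data V W Q \<longrightarrow> orbit V W T \<phi> v h \<and> Q T \<phi> v h \<and> p = (\<phi> 0, v 0)"
    unfolding initial_data_def by blast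
  then obtain T \<phi> v h where *: "\<And>p. p \<in> initial_data V W Q \<Longrightarrow>
      orbit V W (T p) (\<phi> p) (v p) (h p) \<and> Q (T p) (\<phi> p) (v p) (h p) \<and> p = (\<phi> p 0, v p 0)"
    by metis
  show ?thesis
  proof (rule meeting_orbits_negligible[OF W_deriv W'_cont, of _ V T \<phi> v h])
    fix p q assume pq: "p \<in> initial_data V W Q" "q \<in> initial_data V W Q"
    show "orbit V W (T p) (\<phi> p) (v p) (h p)" "(\<phi> p 0, v p 0) = p" using *[OF pq(1)] by auto
    show "\<exists>t\<in>life (T p). \<exists>t'\<in>life (T q). \<phi> p t = \<phi> q t' \<and> v p t = v q t'"
      using *[OF pq(1)] *[OF pq(2)] by (intro meet) auto
  qed
qed

lemma countable_climb_ends: "countable (climb_ends W)" and countable_critical: "countable {p. W p = 0}"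
proof -
  have "{p. W p = 0} sparse_in UNIV"
    unfolding sparse_in_def using noncritical_near by (auto simp: islimpt_iff_eventually intro: exI[of _ UNIV])
  then show "countable {p. W p = 0}" using sparse_imp_countable[of UNIV] by simp
  then show "countable (climb_ends W)" by (simp add: climb_ends_def)
qed

text \<open>The orbits that come to rest at a critical point, those that climb slowly to the right or to the
  left, and those that follow \<open>u\<close> to the right or to the left at unbounded energy.\<close>

definition exceptional_data :: "(real \<times> real) set" where
  "exceptional_data =
     (\<Union>p\<in>{p. W p = 0}. initial_data V W (\<lambda>T \<phi> v h. rests p T \<phi> v)) \<union>
     (\<Union>p\<in>climb_ends W. initial_data V W (climbs W (\<lambda>_. 0) p)) \<union>
     (\<Union>p\<in>climb_ends (\<lambda>x. - W (- x)). initial_data V W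
        (\<lambda>T \<phi> v h. climbs (\<lambda>x. - W (- x)) (\<lambda>_. 0) p T (\<lambda>t. - \<phi> t) (\<lambda>t. - v t) h)) \<union>
     initial_data V W (climbs W (slope V W) \<infinity>) \<union>
     initial_data V W (\<lambda>T \<phi> v h. climbs (\<lambda>x. - W (- x)) (slope (\<lambda>x. V (- x)) (\<lambda>x. - W (- x))) \<infinity>
        T (\<lambda>t. - \<phi> t) (\<lambda>t. - v t) h)"

lemma exceptional_dataI:
  assumes o: "orbit V W T \<phi> v h"
  shows "W p = 0 \<Longrightarrow> rests p T \<phi> v \<Longrightarrow> (\<phi> 0, v 0) \<in> exceptional_data"
    and "p' \<in> climb_ends W \<Longrightarrow> climbs W (\<lambda>_. 0) p' T \<phi> v h \<Longrightarrow> (\<phi> 0, v 0) \<in> exceptional_data"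
    and "p' \<in> climb_ends (\<lambda>x. - W (- x)) \<Longrightarrow>
      climbs (\<lambda>x. - W (- x)) (\<lambda>_. 0) p' T (\<lambda>t. - \<phi> t) (\<lambda>t. - v t) h \<Longrightarrow> (\<phi> 0, v 0) \<in> exceptional_data"
    and "climbs W (slope V W) \<infinity> T \<phi> v h \<Longrightarrow> (\<phi> 0, v 0) \<in> exceptional_data"
    and "climbs (\<lambda>x. - W (- x)) (slope (\<lambda>x. V (- x)) (\<lambda>x. - W (- x))) \<infinity> T (\<lambda>t. - \<phi> t) (\<lambda>t. - v t) h \<Longrightarrow>
      (\<phi> 0, v 0) \<in> exceptional_data"
  unfolding exceptional_data_def
  subgoal by (rule UnI1, rule UnI1, rule UnI1, rule UnI1, rule UN_I[of p], simp, rule initial_dataI[OF o])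
  subgoal by (rule UnI1, rule UnI1, rule UnI1, rule UnI2, rule UN_I[of p'], assumption, rule initial_dataI[OF o])
  subgoal by (rule UnI1, rule UnI1, rule UnI2, rule UN_I[of p'], assumption, rule initial_dataI[OF o])
  subgoal by (rule UnI1, rule UnI2, rule initial_dataI[OF o])
  subgoal by (rule UnI2, rule initial_dataI[OF o])
  done

lemma exceptional_data_negligible: "negligible exceptional_data"
proof -
  interpret M: confining_potential "\<lambda>x. V (- x)" "\<lambda>x. - W (- x)" "\<lambda>x. W' (- x)" R \<rho> K
    by (rule reflection)
  have rest: "negligible (initial_data V W (\<lambda>T \<phi> v h. rests p T \<phi> v))" for p
  proof (rule initial_data_negligible)
    fix T1 \<phi>1 v1 T2 \<phi>2 v2 assume "rests p T1 \<phi>1 v1" "rests p T2 \<phi>2 v2"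
    then show "\<exists>t1\<in>life T1. \<exists>t2\<in>life T2. \<phi>1 t1 = \<phi>2 t2 \<and> v1 t1 = v2 t2"
      unfolding rests_def by metis
  qed
  have climb: "negligible (initial_data V W (climbs W g p))" for g p
    by (rule initial_data_negligible) (rule climbing_orbits_meet)
  have climb': "negligible (initial_data V W
      (\<lambda>T \<phi> v h. climbs (\<lambda>x. - W (- x)) g p T (\<lambda>t. - \<phi> t) (\<lambda>t. - v t) h))" for g p
  proof (rule initial_data_negligible)
    fix T1 \<phi>1 v1 h1 T2 \<phi>2 v2 h2
    assume o1: "orbit V W T1 \<phi>1 v1 h1" and c1: "climbs (\<lambda>x. - W (- x)) g p T1 (\<lambda>t. - \<phi>1 t) (\<lambda>t. - v1 t) h1"
      and o2: "orbit V W T2 \<phi>2 v2 h2" and c2: "climbs (\<lambda>x. - W (- x)) g p T2 (\<lambda>t. - \<phi>2 t) (\<lambda>t. - v2 t) h2"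
    show "\<exists>t1\<in>life T1. \<exists>t2\<in>life T2. \<phi>1 t1 = \<phi>2 t2 \<and> v1 t1 = v2 t2"
      using climbing_orbits_meet[OF orbit_reflect[OF o1] c1 orbit_reflect[OF o2] c2] by simp
  qed
  have UN: "negligible (\<Union>p\<in>I. X p)" if "countable I" "\<And>p. negligible (X p)" for I :: "'i set" and X :: "'i \<Rightarrow> (real \<times> real) set"
    using that by (intro negligible_countable_Union) auto
  show ?thesis
    unfolding exceptional_data_def
    by (intro negligible_Un UN rest climb climb' countable_critical countable_climb_ends M.countable_climb_ends)
qed

end

text \<open>The data of zero energy lie on two curves; each vertical line meets them in at most two points.\<close>

lemma zero_energy_negligible:
  fixes V :: "real \<Rightarrow> real"
  assumes "continuous_on UNIV V"
  shows "negligible {(\<phi>, v). v\<^sup>2 + 2 * V \<phi> = 0}"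
proof -
  let ?Z = "{(\<phi>, v). v\<^sup>2 + 2 * V \<phi> = 0}"
  have "closed ((\<lambda>p. (snd p)\<^sup>2 + 2 * V (fst p)) -` {0})"
    by (intro closed_vimage continuous_intros continuous_on_compose2[OF assms]) auto
  moreover have "(\<lambda>p. (snd p)\<^sup>2 + 2 * V (fst p)) -` {0} = ?Z" by auto
  ultimately have "closed ?Z" by simp
  then have sets: "?Z \<in> sets lborel" by (simp add: borel_closed)
  then have sets': "?Z \<in> sets (lborel \<Otimes>\<^sub>M lborel)" unfolding lborel_prod .
  have slice: "emeasure lborel (Pair x -` ?Z) = 0" for x
  proof -
    have "Pair x -` ?Z \<subseteq> {sqrt (- 2 * V x), - sqrt (- 2 * V x)}"
    proof
      fix v assume "v \<in> Pair x -` ?Z"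
      then have "v\<^sup>2 = - 2 * V x" by simp
      then have "\<bar>v\<bar> = sqrt (- 2 * V x)" by (metis real_sqrt_abs)
      then show "v \<in> {sqrt (- 2 * V x), - sqrt (- 2 * V x)}" by auto
    qed
    then have "finite (Pair x -` ?Z)" by (rule finite_subset) simp
    then show ?thesis by (intro emeasure_lborel_countable countable_finite)
  qed
  have "emeasure (lborel \<Otimes>\<^sub>M lborel) ?Z = (\<integral>\<^sup>+ x. emeasure lborel (Pair x -` ?Z) \<partial>lborel)"
    by (rule lborel.emeasure_pair_measure_alt[OF sets'])
  also have "\<dots> = 0" unfolding slice by simp
  finally have "emeasure lborel ?Z = 0" unfolding lborel_prod .
  then have "?Z \<in> null_sets lborel" using sets by auto
  then show ?thesis by (simp add: negligible_iff_null_sets null_sets_completionI)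
qed

section \<open>The collapse theorem\<close>

lemma eventually_at_left_of_ev:
  assumes "ev (ereal \<tau>) P" shows "\<forall>\<^sub>F t in at_left \<tau>. P t"
proof -
  obtain s where s: "s \<in> life (ereal \<tau>)" "\<And>t. t \<in> life (ereal \<tau>) \<Longrightarrow> s \<le> t \<Longrightarrow> P t"
    using assms unfolding ev_def by metis
  then show ?thesis unfolding eventually_at_left_field by (intro exI[of _ s]) (auto simp: life_def)
qed

lemma ev_above_of_unbounded:
  assumes o: "orbit V W T \<phi> v h" and unb: "\<And>B. \<exists>t\<in>life T. B < h t"
  shows "ev T (\<lambda>t. B < h t)"
proof -
  obtain s where s: "s \<in> life T" "B < h s" using unb by blast
  then show ?thesis
    using orbit_h_mono[OF o life_nonneg[OF s(1)]] by (intro evI[OF s(1)]) (auto intro: less_le_trans)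
qed

lemma black_hole_of_divergence:
  assumes sol: "collapsing_solution V (ereal \<tau>) a \<phi>"
  defines "h \<equiv> \<lambda>t. sqrt (energy V (ereal \<tau>) \<phi> t)"
  assumes h: "\<And>B. ev (ereal \<tau>) (\<lambda>t. B < h t)" and a: "\<And>e. 0 < e \<Longrightarrow> ev (ereal \<tau>) (\<lambda>t. a t < e)"
    and ah: "\<And>B. ev (ereal \<tau>) (\<lambda>t. B < a t * h t)"
  shows "collapses_to_black_hole V (ereal \<tau>) a \<phi>"
proof -
  let ?T = "ereal \<tau>"
  have eqs: "0 < a t" "0 \<le> energy V ?T \<phi> t" "ddt ?T a t / a t = - sqrt (energy V ?T \<phi> t / 3)" if "t \<in> life ?T" for t
    using sol that unfolding collapsing_solution_def by auto
  have energy: "ev ?T (\<lambda>t. B < energy V ?T \<phi> t)" for B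
  proof (rule ev_mono[OF h[of "1 + \<bar>B\<bar>"]])
    fix t assume t: "t \<in> life ?T" "1 + \<bar>B\<bar> < h t"
    have "(1 + \<bar>B\<bar>) * 1 \<le> h t * h t" using t(2) by (intro mult_mono) auto
    also have "h t * h t = energy V ?T \<phi> t" using eqs(2)[OF t(1)] by (simp add: h_def)
    finally show "B < energy V ?T \<phi> t" by simp
  qed
  have speed: "ev ?T (\<lambda>t. B < (ddt ?T a t)\<^sup>2)" for B
  proof (rule ev_mono[OF ah[of "1 + 3 * \<bar>B\<bar>"]])
    fix t assume t: "t \<in> life ?T" "1 + 3 * \<bar>B\<bar> < a t * h t"
    have "a t \<noteq> 0" using eqs(1)[OF t(1)] by simp
    then have "ddt ?T a t = a t * (ddt ?T a t / a t)" by simp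
    also have "\<dots> = - (a t * h t / sqrt 3)" unfolding eqs(3)[OF t(1)] by (simp add: h_def real_sqrt_divide)
    finally have "(ddt ?T a t)\<^sup>2 = (a t * h t)\<^sup>2 / 3" by (simp add: power_divide)
    moreover have "(1 + 3 * \<bar>B\<bar>) * 1 \<le> (a t * h t) * (a t * h t)" using t(2) by (intro mult_mono) auto
    ultimately show "B < (ddt ?T a t)\<^sup>2" by (simp add: power2_eq_square)
  qed
  have "filterlim (energy V ?T \<phi>) at_top (at_left \<tau>)"
    unfolding filterlim_at_top_dense using eventually_at_left_of_ev[OF energy] by blast
  moreover have "(a \<longlongrightarrow> 0) (at_left \<tau>)"
  proof (rule tendstoI)
    fix e :: real assume "0 < e"
    have "ev ?T (\<lambda>t. dist (a t) 0 < e)"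
      by (rule ev_mono[OF a[OF \<open>0 < e\<close>]]) (use eqs(1) in \<open>auto simp: dist_real_def abs_of_pos\<close>)
    then show "\<forall>\<^sub>F t in at_left \<tau>. dist (a t) 0 < e" by (rule eventually_at_left_of_ev)
  qed
  moreover have "\<exists>\<^sub>F t in at_left \<tau>. (ddt ?T a t)\<^sup>2 > B" for B
    by (rule eventually_frequently[OF _ eventually_at_left_of_ev[OF speed]]) simp
  moreover have "\<exists>t\<in>life ?T. \<exists>r\<in>{0..B}. trapped_at ?T a r t" if "0 < B" for B
  proof -
    obtain t where t: "t \<in> life ?T" "1 / B\<^sup>2 < (ddt ?T a t)\<^sup>2" using speed[of "1 / B\<^sup>2"] unfolding ev_def by blast
    then have "1 < B\<^sup>2 * (ddt ?T a t)\<^sup>2" using that by (simp add: field_simps)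
    then show ?thesis using t(1) that unfolding trapped_at_def by (intro bexI[of _ t] bexI[of _ B]) auto
  qed
  ultimately show ?thesis unfolding collapses_to_black_hole_def by blast
qed

lemma maximal_solution_collapses:
  assumes conf: "confining_potential V (deriv V) W' R \<rho> K"
    and max: "maximal_collapsing_solution V T a \<phi>" and pos: "energy V T \<phi> 0 > 0"
    and generic: "(\<phi> 0, ddt T \<phi> 0) \<notin> confining_potential.exceptional_data V (deriv V)"
  shows "collapses_to_black_hole V T a \<phi>"
proof -
  interpret confining_potential V "deriv V" W' R \<rho> K by (rule conf)
  define v where "v = ddt T \<phi>"
  define h where "h = (\<lambda>t. sqrt (energy V T \<phi> t))"
  have sol: "collapsing_solution V T a \<phi>" using max by (simp add: maximal_collapsing_solution_def)
  have o: "orbit V (deriv V) T \<phi> v h"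
    and a: "\<And>t. t \<in> life T \<Longrightarrow> (a has_real_derivative - (a t * h t / sqrt 3)) (at t within life T)"
    unfolding v_def h_def
    by (rule collapsing_solution_orbit(1)[OF V_deriv sol pos], rule collapsing_solution_orbit(2)[OF V_deriv sol pos])
  have apos: "0 < a t" if "t \<in> life T" for t using sol that unfolding collapsing_solution_def by simp
  have T0: "0 < T" using o by (simp add: orbit_def)
  have unb: "\<exists>t\<in>life T. B < h t" for B
  proof (rule ccontr)
    assume "\<not> (\<exists>t\<in>life T. B < h t)"
    then have B: "h t \<le> B" if "t \<in> life T" for t using that by (meson not_le)
    show False
    proof (cases T)
      case (real \<tau>)
      obtain \<tau>' a' \<phi>' where "\<tau> < \<tau>' \<and> collapsing_solution V (ereal \<tau>') a' \<phi>' \<and>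
          (\<forall>t\<in>life (ereal \<tau>). a' t = a t \<and> \<phi>' t = \<phi> t)"
        using bounded_energy_continues[OF V_deriv W_deriv W'_cont V_below
              o[unfolded real] a[unfolded real] apos[unfolded real] B[unfolded real]] by metis
      then have "T < ereal \<tau>' \<and> collapsing_solution V (ereal \<tau>') a' \<phi>' \<and> (\<forall>t\<in>life T. a' t = a t \<and> \<phi>' t = \<phi> t)"
        unfolding real by simp
      then show False using max unfolding maximal_collapsing_solution_def by blast
    next
      case PInf
      have "h t \<le> B" if "0 \<le> t" for t using B[of t] that unfolding PInf by (simp add: life_infinity)
      then have "(\<phi> 0, v 0) \<in> exceptional_data"
        using bounded_orbit_exceptional[OF o[unfolded PInf]] exceptional_dataI(1-3)[OF o[unfolded PInf]] by metis
      then show False using generic by (simp add: v_def)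
    qed (use T0 in auto)
  qed
  have div: "ev T (\<lambda>t. B < h t)" for B by (rule ev_above_of_unbounded[OF o unb])
  \<comment> \<open>Any \<open>\<kappa> < 1\<close> with \<open>\<kappa> > \<rho>\<close> and \<open>\<kappa>\<^sup>2 \<ge> 1/2\<close> serves: the former for the trap, the latter for
    \<open>h\<^sup>2 \<le> 2 v\<^sup>2\<close>.\<close>
  define \<kappa> where "\<kappa> = max ((1 + \<rho>) / 2) (3 / 4)"
  have \<kappa>: "\<rho> < \<kappa>" "0 < \<kappa>" "\<kappa> < 1" "3 / 4 \<le> \<kappa>" using \<rho>_less by (auto simp: \<kappa>_def less_max_iff_disj)
  have fast: "ev T (\<lambda>t. \<kappa> * h t \<le> \<bar>v t\<bar>)"
  proof (rule ccontr)
    assume "\<not> ?thesis"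
    then have "(\<phi> 0, v 0) \<in> exceptional_data"
      using unbounded_orbit_exceptional_or_fast[OF o div \<kappa>(1-3)] exceptional_dataI(4,5)[OF o] by metis
    then show False using generic by (simp add: v_def)
  qed
  have fast': "ev T (\<lambda>t. (h t)\<^sup>2 \<le> 2 * (v t)\<^sup>2)"
  proof (rule ev_mono[OF fast])
    fix t assume t: "t \<in> life T" "\<kappa> * h t \<le> \<bar>v t\<bar>"
    have "0 < h t" by (rule orbitD(5)[OF o t(1)])
    have "3 / 4 * h t \<le> \<kappa> * h t" using \<kappa> \<open>0 < h t\<close> by (intro mult_right_mono) auto
    also have "\<dots> \<le> \<bar>v t\<bar>" by (rule t(2))
    finally have "(3 / 4 * h t)\<^sup>2 \<le> \<bar>v t\<bar>\<^sup>2" by (rule power_mono) (use \<open>0 < h t\<close> in simp)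
    then have "9 / 16 * (h t)\<^sup>2 \<le> (v t)\<^sup>2" by (simp add: power_mult_distrib power2_eq_square)
    moreover have "0 \<le> (h t)\<^sup>2" by simp
    ultimately show "(h t)\<^sup>2 \<le> 2 * (v t)\<^sup>2" by linarith
  qed
  obtain \<tau> where \<tau>: "T = ereal \<tau>"
    using fast_orbit_finite_lifetime[OF o \<kappa>(2) fast] T0 by (cases T) auto
  show ?thesis
    unfolding \<tau>
    using sol div scale_factor_vanishes[OF o div V_below a apos] expansion_rate_diverges[OF o div fast' a apos]
    unfolding h_def \<tau> by (intro black_hole_of_divergence) auto
qed

text \<open>\<open>R\<close> is chosen such that \<open>\<bar>x\<bar> \<ge> R\<close> implies that \<open>x\<close> lies beyond the sublevel set, where \<open>V > 0\<close> and the sign of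
  \<open>V'\<close> is prescribed, and that \<open>\<bar>u\<bar> < \<rho>\<close>, with \<open>\<rho>\<close> between the two upper limits and \<open>1\<close>.\<close>

lemma class_C_confining:
  assumes V: "V \<in> class_C" and adm: "admissible_level V c"
  obtains W' R \<rho> K where "confining_potential V (deriv V) W' R \<rho> K"
proof -
  let ?W = "deriv V"
  have cV: "V \<in> class_V" using V by (simp add: class_C_def)
  obtain D where D: "\<And>x. (V has_vector_derivative D x) (at x)"
    using cV unfolding class_V_def C1_differentiable_on_def by auto
  have VD: "(V has_real_derivative ?W x) (at x)" for x
    using D[of x] unfolding has_real_derivative_iff_has_vector_derivative[symmetric] by (simp add: DERIV_imp_deriv)
  obtain W' where W'v: "\<And>x. (?W has_vector_derivative W' x) (at x)" and W'c: "continuous_on UNIV W'"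
    using cV unfolding class_V_def C1_differentiable_on_def by auto
  have WD: "(?W has_real_derivative W' x) (at x)" for x
    using W'v by (simp add: has_real_derivative_iff_has_vector_derivative)
  obtain m where m: "\<And>x. m \<le> V x" using cV unfolding class_V_def bdd_below_def by auto
  have c: "0 < c" "sublevel V c \<noteq> {}" "bounded (sublevel V c)"
    and right: "\<And>x. Sup (sublevel V c) \<le> x \<Longrightarrow> 0 < ?W x" and left: "\<And>x. x \<le> Inf (sublevel V c) \<Longrightarrow> ?W x < 0"
    using adm unfolding admissible_level_def by auto
  obtain b where b: "\<And>x. x \<in> sublevel V c \<Longrightarrow> \<bar>x\<bar> \<le> b" using c(3) unfolding bounded_iff by auto
  have Sup: "Sup (sublevel V c) \<le> b" by (rule cSup_least[OF c(2)]) (use b in \<open>auto simp: abs_le_iff\<close>)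
  have Inf: "- b \<le> Inf (sublevel V c)" by (rule cInf_greatest[OF c(2)]) (use b in \<open>auto simp: abs_le_iff minus_le_iff\<close>)
  have Vpos: "0 < V x" if "b < \<bar>x\<bar>" for x
  proof -
    have "x \<notin> sublevel V c" using b[of x] that by auto
    then show ?thesis using c(1) by (simp add: sublevel_def)
  qed
  have lim: "Limsup at_top (\<lambda>x. ereal \<bar>u_fun V x\<bar>) < 1" "Limsup at_bot (\<lambda>x. ereal \<bar>u_fun V x\<bar>) < 1"
    using V by (auto simp: class_C_def)
  have "max (Limsup at_top (\<lambda>x. ereal \<bar>u_fun V x\<bar>)) (Limsup at_bot (\<lambda>x. ereal \<bar>u_fun V x\<bar>)) < 1" using lim by simp
  then obtain y where y: "max (Limsup at_top (\<lambda>x. ereal \<bar>u_fun V x\<bar>)) (Limsup at_bot (\<lambda>x. ereal \<bar>u_fun V x\<bar>)) < y" "y < 1"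
    using dense by blast
  have "\<forall>\<^sub>F x in at_top. ereal \<bar>u_fun V x\<bar> < y" "\<forall>\<^sub>F x in at_bot. ereal \<bar>u_fun V x\<bar> < y"
    using y(1) by (auto intro: Limsup_lessD)
  then obtain b1 b2 where b12: "\<And>x. b1 \<le> x \<Longrightarrow> ereal \<bar>u_fun V x\<bar> < y" "\<And>x. x \<le> b2 \<Longrightarrow> ereal \<bar>u_fun V x\<bar> < y"
    unfolding eventually_at_top_linorder eventually_at_bot_linorder by metis
  obtain \<rho> where \<rho>: "y = ereal \<rho>" using y(2) b12(1)[of b1] by (cases y) auto
  define R where "R = \<bar>b\<bar> + \<bar>b1\<bar> + \<bar>b2\<bar> + 1"
  have far: "0 < V x \<and> \<bar>?W x\<bar> \<le> \<rho> * (2 * sqrt 3 * V x)" if "R \<le> \<bar>x\<bar>" for x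
  proof -
    have V0: "0 < V x" using Vpos that by (simp add: R_def)
    have "b1 \<le> x \<or> x \<le> b2" using that by (auto simp: R_def abs_if split: if_splits)
    then have "\<bar>u_fun V x\<bar> < \<rho>" using b12[of x] \<rho> by auto
    then have "\<bar>?W x\<bar> / (2 * sqrt 3 * V x) < \<rho>" using V0 by (simp add: u_fun_def abs_mult)
    then show ?thesis using V0 by (simp add: field_simps)
  qed
  have u_deriv: "(W' x * V x - (?W x)\<^sup>2) / (V x)\<^sup>2 = 2 * sqrt 3 * deriv (u_fun V) x" if "R \<le> \<bar>x\<bar>" for x
  proof -
    have "V x \<noteq> 0" using far[OF that] by auto
    then have "((\<lambda>x. ?W x / V x / (2 * sqrt 3)) has_real_derivative
        (W' x * V x - ?W x * ?W x) / (V x * V x) / (2 * sqrt 3)) (at x)"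
      by (intro DERIV_cdivide DERIV_divide WD VD)
    moreover have "u_fun V = (\<lambda>x. ?W x / V x / (2 * sqrt 3))" by (simp add: u_fun_def fun_eq_iff ac_simps)
    ultimately have "deriv (u_fun V) x = (W' x * V x - (?W x)\<^sup>2) / (V x)\<^sup>2 / (2 * sqrt 3)"
      by (simp add: DERIV_imp_deriv power2_eq_square)
    then show ?thesis by simp
  qed
  have du: "(deriv (u_fun V) \<longlongrightarrow> 0) at_top" "(deriv (u_fun V) \<longlongrightarrow> 0) at_bot" using V by (auto simp: class_C_def)
  have "confining_potential V ?W W' R \<rho> (- m)"
  proof
    show "(V has_real_derivative ?W x) (at x)" "(?W has_real_derivative W' x) (at x)" "- (- m) \<le> V x" for x
      using VD WD m by auto
    show "continuous_on UNIV W'" by (rule W'c)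
    show "\<forall>\<^sub>F y in at x. ?W y \<noteq> 0" for x
    proof (cases "?W x = 0")
      case True
      have "discrete {x. ?W x = 0}" using cV by (simp add: class_V_def)
      then show ?thesis using True unfolding discrete_altdef by simp
    next
      case False
      have "(?W \<longlongrightarrow> ?W x) (at x)" using DERIV_isCont[OF WD] by (simp add: isCont_def)
      then show ?thesis using False by (rule tendsto_imp_eventually_ne)
    qed
    show "(\<forall>\<^sub>F y in at x. V x \<le> V y) \<or> (\<forall>\<^sub>F y in at x. V y \<le> V x)" if "?W x = 0" for x
      using cV that unfolding class_V_def by blast
    show "0 < R" by (simp add: R_def)
    show "\<rho> < 1" using y(2) \<rho> by simp
    show "0 < V x \<and> 0 < ?W x \<and> ?W x \<le> \<rho> * (2 * sqrt 3 * V x)" if "R \<le> x" for x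
    proof -
      have "0 < ?W x" by (rule right) (use Sup that in \<open>auto simp: R_def\<close>)
      then show ?thesis using far[of x] that by auto
    qed
    show "0 < V x \<and> ?W x < 0 \<and> - ?W x \<le> \<rho> * (2 * sqrt 3 * V x)" if "x \<le> - R" for x
    proof -
      have "?W x < 0" by (rule left) (use Inf that in \<open>auto simp: R_def\<close>)
      then show ?thesis using far[of x] that by auto
    qed
    have *: "((\<lambda>x. (W' x * V x - (?W x)\<^sup>2) / (V x)\<^sup>2) \<longlongrightarrow> 0) F"
      if "(deriv (u_fun V) \<longlongrightarrow> 0) F" "\<forall>\<^sub>F x in F. R \<le> \<bar>x\<bar>" for F
    proof -
      have "((\<lambda>x. 2 * sqrt 3 * deriv (u_fun V) x) \<longlongrightarrow> 2 * sqrt 3 * 0) F" by (intro tendsto_intros that)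
      moreover have "\<forall>\<^sub>F x in F. 2 * sqrt 3 * deriv (u_fun V) x = (W' x * V x - (?W x)\<^sup>2) / (V x)\<^sup>2"
        using that(2) by eventually_elim (simp add: u_deriv)
      ultimately show ?thesis by (simp add: tendsto_cong)
    qed
    show "((\<lambda>x. (W' x * V x - (?W x)\<^sup>2) / (V x)\<^sup>2) \<longlongrightarrow> 0) at_top"
      by (rule *[OF du(1)]) (auto simp: eventually_at_top_linorder intro!: exI[of _ R])
    show "((\<lambda>x. (W' x * V x - (?W x)\<^sup>2) / (V x)\<^sup>2) \<longlongrightarrow> 0) at_bot"
      by (rule *[OF du(2)]) (auto simp: eventually_at_bot_linorder intro!: exI[of _ "- R"])
  qed
  then show ?thesis by (rule that)
qed

theorem theorem5p1:
  fixes V :: "real \<Rightarrow> real" and Vstar :: real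
  assumes "V \<in> class_C" and "admissible_level V Vstar"
  shows "\<exists>N \<in> null_sets (lebesgue :: (real \<times> real) measure).
    \<forall>\<phi>\<^sub>0 v\<^sub>0. \<phi>\<^sub>0 \<in> sublevel V Vstar \<longrightarrow> v\<^sub>0\<^sup>2 + 2 * V \<phi>\<^sub>0 \<ge> 0 \<longrightarrow> (\<phi>\<^sub>0, v\<^sub>0) \<notin> N \<longrightarrow>
      (\<forall>T a \<phi> r\<^sub>b M U.
         maximal_collapsing_solution V T a \<phi> \<longrightarrow> \<phi> 0 = \<phi>\<^sub>0 \<longrightarrow> ddt T \<phi> 0 = v\<^sub>0 \<longrightarrow>
         vaidya_matching T a r\<^sub>b M U \<longrightarrow>
         collapses_to_black_hole V T a \<phi>)"
proof -
  obtain W' R \<rho> K where conf: "confining_potential V (deriv V) W' R \<rho> K"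
    by (rule class_C_confining[OF assms])
  interpret confining_potential V "deriv V" W' R \<rho> K by (rule conf)
  define N where "N = {(\<phi>, v). v\<^sup>2 + 2 * V \<phi> = 0} \<union> exceptional_data"
  have "continuous_on UNIV V" using V_isCont by (intro continuous_at_imp_continuous_on) auto
  then have "negligible N"
    unfolding N_def by (intro negligible_Un zero_energy_negligible exceptional_data_negligible)
  then have null: "N \<in> null_sets lebesgue" by (simp add: negligible_iff_null_sets)
  have "collapses_to_black_hole V T a \<phi>"
    if E: "(ddt T \<phi> 0)\<^sup>2 + 2 * V (\<phi> 0) \<ge> 0" and N: "(\<phi> 0, ddt T \<phi> 0) \<notin> N"
      and max: "maximal_collapsing_solution V T a \<phi>" for T a \<phi>
  proof (rule maximal_solution_collapses[OF conf max])
    show "0 < energy V T \<phi> 0" using E N by (auto simp: N_def energy_def)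
    show "(\<phi> 0, ddt T \<phi> 0) \<notin> exceptional_data" using N by (simp add: N_def)
  qed
  with null show ?thesis by (intro bexI[of _ N]) auto
qed

end
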